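(* Let $\tilde d(r,z)$ denote the Carnot-Carathéodory distance from the identity to the point of $\widetilde{\mathbf{SL}(2,\mathbb{R})}$ with cylindrical coordinates $(r,\theta,z)$ (it does not depend on $\theta$). Then: (i) for $z\in\mathbb{R}$, $\tilde d^2(0,z)=2\pi|z|+z^2$; (ii) for $r>0$, $\tilde d^2(r,0)=r^2$; (iii) for $r>0$ and $z\in\mathbb{R}$, $z\ne0$, $$\tilde d^2(r,z)=\frac{(\theta(r,z)-z)^2\tanh^2 r}{\sin^2\theta(r,z)},$$ where $\theta(r,z)$ is the unique solution in $\left(-\arccos\left(\frac{-1}{\cosh r}\right),\arccos\left(\frac{-1}{\cosh r}\right)\right)$ of $$\theta-z=\cosh r\,\sin\theta\,\frac{\operatorname{arccosh}(\cosh r\cos\theta)}{\sqrt{\cosh^2 r\cos^2\theta-1}}.$$ Moreover, if $d(r,z)$ denotes the Carnot-Carathéodory distance from the identity to the point of $\mathbf{SL}(2,\mathbb{R})$ with cylindrical coordinates $(r,\theta,z)$, then $d(r,z)=\tilde d(r,z)$ for all $r>0$ and $z\in[-\pi,\pi]$.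
   Context: Let $X=\begin{pmatrix}1&0\\0&-1\end{pmatrix}$, $Y=\begin{pmatrix}0&1\\1&0\end{pmatrix}$, $Z=\begin{pmatrix}0&1\\-1&0\end{pmatrix}$, a basis of $\mathfrak{sl}(2,\mathbb{R})$; the same letters denote the left-invariant vector fields they generate on $\mathbf{SL}(2,\mathbb{R})$, and $\tilde X,\tilde Y,\tilde Z$ the left-invariant vector fields they generate on the universal covering group $\widetilde{\mathbf{SL}(2,\mathbb{R})}$. Cylindrical coordinates are $(r,\theta,z)\mapsto\exp(r\cos\theta\,X+r\sin\theta\,Y)\exp(zZ)$ with $r>0$, $\theta\in[0,2\pi]$, $z\in[-\pi,\pi]$ on $\mathbf{SL}(2,\mathbb{R})$, and the same formula with $\tilde X,\tilde Y,\tilde Z$ and $z\in\mathbb{R}$ on $\widetilde{\mathbf{SL}(2,\mathbb{R})}$; $r=0$ corresponds to the points $\exp(z\tilde Z)$. The Carnot-Carathéodory distance on $\mathbf{SL}(2,\mathbb{R})$ is $d(g_1,g_2)=\sup\{|f(g_1)-f(g_2)|: f \text{ smooth},\ (Xf)^2+(Yf)^2\le1\}$, equivalently the minimal length of horizontal curves (tangent to $\mathrm{span}(X,Y)$, with $X,Y$ orthonormal) joining $g_1$ to $g_2$; $\tilde d$ is defined in the same way on $\widetilde{\mathbf{SL}(2,\mathbb{R})}$ with $\tilde X,\tilde Y$. The function $u\mapsto\frac{\operatorname{arccosh}u}{\sqrt{u^2-1}}$ is extended analytically to $(-1,\infty)$: it equals $\frac{\arccos u}{\sqrt{1-u^2}}$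 for $-1<u<1$ and $1$ for $u=1$. *)

theory Defs
  imports "HOL-Analysis.Analysis" "HOL-Algebra.Group"
begin

section \<open>The group SL(2,R) and its universal covering group\<close>

definition X_mat :: "real^2^2" where "X_mat = vector [vector [1, 0], vector [0, -1]]"
definition Y_mat :: "real^2^2" where "Y_mat = vector [vector [0, 1], vector [1, 0]]"
definition Z_mat :: "real^2^2" where "Z_mat = vector [vector [0, 1], vector [-1, 0]]"

definition SL2 :: "(real^2^2) monoid" where
  "SL2 = \<lparr>carrier = {A. det A = 1}, mult = (**), one = mat 1\<rparr>"

text \<open>The library operations \<open>*\<close> and \<open>^\<close> on matrices are componentwise,
  so the powers in the exponential series are iterates of \<open>**\<close>.\<close>

definition mat_exp :: "real^2^2 \<Rightarrow> real^2^2" where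
  "mat_exp A = (\<Sum>n. (1 / fact n) *\<^sub>R (((**) A ^^ n) (mat 1)))"

definition universal_covering_group ::
    "('g::topological_space) monoid \<Rightarrow> ('g \<Rightarrow> real^2^2) \<Rightarrow> bool" where
  "universal_covering_group G p \<longleftrightarrow>
     group G \<and>
     continuous_on (carrier G \<times> carrier G) (\<lambda>(x, y). x \<otimes>\<^bsub>G\<^esub> y) \<and>
     continuous_on (carrier G) (\<lambda>x. inv\<^bsub>G\<^esub> x) \<and>
     simply_connected (carrier G) \<and>
     p \<in> hom G SL2 \<and>
     covering_space (carrier G) p (carrier SL2)"

text \<open>In what follows \<open>p\<close> is a covering homomorphism from \<open>G\<close> to \<open>SL2\<close>;
  taking \<open>G = SL2\<close> and \<open>p = id\<close> gives the notions on SL(2,R) itself.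
  The Lie algebra of \<open>G\<close> is identified with that of SL(2,R) through the local diffeomorphism \<open>p\<close>,
  so \<open>lie_exp G p A\<close> is the time-one point of the one-parameter
  subgroup of \<open>G\<close> that lies over \<open>t \<mapsto> exp (t A)\<close>.\<close>

definition lie_exp :: "('g::topological_space) monoid \<Rightarrow> ('g \<Rightarrow> real^2^2) \<Rightarrow> real^2^2 \<Rightarrow> 'g" where
  "lie_exp G p A = (THE g. \<exists>\<gamma> :: real \<Rightarrow> 'g.
     continuous_on UNIV \<gamma> \<and> (\<forall>t. \<gamma> t \<in> carrier G) \<and>
     (\<forall>s t. \<gamma> (s + t) = \<gamma> s \<otimes>\<^bsub>G\<^esub> \<gamma> t) \<and>
     (\<forall>t. p (\<gamma> t) = mat_exp (t *\<^sub>R A)) \<and>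
     g = \<gamma> 1)"

definition left_invariant_field ::
    "('g::topological_space) monoid \<Rightarrow> ('g \<Rightarrow> real^2^2) \<Rightarrow> real^2^2 \<Rightarrow> ('g \<Rightarrow> real) \<Rightarrow> 'g \<Rightarrow> real" where
  "left_invariant_field G p A f g = deriv (\<lambda>t. f (g \<otimes>\<^bsub>G\<^esub> lie_exp G p (t *\<^sub>R A))) 0"

section \<open>Smooth functions\<close>

primrec Ck_on :: "nat \<Rightarrow> 'a::real_normed_vector set \<Rightarrow> ('a \<Rightarrow> real) \<Rightarrow> bool" where
  "Ck_on 0 W F \<longleftrightarrow> continuous_on W F"
| "Ck_on (Suc k) W F \<longleftrightarrow>
     (\<forall>x\<in>W. F differentiable (at x)) \<and> (\<forall>v. Ck_on k W (\<lambda>x. frechet_derivative F (at x) v))"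

text \<open>Smoothness for the manifold structure on \<open>G\<close> that makes \<open>p\<close> a local diffeomorphism
  onto the submanifold SL(2,R) of the space of matrices: locally, \<open>f\<close> is the composition of \<open>p\<close>
  with a smooth function on an open set of matrices.\<close>

definition smooth_function ::
    "('g::topological_space) monoid \<Rightarrow> ('g \<Rightarrow> real^2^2) \<Rightarrow> ('g \<Rightarrow> real) \<Rightarrow> bool" where
  "smooth_function G p f \<longleftrightarrow>
     (\<forall>g\<in>carrier G. \<exists>U W F. openin (top_of_set (carrier G)) U \<and> g \<in> U \<and>
        open W \<and> p ` U \<subseteq> W \<and> (\<forall>k. Ck_on k W F) \<and> (\<forall>x\<in>U. f x = F (p x)))"

section \<open>Carnot-Caratheodory distance and cylindrical coordinates\<close>

text \<open>The supremum is taken in the extended reals, so no boundedness is presupposed.\<close>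

definition cc_dist :: "('g::topological_space) monoid \<Rightarrow> ('g \<Rightarrow> real^2^2) \<Rightarrow> 'g \<Rightarrow> 'g \<Rightarrow> ereal" where
  "cc_dist G p g1 g2 =
     (SUP f \<in> {f. smooth_function G p f \<and>
                  (\<forall>g\<in>carrier G. (left_invariant_field G p X_mat f g)\<^sup>2 +
                                 (left_invariant_field G p Y_mat f g)\<^sup>2 \<le> 1)}.
        ereal \<bar>f g1 - f g2\<bar>)"

definition cyl_point ::
    "('g::topological_space) monoid \<Rightarrow> ('g \<Rightarrow> real^2^2) \<Rightarrow> real \<Rightarrow> real \<Rightarrow> real \<Rightarrow> 'g" where
  "cyl_point G p r \<phi> z =
     lie_exp G p ((r * cos \<phi>) *\<^sub>R X_mat + (r * sin \<phi>) *\<^sub>R Y_mat) \<otimes>\<^bsub>G\<^esub> lie_exp G p (z *\<^sub>R Z_mat)"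

definition cc_dist_cyl ::
    "('g::topological_space) monoid \<Rightarrow> ('g \<Rightarrow> real^2^2) \<Rightarrow> real \<Rightarrow> real \<Rightarrow> real \<Rightarrow> ereal" where
  "cc_dist_cyl G p r \<phi> z = cc_dist G p \<one>\<^bsub>G\<^esub> (cyl_point G p r \<phi> z)"

section \<open>The equation for theta\<close>

text \<open>The analytic extension of \<open>arcosh u / sqrt (u\<^sup>2 - 1)\<close> to \<open>u > -1\<close>.\<close>

definition arcosh_quot :: "real \<Rightarrow> real" where
  "arcosh_quot u =
     (if u > 1 then arcosh u / sqrt (u\<^sup>2 - 1)
      else if u = 1 then 1
      else arccos u / sqrt (1 - u\<^sup>2))"

definition theta_solution :: "real \<Rightarrow> real \<Rightarrow> real \<Rightarrow> bool" where
  "theta_solution r z \<theta> \<longleftrightarrow>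
     \<theta> \<in> {- arccos (-1 / cosh r) <..< arccos (-1 / cosh r)} \<and>
     \<theta> - z = cosh r * sin \<theta> * arcosh_quot (cosh r * cos \<theta>)"

end

(* The distance is a supremum over smooth functions f with horizontal gradient at most 1.

   Upper bound: integrate such an f along the sub-Riemannian geodesic
   exp (t (A + l Z)) exp (- t l Z) with A in span (X, Y) of norm 1. For l = sin theta / tanh r and
   t = sinh r * arcosh_quot (cosh r cos theta) it ends at the point with coordinates (r, phi, z).

   Lower bound: let Phi (cosh r, z) be the claimed distance. On r > 0 it is smooth, and
   d Phi = cos theta dr - (sin theta / tanh r) dz, so it solves the eikonal equation
   (d_r Phi)^2 + tanh^2 r (d_z Phi)^2 = 1, which says that its horizontal gradient has norm 1.
   It is singular on the axis r = 0 only; replacing r by rho with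
   cosh^2 rho = cosh^2 r + epsilon^2 never reaches the axis and does not increase the gradient, so
   f = Phi (cosh rho, z) is admissible on the universal covering group, and epsilon -> 0 gives the bound.
   On SL(2,R), where z is only defined modulo 2 pi, |z| is replaced by arccos (k cos z) with k < 1,
   whose derivative is at most 1, and k -> 1.

   The value on the axis is the limit r -> 0 of the identity
   Phi^2 = (theta - z)^2 + (cosh^2 r cos^2 theta - 1) arcosh_quot^2, where theta tends to -pi for z > 0. *)

theory Submission
  imports Defs
begin

text \<open>No optimality theory of geodesics enters: a single horizontal curve bounds every
  admissible function from above, and a family of admissible functions approaches that bound. Three
  obstacles shape the rest. The curves with l^2 < 1, l^2 = 1 and l^2 > 1 involve hyperbolic,
  polynomial and trigonometric functions; the entire function cosh (sqrt x) treats them by one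
  formula and gives smoothness across cosh r cos theta = 1. The group G is known only as a
  topological covering. A curve of matrices determines an end point in G only through its lift, so
  end points are followed by means of a continuous angle; on the simply connected group, the
  coordinate z is obtained from logarithms of \<open>cu\<close> lifted along paths. Replacing r by
  rho weakens the two parts of the gradient for different reasons: the cos^2 theta part because cosh
  r sinh r \<le> cosh rho sinh rho, the sin^2 theta part because tanh r \<le> tanh rho.\<close>

section \<open>The function arcosh u / sqrt (u^2 - 1)\<close>

text \<open>The index in \<open>cser 1\<close> must not be rewritten to \<open>Suc 0\<close>.\<close>

declare One_nat_def [simp del]

text \<open>\<open>cser k\<close> is the \<open>k\<close>-th derivative of the entire function \<open>x \<mapsto> cosh (sqrt x)\<close>; in particular
  \<open>2 * cser 1 (t\<^sup>2) = sinh t / t\<close>, so that \<open>arcosh_quot\<close> becomes \<open>1 / (2 cser 1)\<close> in the variable \<open>x\<close>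
  and is visibly analytic at \<open>u = 1\<close>.\<close>

definition cser :: "nat \<Rightarrow> real \<Rightarrow> real" where
  "cser k x = (\<Sum>n. (diffs ^^ k) (\<lambda>n. 1 / fact (2 * n)) n * x ^ n)"

lemma cser_summable: "summable (\<lambda>n. (diffs ^^ k) (\<lambda>n. 1 / fact (2 * n) :: real) n * x ^ n)"
proof (induction k arbitrary: x)
  case 0
  have "summable (\<lambda>n. norm (x ^ n / fact n))"
    using summable_norm_exp[of x] by (simp add: divide_inverse_commute)
  moreover have "norm (1 / fact (2 * n) * x ^ n) \<le> norm (x ^ n / fact n)" for n
  proof -
    have "(fact n :: real) \<le> fact (2 * n)" by (intro fact_mono) auto
    then show ?thesis by (simp add: abs_mult divide_simps mult_left_mono)
  qed
  ultimately show ?case by (auto intro: summable_comparison_test')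
next
  case (Suc k)
  then show ?case by (simp add: termdiff_converges_all)
qed

lemma cser_deriv: "(cser k has_real_derivative cser (Suc k) x) (at x)"
  using termdiffs_strong_converges_everywhere[OF cser_summable[of k], of x]
  by (simp add: cser_def[abs_def])

lemma cser_coeff_pos: "(diffs ^^ k) (\<lambda>n. 1 / fact (2 * n) :: real) n > 0"
  by (induction k arbitrary: n) (auto simp: diffs_def)

lemma cser_pos_nonneg: "x \<ge> 0 \<Longrightarrow> cser k x > 0"
  unfolding cser_def
  by (rule suminf_pos2[OF cser_summable, where i = 0])
     (use cser_coeff_pos[of k] less_imp_le[OF cser_coeff_pos[of k]] in auto)

lemma cser_0_square: "cser 0 (t\<^sup>2) = cosh t"
proof -
  have "(\<lambda>n. if even n then t ^ n /\<^sub>R fact n else 0) sums cosh t" by (rule cosh_converges)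
  then have "(\<lambda>n. t ^ (2*n) /\<^sub>R fact (2*n)) sums cosh t"
    using sums_mono_reindex[of "\<lambda>n::nat. 2 * n" "\<lambda>n. if even n then t ^ n /\<^sub>R fact n else 0" "cosh t"]
    by (simp add: strict_mono_def image_iff) (metis dvd_def)
  then show ?thesis
    by (simp add: cser_def sums_iff power_mult divide_inverse)
qed

lemma cser_0_neg_square: "cser 0 (- t\<^sup>2) = cos t"
proof -
  have "(\<lambda>n. (- 1) ^ n / (fact (2 * n)) * t ^ (2 * n)) sums cos t" by (rule cos_paired)
  moreover have "(- 1) ^ n / (fact (2 * n)) * t ^ (2 * n) = 1 / fact (2 * n) * (- t\<^sup>2) ^ n" for n
    by (simp add: power_mult power_minus[of "t\<^sup>2"])
  ultimately show ?thesis by (simp add: cser_def sums_iff)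
qed

text \<open>Differentiating \<open>cser 0 (t^2) = cosh t\<close> in two ways spares a comparison of
  coefficients.\<close>

lemma cser_1_square: "2 * t * cser 1 (t\<^sup>2) = sinh t"
proof -
  have "((\<lambda>t. cser 0 (t\<^sup>2)) has_real_derivative cser 1 (t\<^sup>2) * (2 * t)) (at t)"
    by (rule DERIV_chain2[OF cser_deriv[of 0, folded One_nat_def]]) (auto intro!: derivative_eq_intros)
  moreover have "((\<lambda>t. cser 0 (t\<^sup>2)) has_real_derivative sinh t) (at t)"
    unfolding cser_0_square by (auto intro!: derivative_eq_intros)
  ultimately show ?thesis using DERIV_unique by (fastforce simp: mult_ac)
qed

lemma cser_1_neg_square: "2 * t * cser 1 (- t\<^sup>2) = sin t"
proof -
  have "((\<lambda>t. cser 0 (- t\<^sup>2)) has_real_derivative cser 1 (- t\<^sup>2) * (- (2 * t))) (at t)"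
    by (rule DERIV_chain2[OF cser_deriv[of 0, folded One_nat_def]]) (auto intro!: derivative_eq_intros)
  moreover have "((\<lambda>t. cser 0 (- t\<^sup>2)) has_real_derivative - sin t) (at t)"
    unfolding cser_0_neg_square by (auto intro!: derivative_eq_intros)
  ultimately show ?thesis using DERIV_unique by (fastforce simp: mult_ac)
qed

lemma real_square_cases:
  fixes x :: real
  obtains t where "t \<ge> 0" "x = t\<^sup>2" | t where "t > 0" "x = - t\<^sup>2"
proof (cases "x \<ge> 0")
  case True then show ?thesis using that(1)[of "sqrt x"] by auto
next
  case False then show ?thesis using that(2)[of "sqrt (- x)"] by auto
qed

lemma cser_pythagoras: "(cser 0 x)\<^sup>2 - 4 * x * (cser 1 x)\<^sup>2 = 1"
proof (cases x rule: real_square_cases)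
  case (1 t)
  have "4 * x * (cser 1 x)\<^sup>2 = (2 * t * cser 1 (t\<^sup>2))\<^sup>2" using 1 by (simp add: power2_eq_square)
  then show ?thesis using 1 cosh_square_eq[of t] by (simp only: cser_0_square cser_1_square)
next
  case (2 t)
  have "4 * x * (cser 1 x)\<^sup>2 = - (2 * t * cser 1 (- t\<^sup>2))\<^sup>2" using 2 by (simp add: power2_eq_square)
  then show ?thesis using 2 by (simp only: cser_0_neg_square cser_1_neg_square) simp
qed

lemma cser_ode: "2 * cser 1 x + 4 * x * cser 2 x = cser 0 x"
proof (cases x rule: real_square_cases)
  case (1 t)
  have "((\<lambda>t. 2 * t * cser 1 (t\<^sup>2)) has_real_derivative 2 * cser 1 (t\<^sup>2) + 2 * t * (cser 2 (t\<^sup>2) * (2 * t))) (at t)"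
    by (rule derivative_eq_intros DERIV_chain2[OF cser_deriv] refl)+ (simp add: numeral_2_eq_2 One_nat_def)
  moreover have "((\<lambda>t. 2 * t * cser 1 (t\<^sup>2)) has_real_derivative cosh t) (at t)"
    unfolding cser_1_square by (auto intro!: derivative_eq_intros)
  ultimately have "2 * cser 1 (t\<^sup>2) + 2 * t * (cser 2 (t\<^sup>2) * (2 * t)) = cosh t" using DERIV_unique by blast
  then show ?thesis unfolding \<open>x = t\<^sup>2\<close> cser_0_square by (simp add: power2_eq_square mult_ac)
next
  case (2 t)
  have "((\<lambda>t. 2 * t * cser 1 (- t\<^sup>2)) has_real_derivative 2 * cser 1 (- t\<^sup>2) + 2 * t * (cser 2 (- t\<^sup>2) * (- (2 * t)))) (at t)"
    by (rule derivative_eq_intros DERIV_chain2[OF cser_deriv] refl)+ (simp add: numeral_2_eq_2 One_nat_def)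
  moreover have "((\<lambda>t. 2 * t * cser 1 (- t\<^sup>2)) has_real_derivative cos t) (at t)"
    unfolding cser_1_neg_square by (auto intro!: derivative_eq_intros)
  ultimately have "2 * cser 1 (- t\<^sup>2) + 2 * t * (cser 2 (- t\<^sup>2) * (- (2 * t))) = cos t" using DERIV_unique by blast
  then show ?thesis unfolding \<open>x = - t\<^sup>2\<close> cser_0_neg_square by (simp add: power2_eq_square mult_ac)
qed

lemma neg_square_gt_neg_pi_square: "t > 0 \<Longrightarrow> - t\<^sup>2 > - pi\<^sup>2 \<Longrightarrow> t < pi"
  by (meson neg_less_iff_less pi_ge_zero power_less_imp_less_base)

text \<open>For x = - t^2 the sign is that of sin t / t, which first vanishes at t = pi; hence the
  bound - pi^2, which corresponds to u = -1.\<close>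

lemma cser_1_pos: "x > - pi\<^sup>2 \<Longrightarrow> cser 1 x > 0"
proof (cases x rule: real_square_cases)
  case (2 t)
  assume "x > - pi\<^sup>2"
  with 2 have "t < pi" by (metis neg_square_gt_neg_pi_square)
  with 2 have "2 * t * cser 1 x > 0" using sin_gt_zero[of t] by (simp add: cser_1_neg_square)
  with 2 show ?thesis by (simp add: zero_less_mult_iff)
qed (use cser_pos_nonneg in auto)

lemma sin_gt_x_cos:
  assumes "0 < t" "t < pi" shows "t * cos t < sin t"
proof -
  have "\<exists>y. 0 < y \<and> y < t \<and> (sin t - t * cos t) - (sin 0 - 0 * cos 0) = (t - 0) * (y * sin y)"
    by (rule MVT2) (use assms in \<open>auto intro!: derivative_eq_intros\<close>)
  then obtain y where "0 < y" "y < t" "sin t - t * cos t = t * (y * sin y)" by auto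
  then show ?thesis using sin_gt_zero[of y] assms
    by (smt (verit) mult_pos_pos)
qed

text \<open>For x = - t^2, \<open>cser_ode\<close> becomes
  \<open>4 t^3 cser 2 x = sin t - t cos t\<close>. This sign makes \<open>arcosh_quot\<close>
  strictly decreasing and thereby the equation for theta uniquely solvable.\<close>

lemma cser_2_pos: "x > - pi\<^sup>2 \<Longrightarrow> cser 2 x > 0"
proof (cases x rule: real_square_cases)
  case (2 t)
  assume "x > - pi\<^sup>2"
  with 2 have "t < pi" by (metis neg_square_gt_neg_pi_square)
  have "t * (2 * cser 1 x + 4 * x * cser 2 x) = t * cser 0 x" by (simp only: cser_ode)
  then have "sin t - 4 * t ^ 3 * cser 2 x = t * cos t"
    unfolding \<open>x = - t\<^sup>2\<close> cser_0_neg_square using cser_1_neg_square[of t]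
    by (simp add: algebra_simps power3_eq_cube power2_eq_square)
  then have "4 * t ^ 3 * cser 2 x > 0" using sin_gt_x_cos[of t] 2 \<open>t < pi\<close> by simp
  with 2 show ?thesis by (simp add: zero_less_mult_iff)
qed (use cser_pos_nonneg in auto)

section \<open>The inverse function of cosh (sqrt x) and the arcosh quotient\<close>

definition csinv :: "real \<Rightarrow> real" where
  "csinv u = (if u \<ge> 1 then (arcosh u)\<^sup>2 else - (arccos u)\<^sup>2)"

lemma csinv_cser: "x > - pi\<^sup>2 \<Longrightarrow> csinv (cser 0 x) = x"
proof (cases x rule: real_square_cases)
  case (1 t)
  then show ?thesis
    by (simp add: csinv_def cser_0_square cosh_real_ge_1 arcosh_cosh_real)
next
  case (2 t)
  assume "x > - pi\<^sup>2"
  with 2 have "t < pi" by (metis neg_square_gt_neg_pi_square)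
  with 2 have "cos t < cos 0" by (intro cos_monotone_0_pi) auto
  with 2 \<open>t < pi\<close> show ?thesis by (simp add: csinv_def cser_0_neg_square arccos_cos)
qed

lemma csinv:
  assumes "u > -1" shows "cser 0 (csinv u) = u" "csinv u > - pi\<^sup>2"
proof -
  show "cser 0 (csinv u) = u"
    using assms by (auto simp: csinv_def cser_0_square cser_0_neg_square cosh_arcosh_real cos_arccos)
  have "arccos u < arccos (- 1)" if "u < 1" using assms that by (intro arccos_less_arccos) auto
  moreover have "u < 1 \<Longrightarrow> arccos u \<ge> 0" using assms by (intro arccos_lbound) auto
  ultimately have "u < 1 \<Longrightarrow> (arccos u)\<^sup>2 < pi\<^sup>2" by (intro power_strict_mono) auto
  moreover have "0 < pi\<^sup>2" by simp
  ultimately show "csinv u > - pi\<^sup>2"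
    using zero_le_power2[of "arcosh u"] unfolding csinv_def by (smt (verit))
qed

text \<open>Inverse function theorem for \<open>cser 0\<close> on x > - pi^2. As
  \<open>csinv\<close> is the square of the analytically continued arcosh, it is regular at u = 1,
  where arcosh itself is not.\<close>

lemma csinv_deriv:
  assumes "u > -1"
  shows "(csinv has_real_derivative inverse (cser 1 (csinv u))) (at u)"
proof -
  have "(csinv has_derivative (\<lambda>h. h / cser 1 (csinv u))) (at (cser 0 (csinv u)))"
  proof (rule has_derivative_inverse_strong[where S = "{- pi\<^sup>2 <..}" and f = "cser 0"
        and f' = "\<lambda>h. h * cser 1 (csinv u)"])
    show "continuous_on {- pi\<^sup>2<..} (cser 0)"
      using cser_deriv by (meson DERIV_continuous continuous_at_imp_continuous_on)
    show "(cser 0 has_derivative (\<lambda>h. h * cser 1 (csinv u))) (at (csinv u))"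
      using cser_deriv[of 0 "csinv u"] by (simp add: has_field_derivative_def One_nat_def mult_commute_abs)
    have "cser 1 (csinv u) \<noteq> 0" using cser_1_pos[OF csinv(2)[OF assms]] by simp
    then show "(\<lambda>h. h * cser 1 (csinv u)) \<circ> (\<lambda>h. h / cser 1 (csinv u)) = id" by auto
  qed (use csinv_cser csinv[OF assms] in auto)
  then show ?thesis using csinv[OF assms]
    by (simp add: has_field_derivative_def divide_inverse mult_commute_abs)
qed

lemma arcosh_quot_eq:
  assumes "u > -1" shows "arcosh_quot u = 1 / (2 * cser 1 (csinv u))"
proof -
  consider "u > 1" | "u = 1" | "u < 1" by linarith
  then show ?thesis
  proof cases
    case 1
    let ?t = "arcosh u"
    have t: "?t > 0" using 1 by (simp add: arcosh_real_gt_1_iff)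
    have "2 * ?t * cser 1 (?t\<^sup>2) = sqrt (u\<^sup>2 - 1)"
      using 1 by (simp add: cser_1_square sinh_arcosh_real)
    moreover have "sqrt (u\<^sup>2 - 1) > 0" using 1 by simp
    moreover have "cser 1 (?t\<^sup>2) > 0" by (simp add: cser_pos_nonneg)
    moreover have "u\<^sup>2 \<noteq> 1" using 1 by (simp add: power2_eq_1_iff)
    ultimately show ?thesis using 1 t
      by (simp add: arcosh_quot_def csinv_def field_simps)
  next
    case 2
    \<comment> \<open>The constant coefficient of \<open>cser 1\<close> is
      \<open>1 / fact 2\<close>, so the value at u = 1 is indeed 1.\<close>
    have "cser 1 0 = diffs (\<lambda>n. 1 / fact (2 * n)) 0" unfolding cser_def by (simp add: One_nat_def)
    then show ?thesis using 2 by (simp add: arcosh_quot_def csinv_def diffs_def)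
  next
    case 3
    let ?t = "arccos u"
    have t: "?t > 0" using 3 assms arccos_lt_bounded[of u] by simp
    have "2 * ?t * cser 1 (- ?t\<^sup>2) = sqrt (1 - u\<^sup>2)"
      using 3 assms by (simp add: cser_1_neg_square sin_arccos)
    moreover have "u\<^sup>2 < 1" using 3 assms by (simp add: abs_square_less_1)
    then have "sqrt (1 - u\<^sup>2) > 0" by simp
    moreover have "cser 1 (- ?t\<^sup>2) > 0" using csinv(2)[OF assms] 3 by (simp add: cser_1_pos csinv_def)
    ultimately show ?thesis using 3 t
      by (simp add: arcosh_quot_def csinv_def divide_simps)
  qed
qed

definition arcosh_quot_deriv :: "real \<Rightarrow> real" where
  "arcosh_quot_deriv u = - cser 2 (csinv u) / (2 * cser 1 (csinv u) ^ 3)"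

lemma has_real_derivative_arcosh_quot:
  assumes "u > -1" shows "(arcosh_quot has_real_derivative arcosh_quot_deriv u) (at u)"
proof -
  have pos: "cser 1 (csinv u) > 0" using cser_1_pos csinv assms by blast
  have "((\<lambda>u. 1 / (2 * cser 1 (csinv u))) has_real_derivative arcosh_quot_deriv u) (at u)"
    by (rule derivative_eq_intros DERIV_chain2[OF cser_deriv] csinv_deriv[OF assms] refl)+
       (use pos in \<open>auto simp: arcosh_quot_deriv_def numeral_2_eq_2 power3_eq_cube field_simps\<close>)
  then show ?thesis
    by (rule has_field_derivative_transform_within_open[where S = "{-1<..}"])
       (use assms arcosh_quot_eq in auto)
qed

lemma arcosh_quot_deriv_neg: "u > -1 \<Longrightarrow> arcosh_quot_deriv u < 0"
  using cser_1_pos cser_2_pos csinv by (simp add: arcosh_quot_deriv_def divide_simps)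

lemma arcosh_quot_pos: "u > -1 \<Longrightarrow> arcosh_quot u > 0"
  using cser_1_pos csinv by (simp add: arcosh_quot_eq)

lemma arcosh_quot_square:
  assumes "u > -1" shows "(u\<^sup>2 - 1) * (arcosh_quot u)\<^sup>2 = csinv u"
  using cser_pythagoras[of "csinv u"] cser_1_pos[OF csinv(2)[OF assms]] csinv[OF assms]
  by (simp add: arcosh_quot_eq[OF assms] divide_simps algebra_simps power2_eq_square)

text \<open>The linear equation of arcosh u / sqrt (u^2 - 1), regular at u = 1. The derivatives of
  \<open>theta_fun\<close>, \<open>Theta\<close> and \<open>Phi\<close> all simplify through
  it.\<close>

lemma arcosh_quot_ode:
  assumes "u > -1" shows "(u\<^sup>2 - 1) * arcosh_quot_deriv u + u * arcosh_quot u = 1"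
proof -
  define a b x where "a = cser 1 (csinv u)" "b = cser 2 (csinv u)" "x = csinv u"
  have a: "a > 0" using cser_1_pos csinv assms by (auto simp: a_b_x_def)
  have 1: "u\<^sup>2 - 1 = 4 * x * a\<^sup>2" using cser_pythagoras[of x] csinv[OF assms] by (simp add: a_b_x_def)
  have 2: "u = 2 * a + 4 * x * b" using cser_ode[of x] csinv[OF assms] by (simp add: a_b_x_def)
  have "(u\<^sup>2 - 1) * arcosh_quot_deriv u + u * arcosh_quot u
      = 4 * x * a\<^sup>2 * (- b / (2 * a ^ 3)) + (2 * a + 4 * x * b) * (1 / (2 * a))"
    using 2 unfolding 1 by (simp add: arcosh_quot_deriv_def arcosh_quot_eq[OF assms] a_b_x_def)
  also have "\<dots> = 1" using a by (simp add: field_simps power2_eq_square power3_eq_cube)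
  finally show ?thesis .
qed

section \<open>The equation for theta and the distance as a function of cosh r and z\<close>

definition theta_fun :: "real \<Rightarrow> real \<Rightarrow> real" where
  "theta_fun c \<theta> = \<theta> - c * sin \<theta> * arcosh_quot (c * cos \<theta>)"

text \<open>The interval of the theorem, written so that \<open>c * cos \<theta>\<close> visibly
  lies in the domain of \<open>arcosh_quot\<close> and the condition is open jointly in c and
  \<theta>.\<close>

definition theta_dom :: "real \<Rightarrow> real \<Rightarrow> bool" where
  "theta_dom c \<theta> \<longleftrightarrow> \<bar>\<theta>\<bar> < pi \<and> c * cos \<theta> > -1"

lemma theta_dom_iff:
  assumes "c > 1" shows "theta_dom c \<theta> \<longleftrightarrow> \<bar>\<theta>\<bar> < arccos (-1 / c)"
proof -
  have m: "arccos (-1 / c) < pi" "0 \<le> arccos (-1/c)" "cos (arccos (-1/c)) = -1/c"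
    using assms arccos_lt_bounded[of "-1/c"] by (auto simp: divide_simps intro!: cos_arccos)
  have "c * cos \<theta> > -1 \<longleftrightarrow> \<bar>\<theta>\<bar> < arccos (-1 / c)" if "\<bar>\<theta>\<bar> < pi"
  proof -
    have "c * cos \<theta> > -1 \<longleftrightarrow> cos (arccos (-1/c)) < cos \<bar>\<theta>\<bar>"
      using assms by (simp add: m field_simps)
    also have "\<dots> \<longleftrightarrow> \<bar>\<theta>\<bar> < arccos (-1 / c)"
      using m that by (intro cos_mono_less_eq) auto
    finally show ?thesis .
  qed
  then show ?thesis using m unfolding theta_dom_def by auto
qed

lemma theta_solution_iff:
  assumes "r > 0"
  shows "theta_solution r z \<theta> \<longleftrightarrow> theta_dom (cosh r) \<theta> \<and> theta_fun (cosh r) \<theta> = z"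
proof -
  have "cosh r > 1" using assms cosh_real_strict_mono[of 0 r] by simp
  then show ?thesis using theta_dom_iff[of "cosh r" \<theta>]
    by (auto simp: theta_solution_def theta_fun_def)
qed

text \<open>\<open>arcosh_quot_ode\<close> collapses the derivative to one term, which is negative
  for c > 1.\<close>

lemma theta_fun_deriv:
  assumes "theta_dom c \<theta>"
  shows "(theta_fun c has_real_derivative (c\<^sup>2 - 1) * arcosh_quot_deriv (c * cos \<theta>)) (at \<theta>)"
proof -
  let ?u = "c * cos \<theta>"
  have u: "?u > -1" using assms by (simp add: theta_dom_def)
  have "((\<lambda>\<theta>. \<theta> - c * sin \<theta> * arcosh_quot (c * cos \<theta>)) has_real_derivative
      1 - (c * cos \<theta> * arcosh_quot ?u + c * sin \<theta> * (arcosh_quot_deriv ?u * (c * - sin \<theta>)))) (at \<theta>)"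
    by (rule derivative_eq_intros DERIV_chain2[where f = arcosh_quot and g = "\<lambda>\<theta>. c * cos \<theta>", OF has_real_derivative_arcosh_quot[OF u]] refl)+ auto
  moreover have "1 - (c * cos \<theta> * arcosh_quot ?u + c * sin \<theta> * (arcosh_quot_deriv ?u * (c * - sin \<theta>)))
     = (c\<^sup>2 - 1) * arcosh_quot_deriv ?u"
    using arcosh_quot_ode[OF u] sin_cos_squared_add[of \<theta>] by algebra
  ultimately show ?thesis by (simp add: theta_fun_def[abs_def])
qed

lemma theta_fun_antimono:
  assumes "c > 1" "theta_dom c a" "theta_dom c b" "a < b"
  shows "theta_fun c b < theta_fun c a"
proof (rule DERIV_neg_imp_decreasing[OF \<open>a < b\<close>])
  fix x assume "a \<le> x" "x \<le> b"
  then have "theta_dom c x" using assms by (auto simp: theta_dom_iff)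
  then show "\<exists>y. DERIV (theta_fun c) x :> y \<and> y < 0"
    using theta_fun_deriv[of c x] arcosh_quot_deriv_neg[of "c * cos x"] assms(1)
    by (intro exI[of _ "(c\<^sup>2 - 1) * arcosh_quot_deriv (c * cos x)"])
       (auto simp: theta_dom_def mult_less_0_iff)
qed

lemma theta_fun_minus: "theta_fun c (- \<theta>) = - theta_fun c \<theta>"
  by (simp add: theta_fun_def)

lemma arcosh_quot_cos: "0 < s \<Longrightarrow> s < pi \<Longrightarrow> arcosh_quot (cos s) = s / sin s"
proof -
  assume s: "0 < s" "s < pi"
  then have "cos s < cos 0" by (intro cos_monotone_0_pi) auto
  moreover have "sqrt (1 - (cos s)\<^sup>2) = sin s" using s by (simp add: sin_squared_eq[symmetric] sin_ge_zero)
  ultimately show ?thesis using s by (simp add: arcosh_quot_def arccos_cos)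
qed

lemma theta_fun_surj:
  assumes "c > 1" shows "\<exists>\<theta>. theta_dom c \<theta> \<and> theta_fun c \<theta> = z"
proof -
  define w where "w = sqrt (c\<^sup>2 - 1)"
  have w: "w > 0" using assms by (simp add: w_def)
  \<comment> \<open>The witness \<theta> is fixed by \<open>c * cos \<theta> = cos s\<close> with s
    = pi - \<eta>, so that the quotient becomes s / sin s. As s \<ge> pi / 2 and sin s \<le> \<eta>,
    this \<eta> makes w s / sin s at least |z| + pi, where the summand pi absorbs \<theta> <
    pi.\<close>
  define \<eta> where "\<eta> = min (pi / 2) (w * (pi / 2) / (\<bar>z\<bar> + pi))"
  have \<eta>: "0 < \<eta>" "\<eta> \<le> pi / 2" "\<eta> \<le> w * (pi / 2) / (\<bar>z\<bar> + pi)"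
    using w unfolding \<eta>_def by (auto simp del: times_divide_eq_right intro!: divide_pos_pos add_nonneg_pos)
  define s where "s = pi - \<eta>"
  have s: "pi / 2 \<le> s" "s < pi" "0 < s" using \<eta> pi_gt_zero by (auto simp: s_def simp del: pi_gt_zero)
  define \<theta> where "\<theta> = arccos (cos s / c)"
  have "\<bar>cos s / c\<bar> < 1" using assms order.strict_trans1[OF abs_cos_le_one[of s] assms] by (simp add: abs_divide divide_simps)
  then have b: "-1 < cos s / c" "cos s / c < 1" by linarith+
  have \<theta>: "0 < \<theta>" "\<theta> < pi" "cos \<theta> = cos s / c"
    using b arccos_lt_bounded[of "cos s / c"] by (auto simp: \<theta>_def intro!: cos_arccos)
  have "cos pi < cos s" using s by (intro cos_monotone_0_pi) auto
  then have dom: "theta_dom c \<theta>" using \<theta> assms by (simp add: theta_dom_def)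
  \<comment> \<open>The factor in front of the quotient stays away from 0 however close s is to
    pi.\<close>
  have "w\<^sup>2 \<le> (c * sin \<theta>)\<^sup>2"
  proof -
    have "(c * sin \<theta>)\<^sup>2 = c\<^sup>2 - (cos s)\<^sup>2"
      using assms by (simp add: power_mult_distrib sin_squared_eq \<theta> field_simps)
    moreover have "(cos s)\<^sup>2 \<le> 1" by (simp add: abs_square_le_1)
    ultimately show ?thesis using assms by (simp add: w_def)
  qed
  then have "w \<le> c * sin \<theta>" using assms \<theta> by (intro power2_le_imp_le[of w]) (auto intro!: mult_nonneg_nonneg sin_ge_zero)
  moreover have "\<bar>z\<bar> + pi \<le> w * (s / sin s)"
  proof -
    have sin: "0 < sin s" "sin s \<le> \<eta>" using s \<eta> sin_gt_zero[of s] sin_x_le_x[of \<eta>] by (auto simp: s_def)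
    have "\<bar>z\<bar> + pi \<le> w * ((pi / 2) / \<eta>)" using \<eta> by (simp add: field_simps add_nonneg_pos)
    also have "\<dots> \<le> w * (s / sin s)" using s sin w by (intro mult_left_mono frac_le) auto
    finally show ?thesis .
  qed
  moreover have "arcosh_quot (c * cos \<theta>) = s / sin s" using \<theta> assms s by (simp add: arcosh_quot_cos)
  ultimately have "\<bar>z\<bar> + pi \<le> c * sin \<theta> * arcosh_quot (c * cos \<theta>)"
    using s sin_ge_zero[of s] by (smt (verit) divide_nonneg_nonneg mult_right_mono)
  then have lo: "theta_fun c \<theta> \<le> - \<bar>z\<bar>" using \<theta> by (simp add: theta_fun_def)
  have "\<exists>x\<ge>-\<theta>. x \<le> \<theta> \<and> theta_fun c x = z"
  proof (rule IVT2)
    show "theta_fun c \<theta> \<le> z" "z \<le> theta_fun c (- \<theta>)" "-\<theta> \<le> \<theta>" using lo \<theta> by (auto simp: theta_fun_minus)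
    show "\<forall>x. - \<theta> \<le> x \<and> x \<le> \<theta> \<longrightarrow> isCont (theta_fun c) x"
    proof (intro allI impI)
      fix x assume "- \<theta> \<le> x \<and> x \<le> \<theta>"
      then have "theta_dom c x" using dom assms by (auto simp: theta_dom_iff)
      then show "isCont (theta_fun c) x" using theta_fun_deriv DERIV_isCont by blast
    qed
  qed
  then obtain x where "- \<theta> \<le> x" "x \<le> \<theta>" "theta_fun c x = z" by blast
  moreover from this have "theta_dom c x" using dom assms by (auto simp: theta_dom_iff)
  ultimately show ?thesis by blast
qed

lemma theta_fun_ex1: assumes "c > 1" shows "\<exists>!\<theta>. theta_dom c \<theta> \<and> theta_fun c \<theta> = z"
  using theta_fun_surj[OF assms, of z] theta_fun_antimono[OF assms] by (metis less_irrefl linorder_neqE)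

definition Theta :: "real \<Rightarrow> real \<Rightarrow> real" where
  "Theta c z = (THE \<theta>. theta_dom c \<theta> \<and> theta_fun c \<theta> = z)"

lemma Theta: assumes "c > 1" shows "theta_dom c (Theta c z)" "theta_fun c (Theta c z) = z"
  using theI'[OF theta_fun_ex1[OF assms, of z]] by (auto simp: Theta_def)

lemma Theta_eqI: "c > 1 \<Longrightarrow> theta_dom c \<theta> \<Longrightarrow> theta_fun c \<theta> = z \<Longrightarrow> Theta c z = \<theta>"
  using theta_fun_ex1 Theta by blast

lemma Theta_minus: "c > 1 \<Longrightarrow> Theta c (- z) = - Theta c z"
  using Theta[of c z] by (intro Theta_eqI) (auto simp: theta_fun_minus theta_dom_def)

lemma Theta_0: "c > 1 \<Longrightarrow> Theta c 0 = 0"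
  by (intro Theta_eqI) (auto simp: theta_dom_def theta_fun_def)

text \<open>Joint differentiability in c and z comes from the inverse function theorem for the map
  \<open>(c, \<theta>) \<mapsto> (c, theta_fun c \<theta>)\<close>, whose inverse is
  \<open>(c, z) \<mapsto> (c, Theta c z)\<close>.\<close>

lemma Theta_has_derivative:
  fixes z :: real
  assumes "c > 1"
  defines "\<theta> \<equiv> Theta c z"
  defines "q \<equiv> arcosh_quot (c * cos \<theta>)" and "q' \<equiv> arcosh_quot_deriv (c * cos \<theta>)"
  shows "((\<lambda>(c, z). Theta c z) has_derivative
     (\<lambda>(dc, dz). (dz + sin \<theta> * (q + c * cos \<theta> * q') * dc) / ((c\<^sup>2 - 1) * q'))) (at (c, z))"
proof -
  let ?S = "{1<..} \<times> {-pi<..<pi} \<inter> {x. fst x * cos (snd x) > -1} :: (real \<times> real) set"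
  let ?f = "\<lambda>x. (fst x, theta_fun (fst x) (snd x))"
  let ?g = "\<lambda>x. (fst x, Theta (fst x) (snd x))"
  let ?hc = "- sin \<theta> * (q + c * cos \<theta> * q')" and ?ht = "(c\<^sup>2 - 1) * q'"
  let ?f' = "\<lambda>x. (fst x, ?hc * fst x + ?ht * snd x)"
  let ?g' = "\<lambda>x. (fst x, (snd x + sin \<theta> * (q + c * cos \<theta> * q') * fst x) / ?ht)"
  have der: "(?f has_derivative (\<lambda>x. (fst x,
        - sin b * (arcosh_quot (a * cos b) + a * cos b * arcosh_quot_deriv (a * cos b)) * fst x
        + ((a\<^sup>2 - 1) * arcosh_quot_deriv (a * cos b)) * snd x))) (at (a, b))"
    if "(a, b) \<in> ?S" for a b
  proof -
    have u: "a * cos b > -1" using that by auto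
    have Q: "((\<lambda>x. arcosh_quot (fst x * cos (snd x))) has_derivative
        (\<lambda>x. (fst x * cos b + a * (snd x * - sin b)) * arcosh_quot_deriv (a * cos b))) (at (a, b))"
      using has_real_derivative_arcosh_quot[OF u]
      by (intro DERIV_compose_FDERIV[where f = arcosh_quot]) (auto intro!: derivative_eq_intros simp: algebra_simps)
    have "((\<lambda>x. theta_fun (fst x) (snd x)) has_derivative (\<lambda>x. snd x -
        ((fst x * sin b + a * (snd x * cos b)) * arcosh_quot (a * cos b)
        + a * sin b * ((fst x * cos b + a * (snd x * - sin b)) * arcosh_quot_deriv (a * cos b))))) (at (a, b))"
      unfolding theta_fun_def
      by (rule Q derivative_eq_intros refl)+ (simp add: fun_eq_iff algebra_simps)
    also have "(\<lambda>x. snd x -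
        ((fst x * sin b + a * (snd x * cos b)) * arcosh_quot (a * cos b)
        + a * sin b * ((fst x * cos b + a * (snd x * - sin b)) * arcosh_quot_deriv (a * cos b)))) =
        (\<lambda>x::real\<times>real. - sin b * (arcosh_quot (a * cos b) + a * cos b * arcosh_quot_deriv (a * cos b)) * fst x
        + ((a\<^sup>2 - 1) * arcosh_quot_deriv (a * cos b)) * snd x)"
      using arcosh_quot_ode[OF u] sin_cos_squared_add[of b] unfolding fun_eq_iff by algebra
    finally show ?thesis by (intro has_derivative_Pair has_derivative_fst has_derivative_ident)
  qed
  have dom: "theta_dom c \<theta>" "theta_fun c \<theta> = z" using Theta[OF assms(1)] by (auto simp: \<theta>_def)
  have q': "q' < 0" using arcosh_quot_deriv_neg dom by (simp add: q'_def theta_dom_def)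
  have mem: "(c, \<theta>) \<in> ?S" using dom assms(1) by (auto simp: theta_dom_def)
  have "(?g has_derivative ?g') (at (?f (c, \<theta>)))"
  proof (rule has_derivative_inverse_strong[where S = ?S and f' = ?f' and f = ?f and x = "(c, \<theta>)"])
    show "open ?S"
      by (intro open_Int open_Times open_greaterThan open_greaterThanLessThan open_Collect_less continuous_intros)
    show "continuous_on ?S ?f"
    proof (rule continuous_at_imp_continuous_on, rule ballI)
      fix x assume "x \<in> ?S"
      then show "isCont ?f x" using der[of "fst x" "snd x"] has_derivative_continuous by force
    qed
    show "?g (?f x) = x" if "x \<in> ?S" for x
      using that by (cases x) (auto intro!: Theta_eqI simp: theta_dom_def)
    show "(?f has_derivative ?f') (at (c, \<theta>))"
      using der[OF mem] by (simp add: q_def q'_def)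
    have "?ht * (a / ?ht) = a" for a using q' assms(1) by (auto simp: power2_eq_1_iff)
    then show "?f' \<circ> ?g' = id" by (simp only: fun_eq_iff prod_eq_iff o_def fst_conv snd_conv id_apply) simp
  qed (use mem in auto)
  then have "(?g has_derivative ?g') (at (c, z))" by (simp only: fst_conv snd_conv dom(2))
  from has_derivative_snd[OF this] show ?thesis by (simp add: case_prod_unfold)
qed

text \<open>Formula (iii) with \<theta> - z replaced by means of the equation for \<theta>: the
  factor sin \<theta> cancels, so the expression also makes sense at z = 0.\<close>

definition Phi :: "real \<Rightarrow> real \<Rightarrow> real" where
  "Phi c z = sqrt (c\<^sup>2 - 1) * arcosh_quot (c * cos (Theta c z))"

text \<open>All occurrences of q and q' cancel by \<open>arcosh_quot_ode\<close>, so the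
  differential depends on z only through \<theta>. With dc = sinh r dr it is the differential in the
  coordinates r, z.\<close>

lemma Phi_has_derivative:
  fixes z :: real
  assumes "c > 1"
  defines "\<theta> \<equiv> Theta c z"
  shows "((\<lambda>(c, z). Phi c z) has_derivative
     (\<lambda>(dc, dz). (cos \<theta> * dc - c * sin \<theta> * dz) / sqrt (c\<^sup>2 - 1))) (at (c, z))"
proof -
  define q where "q = arcosh_quot (c * cos \<theta>)"
  define q' where "q' = arcosh_quot_deriv (c * cos \<theta>)"
  define w where "w = sqrt (c\<^sup>2 - 1)"
  have w: "w > 0" "w\<^sup>2 = c\<^sup>2 - 1" using assms(1) by (auto simp: w_def)
  let ?T = "\<lambda>x::real\<times>real. (snd x + sin \<theta> * (q + c * cos \<theta> * q') * fst x) / ((c\<^sup>2 - 1) * q')"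
  have dom: "theta_dom c \<theta>" using Theta[OF assms(1)] by (auto simp: \<theta>_def)
  have u: "c * cos \<theta> > -1" using dom by (simp add: theta_dom_def)
  have q': "q' < 0" using arcosh_quot_deriv_neg u by (simp add: q'_def)
  have T: "((\<lambda>x. Theta (fst x) (snd x)) has_derivative ?T) (at (c, z))"
    using Theta_has_derivative[OF assms(1), of z] by (simp add: case_prod_unfold \<theta>_def q_def q'_def)
  have U: "((\<lambda>x. fst x * cos (Theta (fst x) (snd x))) has_derivative
      (\<lambda>x. fst x * cos \<theta> + c * (?T x * - sin \<theta>))) (at (c, z))"
    by (rule derivative_eq_intros T refl)+ (simp add: fun_eq_iff \<theta>_def algebra_simps)
  have Q: "((\<lambda>x. arcosh_quot (fst x * cos (Theta (fst x) (snd x)))) has_derivative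
      (\<lambda>x. (fst x * cos \<theta> + c * (?T x * - sin \<theta>)) * q')) (at (c, z))"
    by (rule DERIV_compose_FDERIV[where f = arcosh_quot, OF _ U])
       (use has_real_derivative_arcosh_quot[OF u] in \<open>simp add: \<theta>_def q'_def\<close>)
  have W: "((\<lambda>x. sqrt ((fst x)\<^sup>2 - 1)) has_derivative (\<lambda>x. c * fst x / w)) (at (c, z))"
    using assms(1) by (auto intro!: derivative_eq_intros simp: w_def fun_eq_iff divide_simps)
  have "((\<lambda>x. Phi (fst x) (snd x)) has_derivative (\<lambda>x. (c * fst x / w) * q
       + w * ((fst x * cos \<theta> + c * (?T x * - sin \<theta>)) * q'))) (at (c, z))"
    unfolding Phi_def
    by (rule has_derivative_eq_rhs[OF has_derivative_mult[OF W Q]])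
       (auto simp: fun_eq_iff w_def q_def \<theta>_def algebra_simps)
  also have "(\<lambda>x. (c * fst x / w) * q + w * ((fst x * cos \<theta> + c * (?T x * - sin \<theta>)) * q'))
      = (\<lambda>x. (cos \<theta> * fst x - c * sin \<theta> * snd x) / w)"
  proof
    fix x :: "real \<times> real"
    have o: "((c * cos \<theta>)\<^sup>2 - 1) * q' + c * cos \<theta> * q = 1"
      using arcosh_quot_ode[OF u] by (simp add: q_def q'_def)
    have t: "?T x * (w\<^sup>2 * q') = snd x + sin \<theta> * (q + c * cos \<theta> * q') * fst x"
      unfolding w(2)[symmetric] using w(1) q' by simp
    \<comment> \<open>Writing t for \<open>?T x\<close> keeps its denominator out of the
      normalisation; the fact t above then removes it.\<close>
    have *: "w * ((c * f / w) * q + w * ((f * cos \<theta> + c * (t * - sin \<theta>)) * q'))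
       = c * f * q + w\<^sup>2 * f * cos \<theta> * q' - c * sin \<theta> * (t * (w\<^sup>2 * q'))" for t f
      using w(1) by (simp add: field_simps power2_eq_square)
    have "w * ((c * fst x / w) * q + w * ((fst x * cos \<theta> + c * (?T x * - sin \<theta>)) * q'))
       = c * fst x * q + w\<^sup>2 * fst x * cos \<theta> * q' - c * sin \<theta> * (?T x * (w\<^sup>2 * q'))"
      by (rule *)
    also have "\<dots> = cos \<theta> * fst x - c * sin \<theta> * snd x"
      unfolding t using o w(2) sin_cos_squared_add[of \<theta>] by algebra
    finally show "(c * fst x / w) * q + w * ((fst x * cos \<theta> + c * (?T x * - sin \<theta>)) * q')
      = (cos \<theta> * fst x - c * sin \<theta> * snd x) / w" using w(1) by (metis less_irrefl nonzero_mult_div_cancel_left)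
  qed
  finally show ?thesis by (simp add: case_prod_unfold w_def)
qed

section \<open>Special values of the distance function and its limit at the axis\<close>

lemma Phi_minus: "c > 1 \<Longrightarrow> Phi c (- z) = Phi c z"
  by (simp add: Phi_def Theta_minus)

lemma Phi_pos: "c > 1 \<Longrightarrow> Phi c z > 0"
  using Theta[of c z] by (simp add: Phi_def theta_dom_def arcosh_quot_pos)

lemma Phi_0: assumes "r > 0" shows "Phi (cosh r) 0 = r"
proof -
  have "cosh r > 1" using assms cosh_real_strict_mono[of 0 r] by simp
  moreover have "sinh r > 0" using assms by simp
  ultimately show ?thesis using assms
    by (simp add: Phi_def Theta_0 arcosh_quot_def arcosh_cosh_real cosh_square_eq)
qed

text \<open>Splits c^2 - 1 into c^2 sin^2 \<theta> and c^2 cos^2 \<theta> - 1. This form survives c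
  \<rightarrow> 1 with z \<noteq> 0, where the product defining \<open>Phi\<close> becomes 0 times
  infinity.\<close>

lemma Phi_square:
  assumes "c > 1"
  shows "(Phi c z)\<^sup>2 = (Theta c z - z)\<^sup>2 + csinv (c * cos (Theta c z))"
proof -
  define \<theta> where "\<theta> = Theta c z"
  have \<theta>: "c * cos \<theta> > -1" "\<theta> - z = c * sin \<theta> * arcosh_quot (c * cos \<theta>)"
    using Theta[OF assms, of z] by (auto simp: \<theta>_def theta_dom_def theta_fun_def)
  have "(Phi c z)\<^sup>2 = (c\<^sup>2 - 1) * (arcosh_quot (c * cos \<theta>))\<^sup>2"
    using assms by (simp add: Phi_def \<theta>_def power_mult_distrib)
  then show ?thesis unfolding \<theta>_def[symmetric] \<theta>(2) arcosh_quot_square[OF \<theta>(1), symmetric]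
    using sin_cos_squared_add[of \<theta>] by algebra
qed

text \<open>At c = 1 the equation degenerates: \<open>theta_fun 1 (- \<tau>) = 0\<close> for every
  \<tau> in (0, pi). Hence for c near 1 the value at - \<tau> is still below z > 0, and a decreasing
  function can reach z only to the left of - \<tau>.\<close>

lemma Theta_tendsto_pi:
  assumes "z > 0" shows "((\<lambda>c. Theta c z) \<longlongrightarrow> - pi) (at_right 1)"
proof (rule tendstoI)
  fix e :: real assume "e > 0"
  define \<tau> where "\<tau> = pi - min e pi / 2"
  have \<tau>: "0 < \<tau>" "\<tau> < pi" "pi - e < \<tau>" using \<open>e > 0\<close> by (auto simp: \<tau>_def min_def)
  have cos: "cos \<tau> > -1" using \<tau> cos_monotone_0_pi[of \<tau> pi] by simp
  have "isCont arcosh_quot (1 * cos \<tau>)" using has_real_derivative_arcosh_quot[THEN DERIV_isCont] cos by simp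
  then have "((\<lambda>c. arcosh_quot (c * cos \<tau>)) \<longlongrightarrow> arcosh_quot (1 * cos \<tau>)) (at_right 1)"
    by (rule isCont_tendsto_compose) (intro tendsto_intros)
  then have "((\<lambda>c. theta_fun c (- \<tau>)) \<longlongrightarrow> - \<tau> + 1 * sin \<tau> * arcosh_quot (1 * cos \<tau>)) (at_right 1)"
    unfolding theta_fun_minus unfolding theta_fun_def by (auto intro!: tendsto_eq_intros)
  moreover have "- \<tau> + 1 * sin \<tau> * arcosh_quot (1 * cos \<tau>) < z"
    using assms \<tau> sin_gt_zero[of \<tau>] by (simp add: arcosh_quot_cos)
  ultimately have "eventually (\<lambda>c. theta_fun c (- \<tau>) < z) (at_right 1)" by (rule order_tendstoD)
  moreover have "((\<lambda>c. c * cos \<tau>) \<longlongrightarrow> 1 * cos \<tau>) (at_right 1)" by (intro tendsto_intros)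
  then have "eventually (\<lambda>c. c * cos \<tau> > -1) (at_right 1)" by (rule order_tendstoD) (use cos in simp)
  moreover have "eventually (\<lambda>c::real. c > 1) (at_right 1)" by (rule eventually_at_right_less)
  ultimately show "eventually (\<lambda>c. dist (Theta c z) (- pi) < e) (at_right 1)"
  proof eventually_elim
    case (elim c)
    have "theta_dom c (- \<tau>)" using elim \<tau> by (simp add: theta_dom_def)
    then have "Theta c z < - \<tau>"
      using Theta[of c z] elim theta_fun_antimono[of c "- \<tau>" "Theta c z"]
      by (metis less_asym linorder_neqE_linordered_idom)
    moreover have "Theta c z > - pi" using Theta[of c z] elim by (auto simp: theta_dom_def)
    ultimately show ?case using \<tau> by (simp add: dist_real_def)
  qed
qed

lemma Phi_tendsto_axis:
  "((\<lambda>c. Phi c z) \<longlongrightarrow> sqrt (2 * pi * \<bar>z\<bar> + z\<^sup>2)) (at_right 1)"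
proof -
  have gt1: "eventually (\<lambda>c::real. c > 1) (at_right 1)" by (rule eventually_at_right_less)
  have pos: "((\<lambda>c. Phi c z) \<longlongrightarrow> sqrt (2 * pi * \<bar>z\<bar> + z\<^sup>2)) (at_right 1)" if z: "z > 0" for z
  proof -
    note T = Theta_tendsto_pi[OF z]
    have u: "((\<lambda>c. c * cos (Theta c z)) \<longlongrightarrow> 1 * cos (- pi)) (at_right 1)" by (intro tendsto_intros T)
    \<comment> \<open>Being below 1 selects the arccos branch of \<open>csinv\<close>, with limit -
      pi^2; the claimed value is then (pi + z)^2 - pi^2.\<close>
    then have "eventually (\<lambda>c. c * cos (Theta c z) < 1) (at_right 1)" by (rule order_tendstoD) simp
    with gt1 have ev: "eventually (\<lambda>c. c > 1 \<and> c * cos (Theta c z) \<in> {-1..1} \<and> c * cos (Theta c z) < 1) (at_right 1)"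
    proof eventually_elim
      case (elim c) then show ?case using Theta[of c z] by (auto simp: theta_dom_def)
    qed
    have "((\<lambda>c. arccos (c * cos (Theta c z))) \<longlongrightarrow> arccos (-1)) (at_right 1)"
      by (rule continuous_on_tendsto_compose[OF continuous_on_arccos']) 
         (use u in \<open>auto intro: eventually_mono[OF ev]\<close>)
    then have "((\<lambda>c. sqrt ((Theta c z - z)\<^sup>2 - (arccos (c * cos (Theta c z)))\<^sup>2)) \<longlongrightarrow> sqrt ((- pi - z)\<^sup>2 - pi\<^sup>2)) (at_right 1)"
      by (intro tendsto_intros T) simp
    also have "(- pi - z)\<^sup>2 - pi\<^sup>2 = 2 * pi * \<bar>z\<bar> + z\<^sup>2" using z by (simp add: power2_eq_square algebra_simps)
    finally show ?thesis
      by (rule Lim_transform_eventually)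
         (rule eventually_mono[OF ev], metis Phi_square Phi_pos csinv_def diff_conv_add_uminus less_imp_le not_le real_sqrt_unique)
  qed
  consider "z > 0" | "z < 0" | "z = 0" by linarith
  then show ?thesis
  proof cases
    case 2
    have "((\<lambda>c. Phi c (- z)) \<longlongrightarrow> sqrt (2 * pi * \<bar>z\<bar> + z\<^sup>2)) (at_right 1)" using pos[of "- z"] 2 by simp
    then show ?thesis by (rule Lim_transform_eventually) (use gt1 in eventually_elim, simp add: Phi_minus)
  next
    case 3
    have "isCont arcosh_quot (1::real)" using has_real_derivative_arcosh_quot[THEN DERIV_isCont] by simp
    then have "((\<lambda>c. sqrt (c\<^sup>2 - 1) * arcosh_quot c) \<longlongrightarrow> sqrt (1\<^sup>2 - 1) * arcosh_quot 1) (at_right 1)"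
      by (intro tendsto_intros isCont_tendsto_compose[where g = arcosh_quot]) auto
    then have "((\<lambda>c. sqrt (c\<^sup>2 - 1) * arcosh_quot c) \<longlongrightarrow> sqrt (2 * pi * \<bar>z\<bar> + z\<^sup>2)) (at_right 1)" using 3 by simp
    then show ?thesis by (rule Lim_transform_eventually) (use gt1 in eventually_elim, simp add: Phi_def Theta_0 3)
  qed (rule pos)
qed

section \<open>Smooth functions\<close>

definition smooth_on :: "'a::real_normed_vector set \<Rightarrow> ('a \<Rightarrow> real) \<Rightarrow> bool" where
  "smooth_on W F \<longleftrightarrow> (\<forall>k. Ck_on k W F)"

lemma smooth_on_differentiable: "smooth_on W F \<Longrightarrow> x \<in> W \<Longrightarrow> F differentiable at x"
  unfolding smooth_on_def by (drule spec[of _ "Suc 0"]) simp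

lemma smooth_on_has_derivative:
  "smooth_on W F \<Longrightarrow> x \<in> W \<Longrightarrow> (F has_derivative frechet_derivative F (at x)) (at x)"
  using smooth_on_differentiable frechet_derivative_works by blast

lemma smooth_on_frechet: "smooth_on W F \<Longrightarrow> smooth_on W (\<lambda>x. frechet_derivative F (at x) v)"
  unfolding smooth_on_def
proof
  fix k assume "\<forall>k. Ck_on k W F"
  then have "Ck_on (Suc k) W F" ..
  then show "Ck_on k W (\<lambda>x. frechet_derivative F (at x) v)" by simp
qed

text \<open>Differentiability is not assumed: both functions have the same derivatives at x, if any,
  so the choice made by \<open>frechet_derivative\<close> is the same.\<close>

lemma frechet_derivative_cong_open:
  assumes "open W" "x \<in> W" "\<And>x. x \<in> W \<Longrightarrow> F x = G x"
  shows "frechet_derivative F (at x) = frechet_derivative G (at x)"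
proof -
  have "(F has_derivative D) (at x) \<longleftrightarrow> (G has_derivative D) (at x)" for D
    using has_derivative_transform_within_open[of F D x UNIV W G]
      has_derivative_transform_within_open[of G D x UNIV W F] assms by auto
  then show ?thesis by (simp add: frechet_derivative_def)
qed

lemma Ck_on_cong:
  assumes "open W" "\<And>x. x \<in> W \<Longrightarrow> F x = G x" "Ck_on k W F"
  shows "Ck_on k W G"
  using assms(2,3)
proof (induction k arbitrary: F G)
  case 0 then show ?case by (auto cong: continuous_on_cong)
next
  case (Suc k)
  have "G differentiable at x" if "x \<in> W" for x
  proof -
    obtain D where "(F has_derivative D) (at x)" using Suc.prems(2) \<open>x \<in> W\<close> by (auto simp: differentiable_def)
    then have "(G has_derivative D) (at x)"
      by (rule has_derivative_transform_within_open[OF _ assms(1) \<open>x \<in> W\<close> Suc.prems(1)])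
    then show ?thesis by (auto simp: differentiable_def)
  qed
  moreover have "Ck_on k W (\<lambda>x. frechet_derivative G (at x) v)" for v
    by (rule Suc.IH[of "\<lambda>x. frechet_derivative F (at x) v"])
       (use Suc.prems(2) frechet_derivative_cong_open[OF assms(1) _ Suc.prems(1)] in simp_all)
  ultimately show ?case by simp
qed

lemma smooth_on_cong:
  "open W \<Longrightarrow> (\<And>x. x \<in> W \<Longrightarrow> F x = G x) \<Longrightarrow> smooth_on W F \<Longrightarrow> smooth_on W G"
  unfolding smooth_on_def using Ck_on_cong by blast

text \<open>Induction on k for all members of A at once. A derivative has to agree with a member
  only on W, since outside W it is arbitrary.\<close>

lemma smooth_on_coinduct:
  assumes "open W" "F \<in> A"
    and "\<And>F x. F \<in> A \<Longrightarrow> x \<in> W \<Longrightarrow> F differentiable at x"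
    and "\<And>F v. F \<in> A \<Longrightarrow> \<exists>G\<in>A. \<forall>x\<in>W. frechet_derivative F (at x) v = G x"
  shows "smooth_on W F"
proof -
  have "Ck_on k W F" if "F \<in> A" for F k
    using that
  proof (induction k arbitrary: F)
    case 0
    then have "isCont F x" if "x \<in> W" for x
      using that assms(3) differentiable_imp_continuous_within by blast
    then have "continuous_on W F" by (intro continuous_at_imp_continuous_on ballI)
    then show ?case by simp
  next
    case (Suc k)
    have "Ck_on k W (\<lambda>x. frechet_derivative F (at x) v)" for v
    proof -
      obtain G where G: "G \<in> A" "\<forall>x\<in>W. frechet_derivative F (at x) v = G x"
        using assms(4)[OF Suc.prems] by blast
      show ?thesis by (rule Ck_on_cong[OF assms(1) _ Suc.IH[OF G(1)]]) (use G in simp)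
    qed
    then show ?case using assms(3) Suc.prems by auto
  qed
  then show ?thesis using assms(2) by (auto simp: smooth_on_def)
qed

text \<open>Smoothness of a family of functions defined by mutual differential equations is shown by
  coinduction: the algebra generated by the family and by all smooth functions is closed under
  directional derivatives.\<close>

inductive_set fun_algebra :: "('a \<Rightarrow> real) set \<Rightarrow> ('a \<Rightarrow> real) set" for \<Gamma> where
  gen: "F \<in> \<Gamma> \<Longrightarrow> F \<in> fun_algebra \<Gamma>"
| const: "(\<lambda>_. c) \<in> fun_algebra \<Gamma>"
| add: "F \<in> fun_algebra \<Gamma> \<Longrightarrow> G \<in> fun_algebra \<Gamma> \<Longrightarrow> (\<lambda>x. F x + G x) \<in> fun_algebra \<Gamma>"
| mult: "F \<in> fun_algebra \<Gamma> \<Longrightarrow> G \<in> fun_algebra \<Gamma> \<Longrightarrow> (\<lambda>x. F x * G x) \<in> fun_algebra \<Gamma>"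

lemma smooth_on_algebra:
  fixes W :: "'a::real_normed_vector set"
  assumes W: "open W"
    and gen: "\<And>F. F \<in> \<Gamma> \<Longrightarrow> \<exists>F'. (\<forall>x\<in>W. (F has_derivative F' x) (at x)) \<and>
        (\<forall>v. (\<lambda>x. F' x v) \<in> fun_algebra (\<Gamma> \<union> Collect (smooth_on W)))"
    and "F \<in> fun_algebra (\<Gamma> \<union> Collect (smooth_on W))"
  shows "smooth_on W F"
proof -
  let ?A = "fun_algebra (\<Gamma> \<union> Collect (smooth_on W))"
  have *: "\<exists>F'. (\<forall>x\<in>W. (F has_derivative F' x) (at x)) \<and> (\<forall>v. (\<lambda>x. F' x v) \<in> ?A)" if "F \<in> ?A" for F
    using that
  proof induction
    case (gen F)
    then consider "F \<in> \<Gamma>" | "smooth_on W F" by auto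
    then show ?case
    proof cases
      case 2
      then show ?thesis
        by (intro exI[of _ "\<lambda>x. frechet_derivative F (at x)"])
           (auto intro: smooth_on_has_derivative fun_algebra.gen smooth_on_frechet)
    qed (rule assms(2))
  next
    case (const c)
    show ?case by (intro exI[of _ "\<lambda>_ _. 0"]) (auto intro: fun_algebra.const)
  next
    case (add F G)
    then obtain F' G' where "\<forall>x\<in>W. (F has_derivative F' x) (at x)" "\<forall>v. (\<lambda>x. F' x v) \<in> ?A"
      "\<forall>x\<in>W. (G has_derivative G' x) (at x)" "\<forall>v. (\<lambda>x. G' x v) \<in> ?A" by blast
    then show ?case
      by (intro exI[of _ "\<lambda>x v. F' x v + G' x v"]) (auto intro!: has_derivative_add fun_algebra.add)
  next
    case (mult F G)
    then obtain F' G' where "\<forall>x\<in>W. (F has_derivative F' x) (at x)" "\<forall>v. (\<lambda>x. F' x v) \<in> ?A"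
      "\<forall>x\<in>W. (G has_derivative G' x) (at x)" "\<forall>v. (\<lambda>x. G' x v) \<in> ?A" by blast
    then show ?case using mult.hyps
      by (intro exI[of _ "\<lambda>x v. F x * G' x v + F' x v * G x"])
         (auto intro!: has_derivative_mult fun_algebra.add fun_algebra.mult)
  qed
  show ?thesis
  proof (rule smooth_on_coinduct[OF W assms(3)])
    fix F assume "F \<in> ?A"
    then obtain F' where F': "\<forall>x\<in>W. (F has_derivative F' x) (at x)" "\<forall>v. (\<lambda>x. F' x v) \<in> ?A"
      using * by blast
    then show "F differentiable at x" if "x \<in> W" for x using that differentiable_def by blast
    show "\<exists>G\<in>?A. \<forall>x\<in>W. frechet_derivative F (at x) v = G x" for v
      using F' frechet_derivative_at by (intro bexI[of _ "\<lambda>x. F' x v"]) force+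
  qed
qed

lemma fun_algebra_uminus: "F \<in> fun_algebra \<Gamma> \<Longrightarrow> (\<lambda>x. - F x) \<in> fun_algebra \<Gamma>"
  using fun_algebra.mult[OF fun_algebra.const[of "-1"], of F \<Gamma>] by simp

lemma fun_algebra_diff: "F \<in> fun_algebra \<Gamma> \<Longrightarrow> G \<in> fun_algebra \<Gamma> \<Longrightarrow> (\<lambda>x. F x - G x) \<in> fun_algebra \<Gamma>"
  using fun_algebra.add[OF _ fun_algebra_uminus, of F \<Gamma> G] by simp

lemma fun_algebra_power: "F \<in> fun_algebra \<Gamma> \<Longrightarrow> (\<lambda>x. F x ^ n) \<in> fun_algebra \<Gamma>"
  by (induction n) (simp_all add: fun_algebra.const fun_algebra.mult)

lemmas fun_algebra_intros = fun_algebra.const fun_algebra.add fun_algebra.mult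
  fun_algebra_uminus fun_algebra_diff fun_algebra_power

section \<open>Smoothness of compositions with elementary functions\<close>

lemma smooth_on_const: "open W \<Longrightarrow> smooth_on W (\<lambda>_. c)"
  by (rule smooth_on_algebra[where \<Gamma> = "{}"]) (simp_all add: fun_algebra.const)

context
  fixes W :: "'a::real_normed_vector set" and F G :: "'a \<Rightarrow> real"
  assumes W: "open W" and F: "smooth_on W F"
begin

lemma smooth_on_add: "smooth_on W G \<Longrightarrow> smooth_on W (\<lambda>x. F x + G x)"
  by (rule smooth_on_algebra[OF W, where \<Gamma> = "{}"], simp, rule fun_algebra.add) (simp_all add: fun_algebra.gen F)

lemma smooth_on_mult: "smooth_on W G \<Longrightarrow> smooth_on W (\<lambda>x. F x * G x)"
  by (rule smooth_on_algebra[OF W, where \<Gamma> = "{}"], simp, rule fun_algebra.mult) (simp_all add: fun_algebra.gen F)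

lemma smooth_on_power: "smooth_on W (\<lambda>x. F x ^ n)"
  by (rule smooth_on_algebra[OF W, where \<Gamma> = "{}"], simp, rule fun_algebra_power) (simp_all add: fun_algebra.gen F)

text \<open>The derivative g' may be expressed through g itself, as for \<open>inverse\<close> and
  \<open>sqrt\<close>; taking the composite as generator makes this circularity harmless.\<close>

lemma smooth_on_compose:
  assumes g: "\<And>x. x \<in> W \<Longrightarrow> (g has_real_derivative g' (F x)) (at (F x))"
    and g': "(\<lambda>x. g' (F x)) \<in> fun_algebra ({\<lambda>x. g (F x)} \<union> Collect (smooth_on W))"
  shows "smooth_on W (\<lambda>x. g (F x))"
proof (rule smooth_on_algebra[OF W, where \<Gamma> = "{\<lambda>x. g (F x)}"])
  show "\<exists>F'. (\<forall>x\<in>W. (H has_derivative F' x) (at x)) \<and>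
        (\<forall>v. (\<lambda>x. F' x v) \<in> fun_algebra ({\<lambda>x. g (F x)} \<union> Collect (smooth_on W)))"
    if "H \<in> {\<lambda>x. g (F x)}" for H
  proof (intro exI[of _ "\<lambda>x v. frechet_derivative F (at x) v * g' (F x)"] conjI ballI allI)
    show "(H has_derivative (\<lambda>v. frechet_derivative F (at x) v * g' (F x))) (at x)" if "x \<in> W" for x
      using that \<open>H \<in> _\<close> DERIV_compose_FDERIV[where f = g, OF g smooth_on_has_derivative[OF F]] by simp
    show "(\<lambda>x. frechet_derivative F (at x) v * g' (F x)) \<in> fun_algebra ({\<lambda>x. g (F x)} \<union> Collect (smooth_on W))" for v
      by (rule fun_algebra.mult[OF fun_algebra.gen g']) (simp add: smooth_on_frechet[OF F])
  qed
qed (auto intro: fun_algebra.gen)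

lemma smooth_on_inverse: "(\<And>x. x \<in> W \<Longrightarrow> F x \<noteq> 0) \<Longrightarrow> smooth_on W (\<lambda>x. inverse (F x))"
  by (rule smooth_on_compose[where g' = "\<lambda>y. - (inverse y * inverse y)"])
     (auto intro!: derivative_eq_intros fun_algebra_uminus[OF fun_algebra.mult] intro: fun_algebra.gen)

end

lemma smooth_on_uminus: "open W \<Longrightarrow> smooth_on W F \<Longrightarrow> smooth_on W (\<lambda>x. - F x)"
  using smooth_on_mult[OF _ smooth_on_const[where c = "-1"], of W F] by simp

lemma smooth_on_diff: "open W \<Longrightarrow> smooth_on W F \<Longrightarrow> smooth_on W G \<Longrightarrow> smooth_on W (\<lambda>x. F x - G x)"
  using smooth_on_add[OF _ _ smooth_on_uminus, of W F G] by simp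

lemma smooth_on_divide:
  "open W \<Longrightarrow> smooth_on W F \<Longrightarrow> smooth_on W G \<Longrightarrow> (\<And>x. x \<in> W \<Longrightarrow> G x \<noteq> 0) \<Longrightarrow> smooth_on W (\<lambda>x. F x / G x)"
  using smooth_on_mult[OF _ _ smooth_on_inverse, of W F G] by (simp add: divide_inverse)

lemma smooth_on_sqrt:
  assumes "open W" "smooth_on W F" "\<And>x. x \<in> W \<Longrightarrow> F x > 0"
  shows "smooth_on W (\<lambda>x. sqrt (F x))"
\<comment> \<open>The derivative 1 / (2 sqrt y) is written as sqrt y / (2 y), a product of the
  generator and a function already known to be smooth.\<close>
proof (rule smooth_on_compose[OF assms(1,2), where g' = "\<lambda>y. 1/2 * (inverse y * sqrt y)"])
  show "(sqrt has_real_derivative 1/2 * (inverse (F x) * sqrt (F x))) (at (F x))" if "x \<in> W" for x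
  proof -
    have "inverse (sqrt (F x)) / 2 = 1/2 * (inverse (F x) * sqrt (F x))"
      using assms(3)[OF that] by (simp add: field_simps)
    then show ?thesis using DERIV_real_sqrt[OF assms(3)[OF that]] by simp
  qed
  have "smooth_on W (\<lambda>x. inverse (F x))" using assms(3) by (intro smooth_on_inverse[OF assms(1,2)]) force
  then show "(\<lambda>x. 1/2 * (inverse (F x) * sqrt (F x))) \<in> fun_algebra ({\<lambda>x. sqrt (F x)} \<union> Collect (smooth_on W))"
    by (intro fun_algebra.mult[OF fun_algebra.const] fun_algebra.mult fun_algebra.gen) simp_all
qed

lemma smooth_on_arctan:
  assumes "open W" "smooth_on W F" shows "smooth_on W (\<lambda>x. arctan (F x))"
proof (rule smooth_on_compose[OF assms, where g' = "\<lambda>y. inverse (1 + y\<^sup>2)"])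
  have "1 + y\<^sup>2 \<noteq> 0" for y :: real by (smt (verit) zero_le_power2)
  then have "smooth_on W (\<lambda>x. inverse (1 + (F x)\<^sup>2))"
    by (intro smooth_on_inverse smooth_on_add smooth_on_power smooth_on_const assms(1,2)) auto
  then show "(\<lambda>x. inverse (1 + (F x)\<^sup>2)) \<in> fun_algebra ({\<lambda>x. arctan (F x)} \<union> Collect (smooth_on W))"
    by (auto intro: fun_algebra.gen)
qed (auto intro!: derivative_eq_intros)

lemma smooth_on_arccos:
  assumes "open W" "smooth_on W F" "\<And>x. x \<in> W \<Longrightarrow> \<bar>F x\<bar> < 1" shows "smooth_on W (\<lambda>x. arccos (F x))"
proof (rule smooth_on_compose[OF assms(1,2), where g' = "\<lambda>y. inverse (- sqrt (1 - y\<^sup>2))"])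
  have *: "1 - (F x)\<^sup>2 > 0" if "x \<in> W" for x using assms(3)[OF that] by (simp add: abs_square_less_1)
  have "smooth_on W (\<lambda>x. inverse (- sqrt (1 - (F x)\<^sup>2)))"
    using * by (intro smooth_on_inverse smooth_on_uminus smooth_on_sqrt smooth_on_diff smooth_on_power smooth_on_const assms(1,2))
      force+
  then show "(\<lambda>x. inverse (- sqrt (1 - (F x)\<^sup>2))) \<in> fun_algebra ({\<lambda>x. arccos (F x)} \<union> Collect (smooth_on W))"
    by (auto intro: fun_algebra.gen)
  show "(arccos has_real_derivative inverse (- sqrt (1 - (F x)\<^sup>2))) (at (F x))" if "x \<in> W" for x
    using DERIV_arccos[of "F x"] assms(3)[OF that] by (simp add: abs_less_iff)
qed

lemma smooth_on_bounded_linear: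
  assumes "open W" "bounded_linear L" shows "smooth_on W L"
proof (rule smooth_on_algebra[OF assms(1), where \<Gamma> = "{L}"])
  show "\<exists>F'. (\<forall>x\<in>W. (F has_derivative F' x) (at x)) \<and> (\<forall>v. (\<lambda>x. F' x v) \<in> fun_algebra ({L} \<union> Collect (smooth_on W)))"
    if "F \<in> {L}" for F
    using that assms by (intro exI[of _ "\<lambda>_. L"]) (auto intro: fun_algebra.const bounded_linear_imp_has_derivative)
qed (auto intro: fun_algebra.gen)

text \<open>The generators form a closed differential system. Differentiating \<open>cser k\<close>
  calls for \<open>cser (Suc k)\<close>, hence the infinite family; the only reciprocals that arise
  are those of \<open>cser 1\<close>, from the derivative of \<open>csinv\<close>, and of
  \<open>cser 2\<close>, from the division by q' in the derivative of \<open>Theta\<close>.\<close>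

lemma smooth_on_Phi:
  assumes W: "open W" and c: "smooth_on W c" and y: "smooth_on W y" and c1: "\<And>x. x \<in> W \<Longrightarrow> c x > 1"
  shows "smooth_on W (\<lambda>x. Phi (c x) (y x))"
proof -
  define \<theta> where "\<theta> x = Theta (c x) (y x)" for x
  define u where "u x = c x * cos (\<theta> x)" for x
  define i where "i k x = inverse (cser k (csinv (u x)))" for k x
  define \<Gamma> where "\<Gamma> = {\<theta>, \<lambda>x. sin (\<theta> x), \<lambda>x. cos (\<theta> x), \<lambda>x. csinv (u x), i 1, i 2}
     \<union> range (\<lambda>k x. cser k (csinv (u x)))"
  let ?A = "fun_algebra (\<Gamma> \<union> Collect (smooth_on W))"
  let ?D = "\<lambda>F F'. (\<forall>x\<in>W. (F has_derivative F' x) (at x)) \<and> (\<forall>v. (\<lambda>x. F' x v) \<in> ?A)"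
  have sm: "F \<in> ?A" if "smooth_on W F" for F using that by (auto intro: fun_algebra.gen)
  have genA: "F \<in> ?A" if "F \<in> \<Gamma>" for F using that by (auto intro: fun_algebra.gen)
  have "c \<in> ?A" "y \<in> ?A" by (rule sm c y)+
  moreover have "(\<lambda>x. cos (\<theta> x)) \<in> ?A" "(\<lambda>x. sin (\<theta> x)) \<in> ?A" "i 1 \<in> ?A" "i 2 \<in> ?A" "\<And>k. (\<lambda>x. cser k (csinv (u x))) \<in> ?A"
    by (rule genA, force simp: \<Gamma>_def)+
  ultimately have A: "c \<in> ?A" "y \<in> ?A" "(\<lambda>x. cos (\<theta> x)) \<in> ?A" "(\<lambda>x. sin (\<theta> x)) \<in> ?A" "i 1 \<in> ?A" "i 2 \<in> ?A"
    "(\<lambda>x. cser k (csinv (u x))) \<in> ?A" for k by blast+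
  have facts: "u x > -1" "csinv (u x) > - pi\<^sup>2" "cser 1 (csinv (u x)) > 0" "cser 2 (csinv (u x)) > 0" "(c x)\<^sup>2 - 1 > 0"
    if "x \<in> W" for x
    using Theta[OF c1[OF that], of "y x"] csinv(2) cser_1_pos cser_2_pos c1[OF that]
    by (auto simp: u_def \<theta>_def theta_dom_def)
  define dc where "dc x = frechet_derivative c (at x)" for x
  define dy where "dy x = frechet_derivative y (at x)" for x
  have dcy: "(c has_derivative dc x) (at x)" "(y has_derivative dy x) (at x)" if "x \<in> W" for x
    using that smooth_on_has_derivative c y by (auto simp: dc_def dy_def)
  have "smooth_on W (\<lambda>x. inverse ((c x)\<^sup>2 - 1))"
  proof (intro smooth_on_inverse smooth_on_diff smooth_on_power smooth_on_const c W)
    show "(c x)\<^sup>2 - 1 \<noteq> 0" if "x \<in> W" for x using facts(5)[OF that] by simp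
  qed
  then have dA: "(\<lambda>x. dc x v) \<in> ?A" "(\<lambda>x. dy x v) \<in> ?A" "(\<lambda>x. inverse ((c x)\<^sup>2 - 1)) \<in> ?A" for v
    using sm smooth_on_frechet[OF c] smooth_on_frechet[OF y] unfolding dc_def dy_def by auto
  \<comment> \<open>The formula of \<open>Theta_has_derivative\<close> with q, q' and 1 / q'
    expressed by the generators.\<close>
  define \<theta>' where "\<theta>' x v = (dy x v + sin (\<theta> x) * (1/2 * i 1 x + c x * cos (\<theta> x) *
      (- 1/2 * cser 2 (csinv (u x)) * i 1 x ^ 3)) * dc x v) * (inverse ((c x)\<^sup>2 - 1) * (-2 * cser 1 (csinv (u x)) ^ 3 * i 2 x))" for x v
  define u' where "u' x v = dc x v * cos (\<theta> x) + c x * (- sin (\<theta> x) * \<theta>' x v)" for x v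
  define x' where "x' x v = u' x v * i 1 x" for x v
  have \<theta>'A: "(\<lambda>x. \<theta>' x v) \<in> ?A" for v
    unfolding \<theta>'_def by (intro fun_algebra_intros A dA)
  have u'A: "(\<lambda>x. u' x v) \<in> ?A" for v
    unfolding u'_def by (intro fun_algebra_intros A dA \<theta>'A)
  have x'A: "(\<lambda>x. x' x v) \<in> ?A" for v
    unfolding x'_def by (intro fun_algebra_intros A u'A)
  have \<theta>': "(\<theta> has_derivative \<theta>' x) (at x)" if x: "x \<in> W" for x
  proof -
    have "((\<lambda>x. (c x, y x)) has_derivative (\<lambda>v. (dc x v, dy x v))) (at x)"
      using dcy[OF x] by (rule has_derivative_Pair)
    from has_derivative_compose[OF this Theta_has_derivative[OF c1[OF x]]]
    have "(\<theta> has_derivative (\<lambda>v. (dy x v + sin (\<theta> x) * (arcosh_quot (u x) + c x * cos (\<theta> x) * arcosh_quot_deriv (u x)) * dc x v)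
        / (((c x)\<^sup>2 - 1) * arcosh_quot_deriv (u x)))) (at x)"
      by (simp add: \<theta>_def[abs_def] u_def)
    moreover have "arcosh_quot (u x) = 1/2 * i 1 x"
      "arcosh_quot_deriv (u x) = - 1/2 * cser 2 (csinv (u x)) * i 1 x ^ 3"
      "inverse (arcosh_quot_deriv (u x)) = -2 * cser 1 (csinv (u x)) ^ 3 * i 2 x"
      using facts[OF x] by (simp_all add: arcosh_quot_eq arcosh_quot_deriv_def i_def divide_simps)
    ultimately show ?thesis by (simp only: \<theta>'_def[abs_def] divide_inverse inverse_mult_distrib)
  qed
  have u': "(u has_derivative u' x) (at x)" if x: "x \<in> W" for x
    unfolding u_def[abs_def]
    by (rule derivative_eq_intros dcy[OF x] \<theta>'[OF x] refl)+ (simp add: u'_def fun_eq_iff)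
  have x': "((\<lambda>x. csinv (u x)) has_derivative x' x) (at x)" if x: "x \<in> W" for x
    using DERIV_compose_FDERIV[where f = csinv, OF csinv_deriv u'[OF x]] facts[OF x]
    by (simp add: x'_def[abs_def] i_def)
  have s': "((\<lambda>x. cser k (csinv (u x))) has_derivative (\<lambda>v. x' x v * cser (Suc k) (csinv (u x)))) (at x)" if x: "x \<in> W" for x k
    by (rule DERIV_compose_FDERIV[where f = "cser k", OF cser_deriv x'[OF x]])
  have i': "(i k has_derivative (\<lambda>v. - (i k x * (x' x v * cser (Suc k) (csinv (u x))) * i k x))) (at x)"
    if "x \<in> W" "k = 1 \<or> k = 2" for x k
    unfolding i_def[abs_def] by (rule Deriv.has_derivative_inverse[OF _ s'[OF that(1)]]) (use facts[OF that(1)] that(2) in auto)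
  have gen: "\<exists>F'. ?D F F'" if "F \<in> \<Gamma>" for F
    using that[unfolded \<Gamma>_def]
  proof (elim UnE insertE emptyE rangeE)
    assume "F = \<theta>"
    then show ?thesis using \<theta>' \<theta>'A by blast
  next
    assume "F = (\<lambda>x. sin (\<theta> x))"
    moreover have "((\<lambda>x. sin (\<theta> x)) has_derivative (\<lambda>v. \<theta>' x v * cos (\<theta> x))) (at x)" if "x \<in> W" for x
      by (rule derivative_eq_intros \<theta>'[OF that] refl | simp add: mult_ac)+
    ultimately show ?thesis
      by (intro exI[of _ "\<lambda>x v. \<theta>' x v * cos (\<theta> x)"]) (auto intro!: fun_algebra.mult \<theta>'A A)
  next
    assume "F = (\<lambda>x. cos (\<theta> x))"
    moreover have "((\<lambda>x. cos (\<theta> x)) has_derivative (\<lambda>v. \<theta>' x v * (- sin (\<theta> x)))) (at x)" if "x \<in> W" for x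
      by (rule derivative_eq_intros \<theta>'[OF that] refl | simp add: mult_ac)+
    moreover have "(\<lambda>x. \<theta>' x v * (- sin (\<theta> x))) \<in> ?A" for v by (intro fun_algebra_intros \<theta>'A A)
    ultimately show ?thesis
      by (intro exI[of _ "\<lambda>x v. \<theta>' x v * (- sin (\<theta> x))"]) blast
  next
    assume "F = (\<lambda>x. csinv (u x))"
    then show ?thesis using x' x'A by blast
  next
    assume "F = i 1"
    moreover have "(\<lambda>x. - (i 1 x * (x' x v * cser (Suc 1) (csinv (u x))) * i 1 x)) \<in> ?A" for v
      by (intro fun_algebra_intros x'A A)
    ultimately show ?thesis using i'[of _ 1]
      by (intro exI[of _ "\<lambda>x v. - (i 1 x * (x' x v * cser (Suc 1) (csinv (u x))) * i 1 x)"]) simp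
  next
    assume "F = i 2"
    moreover have "(\<lambda>x. - (i 2 x * (x' x v * cser (Suc 2) (csinv (u x))) * i 2 x)) \<in> ?A" for v
      by (intro fun_algebra_intros x'A A)
    ultimately show ?thesis using i'[of _ 2]
      by (intro exI[of _ "\<lambda>x v. - (i 2 x * (x' x v * cser (Suc 2) (csinv (u x))) * i 2 x)"]) simp
  next
    fix k assume "F = (\<lambda>x. cser k (csinv (u x)))"
    moreover have "(\<lambda>x. x' x v * cser (Suc k) (csinv (u x))) \<in> ?A" for v
      by (intro fun_algebra_intros x'A A)
    ultimately show ?thesis using s'[of _ k]
      by (intro exI[of _ "\<lambda>x v. x' x v * cser (Suc k) (csinv (u x))"]) simp
  qed
  have "smooth_on W (\<lambda>x. sqrt ((c x)\<^sup>2 - 1))"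
    using facts(5) by (intro smooth_on_sqrt smooth_on_diff smooth_on_power smooth_on_const c W) auto
  then have *: "(\<lambda>x. sqrt ((c x)\<^sup>2 - 1) * (1/2 * i 1 x)) \<in> ?A"
    by (intro fun_algebra_intros A sm)
  have "smooth_on W (\<lambda>x. sqrt ((c x)\<^sup>2 - 1) * (1/2 * i 1 x))"
    by (rule smooth_on_algebra[OF W, of \<Gamma>]) (use gen * in blast)+
  then show ?thesis
    by (rule smooth_on_cong[OF W, rotated])
       (use facts in \<open>auto simp: Phi_def i_def u_def \<theta>_def arcosh_quot_eq divide_simps\<close>)
qed

section \<open>Matrices in complex coordinates\<close>

text \<open>Writing \<open>u = cu M\<close> and \<open>v = cv M\<close>, one has \<open>M = Re u I + Im u Z + Re v X + Im v Y\<close>.\<close>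

definition cu :: "real^2^2 \<Rightarrow> complex" where
  "cu M = Complex ((M$1$1 + M$2$2) / 2) ((M$1$2 - M$2$1) / 2)"

definition cv :: "real^2^2 \<Rightarrow> complex" where
  "cv M = Complex ((M$1$1 - M$2$2) / 2) ((M$1$2 + M$2$1) / 2)"

definition mk_mat :: "complex \<Rightarrow> complex \<Rightarrow> real^2^2" where
  "mk_mat u v = vector [vector [Re u + Re v, Im u + Im v], vector [Im v - Im u, Re u - Re v]]"

lemma cu_mk_mat [simp]: "cu (mk_mat u v) = u" and cv_mk_mat [simp]: "cv (mk_mat u v) = v"
  by (simp_all add: cu_def cv_def mk_mat_def complex_eq_iff)

lemma mat_eqI: "cu A = cu B \<Longrightarrow> cv A = cv B \<Longrightarrow> A = B"
  by (simp add: cu_def cv_def vec_eq_iff forall_2)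

text \<open>The law of complex matrices with columns (u, v) and (cnj v, cnj u): these coordinates
  realise SL(2,R) as SU(1,1), where right multiplication by exp (z Z) multiplies both u and v by
  \<open>cis z\<close>.\<close>

lemma cu_mult: "cu (A ** B) = cu A * cu B + cnj (cv A) * cv B"
  and cv_mult: "cv (A ** B) = cv A * cu B + cnj (cu A) * cv B"
  by (simp_all add: cu_def cv_def matrix_matrix_mult_def sum_2 complex_eq_iff field_simps)

lemma cu_one [simp]: "cu (mat 1) = 1" and cv_one [simp]: "cv (mat 1) = 0"
  by (simp_all add: cu_def cv_def mat_def complex_eq_iff)

lemma det_cu_cv: "det A = (cmod (cu A))\<^sup>2 - (cmod (cv A))\<^sup>2"
  unfolding cmod_power2 by (simp add: det_2 cu_def cv_def field_simps power2_eq_square)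

lemma bounded_linear_cu: "bounded_linear cu" and bounded_linear_cv: "bounded_linear cv"
proof -
  have "linear cu" "linear cv"
    by (rule linearI; simp add: cu_def cv_def complex_eq_iff add_divide_distrib diff_divide_distrib distrib_left right_diff_distrib)+
  then show "bounded_linear cu" "bounded_linear cv" by (simp_all add: linear_conv_bounded_linear)
qed

lemmas cu_add = linear_add[OF bounded_linear.linear[OF bounded_linear_cu]]
lemmas cv_add = linear_add[OF bounded_linear.linear[OF bounded_linear_cv]]
lemmas cu_scaleR = linear_scale[OF bounded_linear.linear[OF bounded_linear_cu]]
lemmas cv_scaleR = linear_scale[OF bounded_linear.linear[OF bounded_linear_cv]]
lemmas cu_has_derivative = bounded_linear_imp_has_derivative[OF bounded_linear_cu]
lemmas cv_has_derivative = bounded_linear_imp_has_derivative[OF bounded_linear_cv]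

lemma cu_cv_basis [simp]:
  "cu X_mat = 0" "cv X_mat = 1" "cu Y_mat = 0" "cv Y_mat = \<i>" "cu Z_mat = \<i>" "cv Z_mat = 0"
  by (simp_all add: cu_def cv_def X_mat_def Y_mat_def Z_mat_def complex_eq_iff)

lemma continuous_on_If_const:
  "(b \<Longrightarrow> continuous_on S f) \<Longrightarrow> (\<not> b \<Longrightarrow> continuous_on S g) \<Longrightarrow> continuous_on S (\<lambda>x. if b then f x else g x)"
  by (cases b) simp_all

lemma mk_mat_continuous: "continuous_on S (\<lambda>x. mk_mat (f x) (g x))" if "continuous_on S f" "continuous_on S g"
proof -
  have eq: "mk_mat u v = (\<chi> i j. if i = 1 then if j = 1 then Re u + Re v else Im u + Im v
     else if j = 1 then Im v - Im u else Re u - Re v)" for u v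
    by (simp add: mk_mat_def vec_eq_iff forall_2)
  show ?thesis unfolding eq using that
    by (intro continuous_on_vec_lambda continuous_on_If_const) (auto intro!: continuous_intros)
qed

text \<open>Cayley-Hamilton for trace zero: \<open>A ** A\<close> is x times the identity with x = -
  det A.\<close>

lemma mat_iterate:
  assumes "Re (cu A) = 0" and x: "x = (cmod (cv A))\<^sup>2 - (Im (cu A))\<^sup>2"
  shows "((**) A ^^ n) (mat 1) = x ^ (n div 2) *\<^sub>R (if even n then mat 1 else A)"
proof (induction n)
  case (Suc n)
  have sq: "A ** A = x *\<^sub>R mat 1"
    using assms(1) unfolding x cmod_power2
    by (intro mat_eqI) (auto simp: cu_mult cv_mult cu_scaleR cv_scaleR complex_eq_iff power2_eq_square)
  have "A ** (c *\<^sub>R B) = c *\<^sub>R (A ** B)" for c and B :: "real^2^2"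
    by (intro mat_eqI) (simp_all add: cu_mult cv_mult cu_scaleR cv_scaleR algebra_simps)
  with Suc sq show ?case by (auto simp: algebra_simps elim!: oddE evenE)
qed simp

lemma mat_exp_eq:
  assumes "Re (cu A) = 0" and x: "x = (cmod (cv A))\<^sup>2 - (Im (cu A))\<^sup>2"
  shows "mat_exp A = cser 0 x *\<^sub>R mat 1 + (2 * cser 1 x) *\<^sub>R A"
proof -
  define f where "f k = x ^ k / fact (2 * k)" for k
  define g where "g k = x ^ k / fact (2 * k + 1)" for k
  have "f sums cser 0 x"
    using cser_summable[of 0 x] by (simp add: cser_def f_def[abs_def] sums_iff)
  then have f: "(\<lambda>n. if even n then f (n div 2) else 0) sums cser 0 x"
    using sums_if[of "\<lambda>_. 0" 0 f "cser 0 x"] by simp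
  \<comment> \<open>(k + 1) / (2k + 2)! = 1 / (2 (2k + 1)!), which makes the odd part of the
    exponential series equal to \<open>2 * cser 1 x\<close>.\<close>
  have "(diffs ^^ 1) (\<lambda>n. 1 / fact (2 * n) :: real) k = 1 / (2 * fact (2 * k + 1))" for k
  proof -
    have "(1 + real k) * (2 * fact (2 * k + 1)) = (fact (2 * k + 2) :: real)"
      using fact_Suc[of "2 * k + 1", where 'a = real] by (simp add: One_nat_def algebra_simps)
    then show ?thesis by (simp add: diffs_def One_nat_def divide_simps mult_ac)
  qed
  then have "(\<lambda>k. 2 * (1 / (2 * fact (2 * k + 1)) * x ^ k)) sums (2 * cser 1 x)"
    using cser_summable[of 1 x] unfolding cser_def by (intro sums_mult) (simp add: summable_sums)
  then have "g sums (2 * cser 1 x)" by (simp add: g_def[abs_def] field_simps)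
  then have g: "(\<lambda>n. if even n then 0 else g ((n - 1) div 2)) sums (2 * cser 1 x)"
    by (rule sums_if')
  have "(\<lambda>n. (if even n then f (n div 2) else 0) *\<^sub>R mat 1 + (if even n then 0 else g ((n - 1) div 2)) *\<^sub>R A)
     sums (cser 0 x *\<^sub>R mat 1 + (2 * cser 1 x) *\<^sub>R A)"
    by (intro sums_add bounded_linear.sums[OF bounded_linear_scaleR_left] f g)
  also have "(\<lambda>n. (if even n then f (n div 2) else 0) *\<^sub>R mat 1 + (if even n then 0 else g ((n - 1) div 2)) *\<^sub>R A)
     = (\<lambda>n. (1 / fact n) *\<^sub>R (((**) A ^^ n) (mat 1)))"
    by (auto simp: fun_eq_iff mat_iterate[OF assms] f_def g_def elim!: oddE evenE)
  finally show ?thesis by (simp add: mat_exp_def sums_iff)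
qed

lemma mat_exp_Z: "mat_exp (z *\<^sub>R Z_mat) = mk_mat (cis z) 0"
  using mat_exp_eq[of "z *\<^sub>R Z_mat" "- z\<^sup>2"] cser_1_neg_square[of z]
  by (intro mat_eqI) (simp_all add: cu_add cv_add cu_scaleR cv_scaleR cser_0_neg_square complex_eq_iff mult_ac)

lemma mat_exp_XY:
  "mat_exp ((r * cos \<phi>) *\<^sub>R X_mat + (r * sin \<phi>) *\<^sub>R Y_mat) = mk_mat (of_real (cosh r)) (of_real (sinh r) * cis \<phi>)"
proof -
  have "(r * cos \<phi>)\<^sup>2 + (r * sin \<phi>)\<^sup>2 = r\<^sup>2" by (simp add: power_mult_distrib flip: distrib_left)
  then show ?thesis
    using mat_exp_eq[of "(r * cos \<phi>) *\<^sub>R X_mat + (r * sin \<phi>) *\<^sub>R Y_mat" "r\<^sup>2"] cser_1_square[of r]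
    by (intro mat_eqI) (simp_all add: cu_add cv_add cu_scaleR cv_scaleR cser_0_square complex_eq_iff cmod_power2 mult_ac)
qed

section \<open>The test functions and their horizontal gradient\<close>

lemma smooth_on_Re_cu: "open W \<Longrightarrow> smooth_on W (\<lambda>M. Re (cu M))"
  and smooth_on_Im_cu: "open W \<Longrightarrow> smooth_on W (\<lambda>M. Im (cu M))"
  and smooth_on_Re_cv: "open W \<Longrightarrow> smooth_on W (\<lambda>M. Re (cv M))"
  and smooth_on_Im_cv: "open W \<Longrightarrow> smooth_on W (\<lambda>M. Im (cv M))"
  by (erule smooth_on_bounded_linear;
      intro bounded_linear_compose[OF bounded_linear_Re] bounded_linear_compose[OF bounded_linear_Im]
        bounded_linear_cu bounded_linear_cv)+

text \<open>The radial coordinate, shifted by \<open>\<epsilon>\<close> away from the singular axis.\<close>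

definition shifted_cosh :: "real \<Rightarrow> real^2^2 \<Rightarrow> real" where
  "shifted_cosh \<epsilon> M = sqrt (1 + \<epsilon>\<^sup>2 + (cmod (cv M))\<^sup>2)"

text \<open>The angle y is a parameter: it will be a local branch of z on the covering group and the
  rounded angle on SL(2,R).\<close>

definition shifted_dist :: "real \<Rightarrow> (real^2^2 \<Rightarrow> real) \<Rightarrow> real^2^2 \<Rightarrow> real" where
  "shifted_dist \<epsilon> y M = Phi (shifted_cosh \<epsilon> M) (y M)"

lemma shifted_cosh_gt_1: "\<epsilon> > 0 \<Longrightarrow> shifted_cosh \<epsilon> M > 1"
  by (simp add: shifted_cosh_def add_pos_nonneg)

lemma shifted_cosh_has_derivative:
  assumes "\<epsilon> > 0"
  shows "(shifted_cosh \<epsilon> has_derivative (\<lambda>V. Re (cnj (cv M) * cv V) / shifted_cosh \<epsilon> M)) (at M)"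
proof -
  let ?N = "\<lambda>M. 1 + \<epsilon>\<^sup>2 + ((Re (cv M))\<^sup>2 + (Im (cv M))\<^sup>2)"
  have "?N M > 0" by (simp add: add_pos_nonneg)
  moreover have "(?N has_derivative (\<lambda>V. 2 * Re (cnj (cv M) * cv V))) (at M)"
    by (rule has_derivative_eq_rhs[OF has_derivative_add[OF has_derivative_const
          has_derivative_add[OF has_derivative_power[OF has_derivative_Re[OF cv_has_derivative], where n = 2]
            has_derivative_power[OF has_derivative_Im[OF cv_has_derivative], where n = 2]]]])
       (simp add: fun_eq_iff algebra_simps)
  ultimately have *: "((\<lambda>M. sqrt (?N M)) has_derivative (\<lambda>V. 2 * Re (cnj (cv M) * cv V) * (inverse (sqrt (?N M)) / 2))) (at M)"
    by (rule DERIV_compose_FDERIV[where f = sqrt, OF DERIV_real_sqrt])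
  have eq: "shifted_cosh \<epsilon> = (\<lambda>M. sqrt (?N M))" by (rule ext) (simp only: shifted_cosh_def cmod_power2)
  show ?thesis unfolding eq
    by (rule has_derivative_eq_rhs[OF *], rule ext) (simp only: divide_inverse, simp)
qed

lemma smooth_on_shifted_dist:
  assumes "open W" "\<epsilon> > 0" "smooth_on W y"
  shows "smooth_on W (shifted_dist \<epsilon> y)"
  unfolding shifted_dist_def[abs_def]
proof (intro smooth_on_Phi assms)
  have "smooth_on W (\<lambda>M. sqrt (1 + \<epsilon>\<^sup>2 + ((Re (cv M))\<^sup>2 + (Im (cv M))\<^sup>2)))"
    using assms(2)
    by (intro smooth_on_sqrt smooth_on_add smooth_on_power smooth_on_const smooth_on_Re_cv smooth_on_Im_cv assms(1))
       (simp add: add_pos_nonneg)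
  then show "smooth_on W (shifted_cosh \<epsilon>)" by (simp add: shifted_cosh_def[abs_def] cmod_power2)
qed (use shifted_cosh_gt_1[OF assms(2)] in auto)

text \<open>The hypothesis on y says dy = \<mu> d(arg u) with u = \<open>cu M\<close>. With v =
  \<open>cv M\<close> and P = u v, the derivatives along X and Y are a Re P + b Im P and a Im P - b
  Re P, so the mixed terms cancel and (a^2 + b^2) |P|^2 remains. Here s = sinh^2 r and |P|^2 = (1 +
  s) s.\<close>

lemma shifted_dist_gradient:
  assumes \<epsilon>: "\<epsilon> > 0" and det: "det M = 1" and \<mu>: "\<bar>\<mu>\<bar> \<le> 1"
    and y: "(y has_derivative (\<lambda>V. \<mu> * Im (cu V * cnj (cu M)) / (cmod (cu M))\<^sup>2)) (at M)"
  defines "D \<equiv> frechet_derivative (shifted_dist \<epsilon> y) (at M)"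
  shows "(D (M ** X_mat))\<^sup>2 + (D (M ** Y_mat))\<^sup>2 \<le> 1"
proof -
  define c where "c = shifted_cosh \<epsilon> M"
  define \<theta> where "\<theta> = Theta c (y M)"
  define w where "w = sqrt (c\<^sup>2 - 1)"
  define s where "s = (cmod (cv M))\<^sup>2"
  define P where "P = cu M * cv M"
  have c: "c > 1" using shifted_cosh_gt_1[OF \<epsilon>] by (simp add: c_def)
  have s: "s \<ge> 0" "(cmod (cu M))\<^sup>2 = 1 + s" using det by (simp_all add: s_def det_cu_cv)
  have c2: "c\<^sup>2 = 1 + \<epsilon>\<^sup>2 + s" by (simp add: c_def shifted_cosh_def s_def add_nonneg_nonneg)
  have w2: "w\<^sup>2 = s + \<epsilon>\<^sup>2" "w > 0" using c s(1) \<epsilon> by (simp_all add: w_def c2 add_pos_nonneg)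
  have P2: "(Re P)\<^sup>2 + (Im P)\<^sup>2 = (1 + s) * s"
    unfolding cmod_power2[symmetric] P_def norm_mult power_mult_distrib s by (simp add: s_def)
  have "((\<lambda>M. (shifted_cosh \<epsilon> M, y M)) has_derivative (\<lambda>V. (Re (cnj (cv M) * cv V) / c,
      \<mu> * Im (cu V * cnj (cu M)) / (1 + s)))) (at M)"
    using has_derivative_Pair[OF shifted_cosh_has_derivative[OF \<epsilon>] y] s by (simp add: c_def)
  from has_derivative_compose[OF this, folded c_def, OF Phi_has_derivative[OF c, of "y M"]]
  have "(shifted_dist \<epsilon> y has_derivative (\<lambda>V. (cos \<theta> * (Re (cnj (cv M) * cv V) / c)
      - c * sin \<theta> * (\<mu> * Im (cu V * cnj (cu M)) / (1 + s))) / w)) (at M)"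
    by (simp add: shifted_dist_def[abs_def] \<theta>_def w_def)
  from frechet_derivative_at[OF this] have D: "D V = (cos \<theta> * (Re (cnj (cv M) * cv V) / c)
      - c * sin \<theta> * (\<mu> * Im (cu V * cnj (cu M)) / (1 + s))) / w" for V
    unfolding D_def by (rule fun_cong[symmetric])
  have X: "Re (cnj (cv M) * cv (M ** X_mat)) = Re P" "Im (cu (M ** X_mat) * cnj (cu M)) = - Im P"
    and Y: "Re (cnj (cv M) * cv (M ** Y_mat)) = Im P" "Im (cu (M ** Y_mat) * cnj (cu M)) = Re P"
    by (simp_all add: cu_mult cv_mult P_def algebra_simps)
  define a where "a = cos \<theta> / (c * w)"
  define b where "b = c * sin \<theta> * \<mu> / ((1 + s) * w)"
  have "(D (M ** X_mat))\<^sup>2 + (D (M ** Y_mat))\<^sup>2 = (a * Re P + b * Im P)\<^sup>2 + (a * Im P - b * Re P)\<^sup>2"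
  proof -
    have *: "(cos \<theta> * (p / c) - c * sin \<theta> * (\<mu> * q / (1 + s))) / w = a * p - b * q" for p q
      by (simp add: a_def b_def diff_divide_distrib)
    show ?thesis unfolding D X Y * by simp
  qed
  also have "\<dots> = (a\<^sup>2 + b\<^sup>2) * ((1 + s) * s)" unfolding P2[symmetric] by (simp add: power2_eq_square algebra_simps)
  also have "\<dots> = (cos \<theta>)\<^sup>2 * ((1 + s) * s / (c\<^sup>2 * w\<^sup>2)) + (sin \<theta>)\<^sup>2 * (\<mu>\<^sup>2 * (c\<^sup>2 * s / ((1 + s) * w\<^sup>2)))"
  proof -
    have "b\<^sup>2 * ((1 + s) * s) = (sin \<theta>)\<^sup>2 * \<mu>\<^sup>2 * c\<^sup>2 * s * ((1 + s) / (1 + s)) / ((1 + s) * w\<^sup>2)"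
      by (simp only: b_def power_mult_distrib power_divide) (simp add: power2_eq_square)
    moreover have "(1 + s) / (1 + s) = 1" using s(1) by simp
    ultimately show ?thesis by (simp add: distrib_right a_def power_mult_distrib power_divide)
  qed
  also have "\<dots> \<le> (cos \<theta>)\<^sup>2 * 1 + (sin \<theta>)\<^sup>2 * (1 * 1)"
  proof (intro add_mono mult_left_mono mult_mono)
    have "(1 + s) * s \<le> c\<^sup>2 * w\<^sup>2" unfolding c2 w2 using s by (intro mult_mono) auto
    moreover have "0 < c\<^sup>2 * w\<^sup>2" using c w2(2) by simp
    ultimately show "(1 + s) * s / (c\<^sup>2 * w\<^sup>2) \<le> 1" by (simp add: divide_le_eq_1)
    \<comment> \<open>This is tanh^2 r \<le> tanh^2 rho with the denominators cleared.\<close>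
    have "c\<^sup>2 * s \<le> (1 + s) * w\<^sup>2" unfolding c2 w2 using s by (simp add: algebra_simps)
    moreover have "0 < (1 + s) * w\<^sup>2" using s w2(2) by simp
    ultimately show "c\<^sup>2 * s / ((1 + s) * w\<^sup>2) \<le> 1" by (simp add: divide_le_eq_1)
    show "\<mu>\<^sup>2 \<le> 1" using \<mu> by (simp add: abs_square_le_1)
  qed (use s in auto)
  also have "\<dots> = 1" by simp
  finally show ?thesis .
qed

section \<open>Branches of the angle and their differentials\<close>

definition local_angle :: "real \<Rightarrow> real^2^2 \<Rightarrow> real" where
  "local_angle z\<^sub>0 M = z\<^sub>0 + arctan (Im (cu M * cis (- z\<^sub>0)) / Re (cu M * cis (- z\<^sub>0)))"

definition angle_dom :: "real \<Rightarrow> (real^2^2) set" where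
  "angle_dom z\<^sub>0 = {M. Re (cu M * cis (- z\<^sub>0)) > 0}"

lemma open_angle_dom: "open (angle_dom z\<^sub>0)"
  unfolding angle_dom_def
  by (intro open_Collect_less continuous_intros continuous_on_compose2[OF linear_continuous_on[OF bounded_linear_cu]]) auto

lemma local_angle_smooth: "smooth_on (angle_dom z\<^sub>0) (local_angle z\<^sub>0)"
proof -
  have "smooth_on (angle_dom z\<^sub>0) (\<lambda>M. z\<^sub>0 + arctan ((Re (cu M) * sin (- z\<^sub>0) + Im (cu M) * cos (- z\<^sub>0))
     / (Re (cu M) * cos (- z\<^sub>0) - Im (cu M) * sin (- z\<^sub>0))))"
    by (intro smooth_on_add smooth_on_const smooth_on_arctan smooth_on_divide smooth_on_diff smooth_on_mult
        smooth_on_Re_cu smooth_on_Im_cu open_angle_dom) (simp add: angle_dom_def)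
  then show ?thesis by (simp add: local_angle_def[abs_def] algebra_simps)
qed

text \<open>The differential of arg (cu M): turning by \<open>cis (- z\<^sub>0)\<close> changes
  neither |cu M| nor Im (cu V * cnj (cu M)). The factor 1 is the \<mu> of
  \<open>shifted_dist_gradient\<close>.\<close>

lemma local_angle_has_derivative:
  assumes "M \<in> angle_dom z\<^sub>0"
  shows "(local_angle z\<^sub>0 has_derivative (\<lambda>V. 1 * Im (cu V * cnj (cu M)) / (cmod (cu M))\<^sup>2)) (at M)"
proof -
  define e where "e = cis (- z\<^sub>0)"
  define w where "w M = cu M * e" for M
  have w: "Re (w M) > 0" using assms by (simp add: angle_dom_def w_def e_def)
  have e: "(cmod e)\<^sup>2 = 1" by (simp add: e_def)
  have wd: "(w has_derivative w) (at M)" unfolding w_def[abs_def]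
    by (rule has_derivative_mult_left[OF cu_has_derivative])
  have q: "((\<lambda>M. Im (w M) / Re (w M)) has_derivative
      (\<lambda>V. (Im (w V) * Re (w M) - Im (w M) * Re (w V)) / (Re (w M) * Re (w M)))) (at M)"
    using w by (intro has_derivative_divide' wd has_derivative_Im has_derivative_Re) auto
  have "((\<lambda>M. z\<^sub>0 + arctan (Im (w M) / Re (w M))) has_derivative
     (\<lambda>V. (Im (w V) * Re (w M) - Im (w M) * Re (w V)) / (Re (w M) * Re (w M)) * inverse (1 + (Im (w M) / Re (w M))\<^sup>2))) (at M)"
    using has_derivative_add[OF has_derivative_const[of z\<^sub>0] DERIV_compose_FDERIV[where f = arctan, OF DERIV_arctan q]]
    by simp
  also have "(\<lambda>V. (Im (w V) * Re (w M) - Im (w M) * Re (w V)) / (Re (w M) * Re (w M)) * inverse (1 + (Im (w M) / Re (w M))\<^sup>2))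
    = (\<lambda>V. 1 * Im (cu V * cnj (cu M)) / (cmod (cu M))\<^sup>2)"
  proof
    fix V
    have "(cmod (cu M))\<^sup>2 = (Re (w M))\<^sup>2 + (Im (w M))\<^sup>2"
      unfolding cmod_power2[symmetric] w_def norm_mult power_mult_distrib e by simp
    moreover have "Im (cu V * cnj (cu M)) = Im (w V * cnj (w M))"
    proof -
      have "w V * cnj (w M) = cu V * cnj (cu M) * (e * cnj e)" by (simp add: w_def mult_ac)
      also have "e * cnj e = 1" using e by (simp add: complex_norm_square[symmetric])
      finally show ?thesis by simp
    qed
    moreover have *: "(B * a - b * A) / (a * a) * inverse (1 + (b / a)\<^sup>2) = (B * a - b * A) / (a\<^sup>2 + b\<^sup>2)"
      if "a > 0" for a b A B :: real
    proof -
      have "1 + (b / a)\<^sup>2 = (a\<^sup>2 + b\<^sup>2) / (a * a)" using that by (simp add: field_simps power2_eq_square)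
      then show ?thesis using that by simp
    qed
    ultimately show "(Im (w V) * Re (w M) - Im (w M) * Re (w V)) / (Re (w M) * Re (w M)) * inverse (1 + (Im (w M) / Re (w M))\<^sup>2)
      = 1 * Im (cu V * cnj (cu M)) / (cmod (cu M))\<^sup>2"
      using * w by simp
  qed
  finally show ?thesis by (simp add: local_angle_def[abs_def] w_def e_def)
qed

text \<open>A smooth and \<open>2 \<pi>\<close>-periodic substitute for \<open>\<bar>z\<bar>\<close> on SL(2,R): it is \<open>arccos (k cos z)\<close>.\<close>

definition rounded_angle :: "real \<Rightarrow> real^2^2 \<Rightarrow> real" where
  "rounded_angle k M = arccos (k * (Re (cu M) / cmod (cu M)))"

lemma rounded_angle_abs_less:
  assumes "0 \<le> k" "k < 1" shows "\<bar>k * (Re u / cmod u)\<bar> < 1"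
proof -
  have "\<bar>Re u / cmod u\<bar> \<le> 1" using abs_Re_le_cmod[of u] by (simp add: divide_le_eq_1)
  then have "k * \<bar>Re u / cmod u\<bar> \<le> k * 1" using assms by (intro mult_left_mono) auto
  then show ?thesis using assms by (simp add: abs_mult)
qed

lemma open_cu_nonzero: "open {M. cu M \<noteq> 0}"
  by (intro open_Collect_neq continuous_intros linear_continuous_on[OF bounded_linear_cu])

lemma smooth_on_cmod_cu: "open W \<Longrightarrow> (\<And>M. M \<in> W \<Longrightarrow> cu M \<noteq> 0) \<Longrightarrow> smooth_on W (\<lambda>M. cmod (cu M))"
  unfolding cmod_def
  by (intro smooth_on_sqrt smooth_on_add smooth_on_power smooth_on_Re_cu smooth_on_Im_cu)
     (auto simp: complex_eq_iff add_pos_nonneg add_nonneg_pos sum_power2_gt_zero_iff)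

lemma rounded_angle_smooth:
  assumes "0 \<le> k" "k < 1" shows "smooth_on {M. cu M \<noteq> 0} (rounded_angle k)"
  unfolding rounded_angle_def[abs_def]
  by (intro smooth_on_arccos smooth_on_mult smooth_on_const smooth_on_divide smooth_on_Re_cu
      smooth_on_cmod_cu open_cu_nonzero rounded_angle_abs_less assms) auto

text \<open>With z the argument of \<open>cu M\<close>, \<mu> is the derivative k sin z / sqrt (1 -
  k^2 cos^2 z) of arccos (k cos z); it is at most 1 in absolute value because k^2 sin^2 z + k^2
  cos^2 z = k^2 \<le> 1.\<close>

lemma rounded_angle_has_derivative:
  assumes k: "0 \<le> k" "k < 1" and M: "cu M \<noteq> 0"
  defines "\<mu> \<equiv> k * (Im (cu M) / cmod (cu M)) / sqrt (1 - (k * (Re (cu M) / cmod (cu M)))\<^sup>2)"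
  shows "(rounded_angle k has_derivative (\<lambda>V. \<mu> * Im (cu V * cnj (cu M)) / (cmod (cu M))\<^sup>2)) (at M)" "\<bar>\<mu>\<bar> \<le> 1"
proof -
  define n where "n = cmod (cu M)"
  have n: "n > 0" "n\<^sup>2 = (Re (cu M))\<^sup>2 + (Im (cu M))\<^sup>2" using M by (simp_all add: n_def cmod_power2)
  define t where "t = k * (Re (cu M) / n)"
  have t: "\<bar>t\<bar> < 1" using rounded_angle_abs_less[OF k] by (simp add: t_def n_def)
  have t2: "1 - t\<^sup>2 > 0" using t by (simp add: abs_square_less_1)
  have nd: "((\<lambda>M. cmod (cu M)) has_derivative (\<lambda>V. (Re (cu M) * Re (cu V) + Im (cu M) * Im (cu V)) / n)) (at M)"
    using has_derivative_compose[OF cu_has_derivative has_derivative_norm[OF M]]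
    by (simp add: sgn_div_norm inner_complex_def n_def divide_inverse algebra_simps)
  have qd: "((\<lambda>M. k * (Re (cu M) / cmod (cu M))) has_derivative (\<lambda>V. k * ((Re (cu V) * n -
     Re (cu M) * ((Re (cu M) * Re (cu V) + Im (cu M) * Im (cu V)) / n)) / (n * n)))) (at M)"
    using M unfolding n_def
    by (intro has_derivative_mult_right has_derivative_divide' has_derivative_Re cu_has_derivative
        nd[unfolded n_def]) auto
  have "(rounded_angle k has_derivative (\<lambda>V. k * ((Re (cu V) * n -
     Re (cu M) * ((Re (cu M) * Re (cu V) + Im (cu M) * Im (cu V)) / n)) / (n * n)) * inverse (- sqrt (1 - t\<^sup>2)))) (at M)"
    unfolding rounded_angle_def[abs_def]
  proof (rule DERIV_compose_FDERIV[where f = arccos, OF _ qd])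
    have "(arccos has_real_derivative inverse (- sqrt (1 - t\<^sup>2))) (at t)"
      by (rule DERIV_arccos) (use t in auto)
    then show "(arccos has_real_derivative inverse (- sqrt (1 - t\<^sup>2))) (at (k * (Re (cu M) / cmod (cu M))))"
      by (simp only: t_def n_def)
  qed
  also have "(\<lambda>V. k * ((Re (cu V) * n -
     Re (cu M) * ((Re (cu M) * Re (cu V) + Im (cu M) * Im (cu V)) / n)) / (n * n)) * inverse (- sqrt (1 - t\<^sup>2)))
    = (\<lambda>V. \<mu> * Im (cu V * cnj (cu M)) / (cmod (cu M))\<^sup>2)"
  proof
    fix V
    have "Re (cu V) * n - Re (cu M) * ((Re (cu M) * Re (cu V) + Im (cu M) * Im (cu V)) / n)
       = - (Im (cu M) / n) * Im (cu V * cnj (cu M))"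
    proof -
      have "Re (cu V) * n = Re (cu V) * n\<^sup>2 / n" using n(1) by (simp add: power2_eq_square)
      then show ?thesis unfolding n(2) by (simp add: algebra_simps power2_eq_square add_divide_distrib diff_divide_distrib)
    qed
    then show "k * ((Re (cu V) * n -
     Re (cu M) * ((Re (cu M) * Re (cu V) + Im (cu M) * Im (cu V)) / n)) / (n * n)) * inverse (- sqrt (1 - t\<^sup>2))
      = \<mu> * Im (cu V * cnj (cu M)) / (cmod (cu M))\<^sup>2"
      by (simp only: \<mu>_def t_def[symmetric] n_def[symmetric]) (simp add: power2_eq_square divide_inverse)
  qed
  finally show "(rounded_angle k has_derivative (\<lambda>V. \<mu> * Im (cu V * cnj (cu M)) / (cmod (cu M))\<^sup>2)) (at M)" .
  have "(k * (Im (cu M) / n))\<^sup>2 \<le> 1 - t\<^sup>2"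
  proof -
    have "(k * (Im (cu M) / n))\<^sup>2 + t\<^sup>2 = k\<^sup>2 * (((Re (cu M))\<^sup>2 + (Im (cu M))\<^sup>2) / n\<^sup>2)"
      by (simp add: t_def power_mult_distrib power_divide add_divide_distrib algebra_simps)
    also have "\<dots> = k\<^sup>2" unfolding n(2)[symmetric] using n(1) by simp
    also have "\<dots> \<le> 1" using k by (simp add: power_le_one)
    finally show ?thesis by simp
  qed
  then have "\<bar>k * (Im (cu M) / n)\<bar> \<le> sqrt (1 - t\<^sup>2)" by (intro real_le_rsqrt) (simp only: power2_abs)
  moreover have "\<mu> = k * (Im (cu M) / n) / sqrt (1 - t\<^sup>2)" by (simp add: \<mu>_def t_def n_def)
  moreover have "sqrt (1 - t\<^sup>2) > 0" using t2 by (simp only: real_sqrt_gt_0_iff)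
  ultimately show "\<bar>\<mu>\<bar> \<le> 1" by (simp only: abs_divide abs_of_pos divide_le_eq_1_pos)
qed

text \<open>The coincidence set is open and closed in T. Over an evenly covered set the two values
  lie in sheets u and v: if u = v, injectivity of p forces equality nearby, and if not, disjointness
  of the sheets excludes it nearby.\<close>

lemma covering_lift_unique:
  fixes p :: "'b::topological_space \<Rightarrow> 'c::topological_space" and g h :: "'a::topological_space \<Rightarrow> 'b"
  assumes cov: "covering_space C p S" and T: "connected T"
    and g: "continuous_on T g" "g \<in> T \<rightarrow> C" and h: "continuous_on T h" "h \<in> T \<rightarrow> C"
    and ph: "\<And>x. x \<in> T \<Longrightarrow> p (g x) = p (h x)"
    and a: "a \<in> T" "g a = h a" and x: "x \<in> T"
  shows "g x = h x"
proof (rule ccontr)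
  assume ne: "g x \<noteq> h x"
  define E where "E = {z \<in> T. g z = h z}"
  have loc: "\<exists>N. openin (top_of_set T) N \<and> z \<in> N \<and> (\<forall>y\<in>N. g y = h y \<longleftrightarrow> g z = h z)" if z: "z \<in> T" for z
  proof -
    have "g z \<in> C" "h z \<in> C" using z g h by auto
    then have "p (g z) \<in> S" using covering_space_imp_surjective[OF cov] by auto
    then obtain B \<V> where B: "p (g z) \<in> B" "\<Union>\<V> = C \<inter> p -` B" "\<forall>u\<in>\<V>. openin (top_of_set C) u"
      "pairwise disjnt \<V>" "\<forall>u\<in>\<V>. \<exists>q. homeomorphism u B p q"
      using cov unfolding covering_space_def by meson
    moreover from B have "g z \<in> \<Union>\<V>" "h z \<in> \<Union>\<V>"
      using \<open>g z \<in> C\<close> \<open>h z \<in> C\<close> ph[OF z] by auto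
    ultimately obtain u v where uv: "u \<in> \<V>" "g z \<in> u" "v \<in> \<V>" "h z \<in> v" by blast
    define N where "N = (T \<inter> g -` u) \<inter> (T \<inter> h -` v)"
    obtain q where "homeomorphism u B p q" using B(5) uv by blast
    then have inj: "inj_on p u" by (intro inj_on_inverseI[of _ q]) (simp add: homeomorphism_def)
    have "openin (top_of_set T) N" unfolding N_def
      using B(3) uv g h by (intro openin_Int continuous_openin_preimage) auto
    moreover have "z \<in> N" using z uv by (simp add: N_def)
    moreover have "\<forall>y\<in>N. g y = h y \<longleftrightarrow> g z = h z"
    proof (cases "u = v")
      case True
      then have "g y = h y" if "y \<in> N" for y using inj ph that by (auto simp: N_def inj_on_def)
      then show ?thesis using \<open>z \<in> N\<close> by blast
    next
      case False
      then have "disjnt u v" using B(4) uv by (auto simp: pairwise_def)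
      then show ?thesis using uv by (auto simp: N_def disjnt_iff)
    qed
    ultimately show ?thesis by blast
  qed
  have sub: "N \<subseteq> T" if "openin (top_of_set T) N" for N using openin_imp_subset[OF that] .
  have "openin (top_of_set T) E"
  proof (subst openin_subopen, intro ballI)
    fix z assume "z \<in> E"
    then obtain N where "openin (top_of_set T) N" "z \<in> N" "\<forall>y\<in>N. g y = h y" using loc[of z] by (auto simp: E_def)
    then show "\<exists>N. openin (top_of_set T) N \<and> z \<in> N \<and> N \<subseteq> E" using sub[of N] by (intro exI[of _ N]) (auto simp: E_def)
  qed
  moreover have "openin (top_of_set T) (T - E)"
  proof (subst openin_subopen, intro ballI)
    fix z assume "z \<in> T - E"
    then obtain N where "openin (top_of_set T) N" "z \<in> N" "\<forall>y\<in>N. g y \<noteq> h y" using loc[of z] by (auto simp: E_def)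
    then show "\<exists>N. openin (top_of_set T) N \<and> z \<in> N \<and> N \<subseteq> T - E" using sub[of N] by (intro exI[of _ N]) (auto simp: E_def)
  qed
  moreover have "T \<subseteq> E \<union> (T - E)" "E \<inter> (T - E) = {}" "E \<noteq> {}" "T - E \<noteq> {}" using a x ne by (auto simp: E_def)
  ultimately show False using T unfolding connected_openin by blast
qed

section \<open>Covering groups of SL(2,R)\<close>

lemma carrier_SL2 [simp]: "A \<in> carrier SL2 \<longleftrightarrow> det A = 1" by (simp add: SL2_def)
lemma mult_SL2 [simp]: "A \<otimes>\<^bsub>SL2\<^esub> B = A ** B" by (simp add: SL2_def)
lemma one_SL2 [simp]: "\<one>\<^bsub>SL2\<^esub> = mat 1" by (simp add: SL2_def)

text \<open>The adjugate, an inverse on SL(2,R) that is continuous on all matrices.\<close>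

definition adj_mat :: "real^2^2 \<Rightarrow> real^2^2" where
  "adj_mat A = mk_mat (cnj (cu A)) (- cv A)"

lemma adj_mat: assumes "det A = 1" shows "adj_mat A ** A = mat 1" "A ** adj_mat A = mat 1" "det (adj_mat A) = 1"
proof -
  have "cnj (cu A) * cu A - cnj (cv A) * cv A = complex_of_real (det A)"
    unfolding det_cu_cv of_real_diff complex_norm_square by (simp add: mult.commute)
  then show "adj_mat A ** A = mat 1" "A ** adj_mat A = mat 1"
    using assms by (auto intro!: mat_eqI simp: adj_mat_def cu_mult cv_mult algebra_simps)
  show "det (adj_mat A) = 1" using assms by (simp add: adj_mat_def det_cu_cv)
qed

lemma group_SL2: "group SL2"
proof (rule groupI)
  show "\<exists>y\<in>carrier SL2. y \<otimes>\<^bsub>SL2\<^esub> x = \<one>\<^bsub>SL2\<^esub>" if "x \<in> carrier SL2" for x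
    using adj_mat[of x] that by (intro bexI[of _ "adj_mat x"]) auto
qed (auto simp: det_mul matrix_mul_assoc)

lemma continuous_on_cu [continuous_intros]: "continuous_on S f \<Longrightarrow> continuous_on S (\<lambda>x. cu (f x))"
  and continuous_on_cv [continuous_intros]: "continuous_on S f \<Longrightarrow> continuous_on S (\<lambda>x. cv (f x))"
  using continuous_on_compose2[OF linear_continuous_on[OF bounded_linear_cu, of UNIV]]
    continuous_on_compose2[OF linear_continuous_on[OF bounded_linear_cv, of UNIV]] by auto

declare mk_mat_continuous [continuous_intros]

lemma mult_eq_mk_mat: "A ** B = mk_mat (cu A * cu B + cnj (cv A) * cv B) (cv A * cu B + cnj (cu A) * cv B)"
  by (rule mat_eqI) (simp_all add: cu_mult cv_mult)

lemma continuous_on_mat_mult [continuous_intros]: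
  fixes f g :: "'a::topological_space \<Rightarrow> real^2^2"
  shows "continuous_on S f \<Longrightarrow> continuous_on S g \<Longrightarrow> continuous_on S (\<lambda>x. f x ** g x)"
  unfolding mult_eq_mk_mat by (intro continuous_intros)

lemma continuous_on_adj_mat [continuous_intros]: "continuous_on S f \<Longrightarrow> continuous_on S (\<lambda>x. adj_mat (f x))"
  unfolding adj_mat_def by (intro continuous_intros)

text \<open>\<open>kap (sinh r e\<^sup>i\<^sup>\<phi>, z)\<close> is the point with cylindrical coordinates \<open>(r, \<phi>, z)\<close>; unlike these,
  it is also regular on the axis.\<close>

definition kap :: "complex \<times> real \<Rightarrow> real^2^2" where
  "kap x = mk_mat (of_real (sqrt (1 + (cmod (fst x))\<^sup>2)) * cis (snd x)) (fst x * cis (snd x))"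

lemma cu_kap: "cu (kap (w, z)) = of_real (sqrt (1 + (cmod w)\<^sup>2)) * cis z"
  and cv_kap: "cv (kap (w, z)) = w * cis z"
  by (simp_all add: kap_def)

lemma det_kap [simp]: "det (kap x) = 1"
  by (simp add: kap_def det_cu_cv norm_mult power_mult_distrib add_nonneg_nonneg)

lemma continuous_on_cis_compose [continuous_intros]:
  "continuous_on S f \<Longrightarrow> continuous_on S (\<lambda>x. cis (f x))"
  unfolding cis_conv_exp by (intro continuous_intros)

lemma continuous_on_kap: "continuous_on S f \<Longrightarrow> continuous_on S (\<lambda>x. kap (f x))"
  unfolding kap_def by (intro continuous_intros)

lemma kap_0: "kap (0, 0) = mat 1"
  by (rule mat_eqI) (simp_all add: cu_kap cv_kap)

text \<open>A common frame for the universal covering group and, with \<open>p = id\<close>, for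
  SL(2,R) itself. Simple connectivity enters later, as a hypothesis of the lemmas that construct a
  global angle.\<close>

locale covering_group =
  fixes G :: "('g::topological_space) monoid" (structure) and p :: "'g \<Rightarrow> real^2^2"
  assumes group_G: "group G"
    and continuous_mult: "continuous_on (carrier G \<times> carrier G) (\<lambda>(x, y). x \<otimes> y)"
    and hom: "p \<in> hom G SL2"
    and covering: "covering_space (carrier G) p (carrier SL2)"
begin

lemma one_closed [simp]: "\<one> \<in> carrier G"
  and mult_closed [simp]: "x \<in> carrier G \<Longrightarrow> y \<in> carrier G \<Longrightarrow> x \<otimes> y \<in> carrier G"
  and l_one [simp]: "x \<in> carrier G \<Longrightarrow> \<one> \<otimes> x = x"
  and r_one [simp]: "x \<in> carrier G \<Longrightarrow> x \<otimes> \<one> = x"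
  using group_G group.is_monoid monoid.one_closed monoid.m_closed monoid.l_one monoid.r_one by metis+

lemma p_mult: "x \<in> carrier G \<Longrightarrow> y \<in> carrier G \<Longrightarrow> p (x \<otimes> y) = p x ** p y"
  using hom by (simp add: hom_def)

lemma det_p: "x \<in> carrier G \<Longrightarrow> det (p x) = 1"
  using hom by (auto simp: hom_def)

lemma p_one: "p \<one> = mat 1"
  using hom_one[OF hom group_G group_SL2] by simp

lemma continuous_p: "continuous_on (carrier G) p"
  using covering by (rule covering_space_imp_continuous)

lemma continuous_on_p:
  "continuous_on S f \<Longrightarrow> f \<in> S \<rightarrow> carrier G \<Longrightarrow> continuous_on S (\<lambda>x. p (f x))"
  by (rule continuous_on_compose2[OF continuous_p]) auto

lemma continuous_on_mult:
  "continuous_on S f \<Longrightarrow> continuous_on S g \<Longrightarrow> f \<in> S \<rightarrow> carrier G \<Longrightarrow> g \<in> S \<rightarrow> carrier G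
    \<Longrightarrow> continuous_on S (\<lambda>x. f x \<otimes> g x)"
  using continuous_on_compose2[OF continuous_mult, of S "\<lambda>x. (f x, g x)"]
  by (auto intro!: continuous_on_Pair)

lemma lift_unique:
  fixes f h :: "'a::topological_space \<Rightarrow> 'g"
  assumes "connected S" "continuous_on S f" "f \<in> S \<rightarrow> carrier G" "continuous_on S h" "h \<in> S \<rightarrow> carrier G"
    "\<And>x. x \<in> S \<Longrightarrow> p (f x) = p (h x)" "a \<in> S" "f a = h a" "x \<in> S"
  shows "f x = h x"
  by (rule covering_lift_unique[OF covering assms])

lemma local_section:
  obtains B u \<sigma> where "openin (top_of_set (carrier SL2)) B" "mat 1 \<in> B"
    "openin (top_of_set (carrier G)) u" "\<one> \<in> u" "homeomorphism u B p \<sigma>"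
proof -
  have "mat 1 \<in> carrier SL2" by simp
  then obtain B \<V> where B: "mat 1 \<in> B" "openin (top_of_set (carrier SL2)) B" "\<Union>\<V> = carrier G \<inter> p -` B"
      "\<forall>u\<in>\<V>. openin (top_of_set (carrier G)) u" "\<forall>u\<in>\<V>. \<exists>q. homeomorphism u B p q"
    using covering unfolding covering_space_def by meson
  have "\<one> \<in> \<Union>\<V>" using B p_one by simp
  then obtain u where u: "u \<in> \<V>" "\<one> \<in> u" by blast
  then obtain q where "homeomorphism u B p q" using B(5) by blast
  with u B(1,2,4) show ?thesis by (intro that[of B u q]) auto
qed

text \<open>The total space carries no metric, so the lifting theorems of the library do not apply. Instead,
  the lift is a finite product of values of a section near the identity, taken along a
  subdivision of the segment from \<open>0\<close> to \<open>x\<close>.\<close>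

lemma lift_on_cball:
  fixes f :: "'a::euclidean_space \<Rightarrow> real^2^2"
  assumes f: "continuous_on UNIV f" "\<And>x. det (f x) = 1" "f 0 = mat 1"
  shows "\<exists>K. continuous_on (cball 0 R) K \<and> K \<in> cball 0 R \<rightarrow> carrier G \<and> (\<forall>x\<in>cball 0 R. p (K x) = f x) \<and> K 0 = \<one>"
proof -
  obtain B u \<sigma> where B: "openin (top_of_set (carrier SL2)) B" "mat 1 \<in> B"
    "openin (top_of_set (carrier G)) u" "\<one> \<in> u" "homeomorphism u B p \<sigma>" by (rule local_section)
  have \<sigma>: "continuous_on B \<sigma>" "\<sigma> \<in> B \<rightarrow> carrier G" "\<And>x. x \<in> B \<Longrightarrow> p (\<sigma> x) = x" "\<sigma> (mat 1) = \<one>"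
    using B(4,5) openin_imp_subset[OF B(3)] p_one unfolding homeomorphism_def by force+
  obtain Q where Q: "open Q" "B = carrier SL2 \<inter> Q" using B(1) by (auto simp: openin_open)
  then obtain e where e: "e > 0" "ball (mat 1) e \<subseteq> Q" using B(2) open_contains_ball by blast
  \<comment> \<open>The increment of f along the ray through x between the parameters s and t. It is
    the identity for s = t, so by uniform continuity all increments over steps of length 1 / n lie
    in B.\<close>
  define \<Psi> where "\<Psi> = (\<lambda>(x, s, t). adj_mat (f (s *\<^sub>R x)) ** f (t *\<^sub>R x))"
  have c\<Psi>: "continuous_on S \<Psi>" for S
  proof -
    have cf: "continuous_on S (\<lambda>x. f (h x))" if "continuous_on S h" for h :: "'a \<times> real \<times> real \<Rightarrow> 'a"
      using that by (rule continuous_on_compose2[OF f(1)]) simp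
    show ?thesis unfolding \<Psi>_def case_prod_unfold
      by (intro continuous_on_mat_mult continuous_on_adj_mat cf continuous_intros)
  qed
  have "compact (cball (0::'a) R \<times> {0..1::real} \<times> {0..1::real})" by (intro compact_Times compact_cball compact_Icc)
  from uniformly_continuous_onE[OF compact_uniformly_continuous[OF c\<Psi> this] e(1)]
  obtain d where d: "d > 0" "\<And>a b. a \<in> cball 0 R \<times> {0..1} \<times> {0..1} \<Longrightarrow> b \<in> cball 0 R \<times> {0..1} \<times> {0..1} \<Longrightarrow>
      dist b a < d \<Longrightarrow> dist (\<Psi> b) (\<Psi> a) < e" by blast
  obtain m where "inverse (real (Suc m)) < d" using reals_Archimedean[OF d(1)] by blast
  then obtain n :: nat where n: "n > 0" "1 / n < d"
    by (intro that[of "Suc m"]) (simp_all add: divide_inverse)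
  have mem: "\<Psi> (x, i / n, Suc i / n) \<in> B" if "x \<in> cball 0 R" "i < n" for x i
  proof -
    have "dist (\<Psi> (x, i / n, Suc i / n)) (\<Psi> (x, i / n, i / n)) < e"
    proof (rule d(2))
      have "real (Suc i) / n - i / n = 1 / n" by (simp flip: diff_divide_distrib)
      then show "dist (x, i / n, Suc i / n) (x, i / n, i / n) < d"
        using n by (simp only: dist_Pair_Pair dist_self dist_real_def) simp
    qed (use that n in auto)
    moreover have "\<Psi> (x, i / n, i / n) = mat 1" using f adj_mat by (simp add: \<Psi>_def)
    moreover have "det (\<Psi> (x, i / n, Suc i / n)) = 1" using f adj_mat by (simp add: \<Psi>_def det_mul)
    ultimately show ?thesis using e Q by (auto simp: dist_commute)
  qed
  have "\<exists>K. continuous_on (cball 0 R) K \<and> K \<in> cball 0 R \<rightarrow> carrier G \<and>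
      (\<forall>x\<in>cball 0 R. p (K x) = f ((i / n) *\<^sub>R x)) \<and> K 0 = \<one>" if "i \<le> n" for i
    using that
  proof (induction i)
    case 0
    show ?case by (rule exI[of _ "\<lambda>_. \<one>"]) (auto simp: p_one f)
  next
    case (Suc i)
    then obtain K where K: "continuous_on (cball 0 R) K" "K \<in> cball 0 R \<rightarrow> carrier G"
      "\<forall>x\<in>cball 0 R. p (K x) = f ((i / n) *\<^sub>R x)" "K 0 = \<one>" by auto
    \<comment> \<open>By homogeneity the one section at the identity serves every piece: the lift so
      far is multiplied by the lift of the next increment.\<close>
    let ?s = "\<lambda>x. \<sigma> (\<Psi> (x, i / n, Suc i / n))"
    have mem': "\<Psi> (x, i / n, Suc i / n) \<in> B" if "x \<in> cball 0 R" for x using mem that Suc.prems by simp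
    have s: "continuous_on (cball 0 R) ?s" "?s \<in> cball 0 R \<rightarrow> carrier G"
      using mem' \<sigma>(2) by (auto intro!: continuous_on_compose2[OF \<sigma>(1)] continuous_on_compose2[OF c\<Psi>[of UNIV]] continuous_intros)
    have "p (K x \<otimes> ?s x) = f ((Suc i / n) *\<^sub>R x)" if "x \<in> cball 0 R" for x
    proof -
      have "p (K x \<otimes> ?s x) = f ((i / n) *\<^sub>R x) ** (adj_mat (f ((i / n) *\<^sub>R x)) ** f ((Suc i / n) *\<^sub>R x))"
        using K s that \<sigma>(3)[OF mem'[OF that]] by (subst p_mult) (auto simp: \<Psi>_def)
      also have "\<dots> = f ((Suc i / n) *\<^sub>R x)"
        using f adj_mat by (simp add: matrix_mul_assoc)
      finally show ?thesis .
    qed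
    moreover have "\<Psi> (0, i / n, Suc i / n) = mat 1" using f adj_mat[of "mat 1"] by (simp add: \<Psi>_def)
    moreover have "(\<lambda>x. K x \<otimes> ?s x) \<in> cball 0 R \<rightarrow> carrier G" using K(2) s(2) by (intro Pi_I mult_closed) blast+
    ultimately show ?case using K s
      by (intro exI[of _ "\<lambda>x. K x \<otimes> ?s x"] conjI ballI continuous_on_mult) (simp_all add: \<sigma>(4))
  qed
  from this[of n] show ?thesis using n by simp
qed

text \<open>Lifts on the balls of integer radius agree where they overlap, by uniqueness of lifts
  fixed at 0, and are glued.\<close>

lemma lift_exists:
  fixes f :: "'a::euclidean_space \<Rightarrow> real^2^2"
  assumes f: "continuous_on UNIV f" "\<And>x. det (f x) = 1" "f 0 = mat 1"
  shows "\<exists>K. continuous_on UNIV K \<and> (\<forall>x. K x \<in> carrier G) \<and> (\<forall>x. p (K x) = f x) \<and> K 0 = \<one>"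
proof -
  have "\<forall>n::nat. \<exists>K. continuous_on (cball 0 n) K \<and> K \<in> cball 0 n \<rightarrow> carrier G \<and> (\<forall>x\<in>cball 0 n. p (K x) = f x) \<and> K 0 = \<one>"
    using lift_on_cball[OF f] by blast
  from choice[OF this] obtain K :: "nat \<Rightarrow> 'a \<Rightarrow> 'g" where
    "\<forall>n. continuous_on (cball 0 (real n)) (K n) \<and> K n \<in> cball 0 n \<rightarrow> carrier G \<and> (\<forall>x\<in>cball 0 n. p (K n x) = f x) \<and> K n 0 = \<one>" ..
  then have K: "\<And>n. continuous_on (cball 0 (real n)) (K n)" "\<And>n. K n \<in> cball 0 n \<rightarrow> carrier G"
    "\<And>n x. x \<in> cball 0 n \<Longrightarrow> p (K n x) = f x" "\<And>n. K n 0 = \<one>" by blast+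
  have agree: "K m x = K n x" if "m \<le> n" "x \<in> cball 0 m" for m n :: nat and x
  proof (rule lift_unique[where S = "cball 0 (real m)" and a = 0])
    have sub: "cball (0::'a) m \<subseteq> cball 0 n" using that by auto
    show "continuous_on (cball 0 m) (K n)" using K(1) sub continuous_on_subset by blast
    show "K n \<in> cball 0 m \<rightarrow> carrier G" using K(2)[of n] sub by blast
    show "p (K m y) = p (K n y)" if "y \<in> cball 0 m" for y using K(3)[of y] sub that by auto
  qed (use K that in auto)
  define L where "L x = K (nat \<lceil>norm x\<rceil>) x" for x
  have L: "L x = K n x" if "norm x \<le> n" for x and n :: nat
    unfolding L_def using that by (intro agree) (auto simp: nat_le_iff ceiling_le_iff real_nat_ceiling_ge)
  have "continuous_on (\<Union>n. ball 0 (real n)) L"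
  proof (rule continuous_on_open_UN)
    show "continuous_on (ball 0 (real n)) L" for n
      using continuous_on_subset[OF K(1)[of n] ball_subset_cball] L[of _ n]
      by (subst continuous_on_cong[OF refl, of _ _ "K n"]) (auto simp: less_imp_le)
  qed auto
  moreover have "(\<Union>n. ball (0::'a) (real n)) = UNIV"
    using reals_Archimedean2 by (auto simp: set_eq_iff)
  moreover have "L x \<in> carrier G" "p (L x) = f x" for x
  proof -
    have "x \<in> cball 0 (real (nat \<lceil>norm x\<rceil>))" by (simp add: real_nat_ceiling_ge)
    then show "L x \<in> carrier G" "p (L x) = f x" using K(2,3) unfolding L_def by blast+
  qed
  moreover have "L 0 = \<one>" by (simp add: L_def K)
  ultimately show ?thesis by auto
qed

section \<open>Cylindrical coordinates and one-parameter subgroups of the covering group\<close>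

definition K :: "complex \<times> real \<Rightarrow> 'g" where
  "K = (SOME K. continuous_on UNIV K \<and> (\<forall>x. K x \<in> carrier G) \<and> (\<forall>x. p (K x) = kap x) \<and> K (0, 0) = \<one>)"

lemma K: "continuous_on UNIV K" "K x \<in> carrier G" "p (K x) = kap x" "K (0, 0) = \<one>"
proof -
  have "\<exists>K. continuous_on UNIV K \<and> (\<forall>x. K x \<in> carrier G) \<and> (\<forall>x. p (K x) = kap x) \<and> K (0, 0) = \<one>"
    using lift_exists[of kap] continuous_on_kap[OF continuous_on_id] kap_0 by (simp add: zero_prod_def)
  from someI_ex[OF this, folded K_def]
  show "continuous_on UNIV K" "K x \<in> carrier G" "p (K x) = kap x" "K (0, 0) = \<one>" by blast+
qed

lemma continuous_on_K: "continuous_on S f \<Longrightarrow> continuous_on S (\<lambda>x. K (f x))"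
  by (rule continuous_on_compose2[OF K(1)]) auto

text \<open>Uniqueness of lifts is used twice: it makes any continuous lift through the identity a
  homomorphism, and it makes the point described by \<open>lie_exp\<close> unique.\<close>

lemma lie_exp_eq:
  fixes \<gamma> :: "real \<Rightarrow> 'g"
  assumes \<gamma>: "continuous_on UNIV \<gamma>" "\<And>t. \<gamma> t \<in> carrier G" "\<gamma> 0 = \<one>" "\<And>t. p (\<gamma> t) = mat_exp (t *\<^sub>R A)"
    and add: "\<And>s t. mat_exp ((s + t) *\<^sub>R A) = mat_exp (s *\<^sub>R A) ** mat_exp (t *\<^sub>R A)"
  shows "lie_exp G p A = \<gamma> 1"
  unfolding lie_exp_def
proof (rule the_equality)
  have \<gamma>_add: "\<gamma> (s + t) = \<gamma> s \<otimes> \<gamma> t" for s t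
  proof (rule lift_unique[where S = UNIV and a = 0 and f = "\<lambda>t. \<gamma> (s + t)" and h = "\<lambda>t. \<gamma> s \<otimes> \<gamma> t"])
    show "continuous_on UNIV (\<lambda>t. \<gamma> (s + t))"
    proof (rule continuous_on_compose2[OF \<gamma>(1)])
      show "continuous_on UNIV (\<lambda>t. s + t)" by (intro continuous_on_add continuous_on_const continuous_on_id)
    qed simp
    show "continuous_on UNIV (\<lambda>t. \<gamma> s \<otimes> \<gamma> t)"
      by (intro continuous_on_mult continuous_on_const \<gamma>(1)) (auto simp: \<gamma>(2))
    show "p (\<gamma> (s + t)) = p (\<gamma> s \<otimes> \<gamma> t)" for t
      unfolding p_mult[OF \<gamma>(2) \<gamma>(2)] \<gamma>(4) add ..
  qed (use \<gamma>(2,3) in auto)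
  show "\<exists>\<gamma>'. continuous_on UNIV \<gamma>' \<and> (\<forall>t. \<gamma>' t \<in> carrier G) \<and> (\<forall>s t. \<gamma>' (s + t) = \<gamma>' s \<otimes> \<gamma>' t) \<and>
     (\<forall>t. p (\<gamma>' t) = mat_exp (t *\<^sub>R A)) \<and> \<gamma> 1 = \<gamma>' 1"
    by (intro exI[of _ \<gamma>] conjI allI) (rule \<gamma> \<gamma>_add refl)+
next
  fix g assume "\<exists>\<gamma>'. continuous_on UNIV \<gamma>' \<and> (\<forall>t. \<gamma>' t \<in> carrier G) \<and> (\<forall>s t. \<gamma>' (s + t) = \<gamma>' s \<otimes> \<gamma>' t) \<and>
     (\<forall>t. p (\<gamma>' t) = mat_exp (t *\<^sub>R A)) \<and> g = \<gamma>' 1"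
  then obtain \<gamma>' where \<gamma>': "continuous_on UNIV \<gamma>'" "\<forall>t. \<gamma>' t \<in> carrier G" "\<forall>s t. \<gamma>' (s + t) = \<gamma>' s \<otimes> \<gamma>' t"
     "\<forall>t. p (\<gamma>' t) = mat_exp (t *\<^sub>R A)" "g = \<gamma>' 1" by blast
  have "\<gamma>' 0 \<otimes> \<gamma>' 0 = \<gamma>' 0" using \<gamma>'(3)[rule_format, of 0 0, symmetric] by simp
  then have \<gamma>'0: "\<gamma>' 0 = \<one>" using group.r_cancel_one[OF group_G] \<gamma>'(2) by simp
  have "\<gamma>' 1 = \<gamma> 1"
    by (rule lift_unique[where S = UNIV and a = 0 and f = \<gamma>' and h = \<gamma>]) (simp_all add: \<gamma> \<gamma>'(1,2,4) \<gamma>'0)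
  then show "g = \<gamma> 1" unfolding \<gamma>'(5) .
qed

lemma lie_exp_Z: "lie_exp G p (z *\<^sub>R Z_mat) = K (0, z)"
proof -
  have *: "mat_exp (t *\<^sub>R z *\<^sub>R Z_mat) = kap (0, t * z)" for t
    unfolding scaleR_scaleR mat_exp_Z by (rule mat_eqI) (simp_all add: cu_kap cv_kap)
  have "lie_exp G p (z *\<^sub>R Z_mat) = K (0, 1 * z)"
  proof (rule lie_exp_eq[of "\<lambda>t. K (0, t * z)"])
    show "continuous_on UNIV (\<lambda>t. K (0, t * z))" by (intro continuous_on_K continuous_intros)
    show "mat_exp ((s + t) *\<^sub>R z *\<^sub>R Z_mat) = mat_exp (s *\<^sub>R z *\<^sub>R Z_mat) ** mat_exp (t *\<^sub>R z *\<^sub>R Z_mat)" for s t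
      unfolding * by (intro mat_eqI) (simp_all add: cu_mult cv_mult cu_kap cv_kap cis_mult distrib_right)
  qed (simp_all only: K * mult_zero_left)
  then show ?thesis by simp
qed

lemma kap_sinh: "kap (of_real (sinh r) * cis \<phi>, 0) = mk_mat (of_real (cosh r)) (of_real (sinh r) * cis \<phi>)"
  by (rule mat_eqI) (simp_all add: cu_kap cv_kap norm_mult cosh_square_eq[symmetric] add.commute[of 1])

lemma lie_exp_XY: "lie_exp G p ((r * cos \<phi>) *\<^sub>R X_mat + (r * sin \<phi>) *\<^sub>R Y_mat) = K (of_real (sinh r) * cis \<phi>, 0)"
proof -
  let ?A = "(r * cos \<phi>) *\<^sub>R X_mat + (r * sin \<phi>) *\<^sub>R Y_mat"
  have *: "mat_exp (t *\<^sub>R ?A) = kap (of_real (sinh (t * r)) * cis \<phi>, 0)" for t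
  proof -
    have "t *\<^sub>R ?A = ((t * r) * cos \<phi>) *\<^sub>R X_mat + ((t * r) * sin \<phi>) *\<^sub>R Y_mat"
      by (simp add: scaleR_add_right mult.assoc)
    then show ?thesis by (simp only: mat_exp_XY kap_sinh)
  qed
  have cc: "cis (- \<phi>) * cis \<phi> = 1" by (simp add: cis_mult)
  have "lie_exp G p ?A = K (of_real (sinh (1 * r)) * cis \<phi>, 0)"
  proof (rule lie_exp_eq[of "\<lambda>t. K (of_real (sinh (t * r)) * cis \<phi>, 0)"])
    show "continuous_on UNIV (\<lambda>t. K (of_real (sinh (t * r)) * cis \<phi>, 0))"
      by (intro continuous_on_K continuous_intros)
    show "mat_exp ((s + t) *\<^sub>R ?A) = mat_exp (s *\<^sub>R ?A) ** mat_exp (t *\<^sub>R ?A)" for s t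
      unfolding * kap_sinh using cc
      by (intro mat_eqI) (simp_all add: cu_mult cv_mult cis_cnj distrib_right sinh_add cosh_add algebra_simps)
    show "p (K (of_real (sinh (t * r)) * cis \<phi>, 0)) = mat_exp (t *\<^sub>R ?A)" for t by (simp only: K *)
  qed (simp_all add: K)
  then show ?thesis by simp
qed

text \<open>Both sides, as functions of z, lift the same curve of matrices and agree at z =
  0.\<close>

lemma cyl_point_eq: "cyl_point G p r \<phi> z = K (of_real (sinh r) * cis \<phi>, z)"
proof -
  let ?w = "of_real (sinh r) * cis \<phi>"
  have "K (?w, 0) \<otimes> K (0, z) = K (?w, z)"
  proof (rule lift_unique[where S = UNIV and a = 0 and f = "\<lambda>t. K (?w, 0) \<otimes> K (0, t)" and h = "\<lambda>t. K (?w, t)"])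
    show "continuous_on UNIV (\<lambda>t. K (?w, 0) \<otimes> K (0, t))"
      by (intro continuous_on_mult continuous_on_K continuous_intros) (auto simp: K)
    show "continuous_on UNIV (\<lambda>t. K (?w, t))" by (intro continuous_on_K continuous_intros)
    show "p (K (?w, 0) \<otimes> K (0, t)) = p (K (?w, t))" for t
      by (rule mat_eqI) (simp_all add: p_mult K cu_mult cv_mult cu_kap cv_kap)
  qed (auto simp: K)
  then show ?thesis by (simp add: cyl_point_def lie_exp_Z lie_exp_XY)
qed

end

section \<open>Geodesics and the upper bound\<close>

lemma has_real_derivative_along_curve:
  fixes m :: "real \<Rightarrow> 'a::real_normed_vector" and F :: "'a \<Rightarrow> real"
  assumes "F differentiable at (m t)" "(m has_vector_derivative v) (at t)"
  shows "((\<lambda>t. F (m t)) has_real_derivative frechet_derivative F (at (m t)) v) (at t)"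
proof -
  have F: "(F has_derivative frechet_derivative F (at (m t))) (at (m t))"
    using assms(1) frechet_derivative_works by blast
  have "((\<lambda>t. F (m t)) has_derivative (\<lambda>h. frechet_derivative F (at (m t)) (h *\<^sub>R v))) (at t)"
    using has_derivative_compose[OF assms(2)[unfolded has_vector_derivative_def] F] .
  also have "(\<lambda>h. frechet_derivative F (at (m t)) (h *\<^sub>R v)) = (*) (frechet_derivative F (at (m t)) v)"
    using linear_scale[OF has_derivative_linear[OF F]] by (simp add: fun_eq_iff)
  finally show ?thesis by (simp add: has_field_derivative_def)
qed

text \<open>All unit vectors of span (X, Y) in one family, so that X and Y are handled together as
  the angles 0 and pi / 2.\<close>

definition horizontal :: "real \<Rightarrow> real^2^2" where
  "horizontal \<phi> = cos \<phi> *\<^sub>R X_mat + sin \<phi> *\<^sub>R Y_mat"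

lemma cu_horizontal [simp]: "cu (horizontal \<phi>) = 0" and cv_horizontal [simp]: "cv (horizontal \<phi>) = cis \<phi>"
  by (simp_all add: horizontal_def cu_add cv_add cu_scaleR cv_scaleR complex_eq_iff)

lemma horizontal_0: "horizontal 0 = X_mat" and horizontal_pi_half: "horizontal (pi / 2) = Y_mat"
  by (simp_all add: horizontal_def)

lemma mult_horizontal:
  fixes M :: "real^2^2"
  shows "M ** horizontal \<phi> = cos \<phi> *\<^sub>R (M ** X_mat) + sin \<phi> *\<^sub>R (M ** Y_mat)"
  by (rule mat_eqI)
     (simp_all add: cu_mult cv_mult cu_add cv_add cu_scaleR cv_scaleR complex_eq_iff)

context covering_group
begin

lemma smooth_function_local:
  assumes "smooth_function G p f" "g \<in> carrier G"
  obtains U F where "openin (top_of_set (carrier G)) U" "g \<in> U" "\<forall>x\<in>U. f x = F (p x)"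
    "\<forall>x\<in>U. F differentiable at (p x)"
proof -
  obtain U W F where *: "openin (top_of_set (carrier G)) U" "g \<in> U" "p ` U \<subseteq> W" "\<forall>k. Ck_on k W F" "\<forall>x\<in>U. f x = F (p x)"
    using bspec[OF assms(1)[unfolded smooth_function_def] assms(2)] by (elim exE conjE) (rule that)
  have "smooth_on W F" unfolding smooth_on_def by (rule *(4))
  have "F differentiable at (p x)" if "x \<in> U" for x
    by (rule smooth_on_differentiable[OF \<open>smooth_on W F\<close>]) (use *(3) that in blast)
  then show ?thesis by (intro that[OF *(1,2,5)] ballI)
qed

lemma continuous_on_smooth_function:
  fixes \<gamma> :: "real \<Rightarrow> 'g"
  assumes f: "smooth_function G p f" and \<gamma>: "continuous_on S \<gamma>" "\<gamma> \<in> S \<rightarrow> carrier G"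
  shows "continuous_on S (\<lambda>t. f (\<gamma> t))"
  unfolding continuous_on_eq_continuous_within
proof
  fix t assume t: "t \<in> S"
  then have "\<gamma> t \<in> carrier G" using \<gamma> by blast
  then obtain U F where U: "openin (top_of_set (carrier G)) U" "\<gamma> t \<in> U" "\<forall>x\<in>U. f x = F (p x)"
    "\<forall>x\<in>U. F differentiable at (p x)" by (rule smooth_function_local[OF f])
  note U = U(1,2) U(3)[rule_format] U(4)[rule_format]
  have "continuous (at t within S) (\<lambda>t. p (\<gamma> t))"
    using continuous_on_p[OF \<gamma>] t by (simp add: continuous_on_eq_continuous_within)
  moreover have "isCont F (p (\<gamma> t))" using U(2,4) differentiable_imp_continuous_within by blast
  ultimately have "continuous (at t within S) (\<lambda>t. F (p (\<gamma> t)))"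
    by (rule continuous_within_compose3[rotated])
  then show "continuous (at t within S) (\<lambda>t. f (\<gamma> t))"
  proof (rule continuous_transform_within_openin)
    show "openin (top_of_set S) (S \<inter> \<gamma> -` U)" using \<gamma> U(1) by (rule continuous_openin_preimage)
  qed (use t U in auto)
qed

text \<open>The curve defining the field lies over \<open>cosh t *\<^sub>R p g + sinh t *\<^sub>R (p
  g ** horizontal \<phi>)\<close>, whose velocity at t = 0 is the vector on the right.\<close>

lemma left_invariant_field_eq:
  assumes U: "openin (top_of_set (carrier G)) U" "g \<in> U" "\<And>x. x \<in> U \<Longrightarrow> f x = F (p x)"
    and F: "F differentiable at (p g)"
  shows "left_invariant_field G p (horizontal \<phi>) f g = frechet_derivative F (at (p g)) (p g ** horizontal \<phi>)"
proof -
  have g: "g \<in> carrier G" using U openin_imp_subset by blast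
  define E where "E t = K (of_real (sinh t) * cis \<phi>, 0)" for t
  define m where "m t = cosh t *\<^sub>R p g + sinh t *\<^sub>R (p g ** horizontal \<phi>)" for t
  have lie: "lie_exp G p (t *\<^sub>R horizontal \<phi>) = E t" for t
    using lie_exp_XY[of t \<phi>] by (simp add: E_def horizontal_def scaleR_add_right)
  have pE: "p (g \<otimes> E t) = m t" for t
    unfolding E_def p_mult[OF g K(2)] K(3) kap_sinh
    by (rule mat_eqI) (simp_all add: m_def cu_mult cv_mult cu_add cv_add cu_scaleR cv_scaleR complex_eq_iff algebra_simps)
  have c: "continuous_on UNIV (\<lambda>t. g \<otimes> E t)" "(\<lambda>t. g \<otimes> E t) \<in> UNIV \<rightarrow> carrier G"
    unfolding E_def using g by (auto intro!: continuous_on_mult continuous_on_K continuous_intros simp: K)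
  have "openin (top_of_set UNIV) (UNIV \<inter> (\<lambda>t. g \<otimes> E t) -` U)"
    by (rule continuous_openin_preimage[OF c U(1)])
  then have op: "open ((\<lambda>t. g \<otimes> E t) -` U)" by simp
  have E0: "E 0 = \<one>" by (simp add: E_def K)
  have "(m has_vector_derivative p g ** horizontal \<phi>) (at 0)"
    unfolding m_def[abs_def] by (auto intro!: derivative_eq_intros)
  moreover have m0: "m 0 = p g" by (simp add: m_def)
  ultimately have "((\<lambda>t. F (m t)) has_real_derivative frechet_derivative F (at (p g)) (p g ** horizontal \<phi>)) (at 0)"
    using has_real_derivative_along_curve[of F m 0] F by simp
  then have "((\<lambda>t. f (g \<otimes> E t)) has_real_derivative frechet_derivative F (at (p g)) (p g ** horizontal \<phi>)) (at 0)"
  proof (rule has_field_derivative_transform_within_open[OF _ op])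
    show "0 \<in> (\<lambda>t. g \<otimes> E t) -` U" using U(2) g by (simp add: E0)
    show "F (m t) = f (g \<otimes> E t)" if "t \<in> (\<lambda>t. g \<otimes> E t) -` U" for t using U(3) that pE by simp
  qed
  then show ?thesis unfolding left_invariant_field_def lie by (rule DERIV_imp_deriv)
qed

lemmas left_invariant_field_X = left_invariant_field_eq[where \<phi> = 0, unfolded horizontal_0]
lemmas left_invariant_field_Y = left_invariant_field_eq[where \<phi> = "pi / 2", unfolded horizontal_pi_half]

definition admissible :: "('g \<Rightarrow> real) \<Rightarrow> bool" where
  "admissible f \<longleftrightarrow> smooth_function G p f \<and>
     (\<forall>g\<in>carrier G. (left_invariant_field G p X_mat f g)\<^sup>2 + (left_invariant_field G p Y_mat f g)\<^sup>2 \<le> 1)"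

text \<open>Mean value theorem along a horizontal curve of unit speed. Only its matrix projection M
  is differentiated; \<gamma> itself is merely a continuous lift.\<close>

lemma horizontal_curve_bound:
  fixes \<gamma> :: "real \<Rightarrow> 'g"
  assumes f: "admissible f" and T: "T > 0"
    and \<gamma>: "continuous_on {0..T} \<gamma>" "\<gamma> \<in> {0..T} \<rightarrow> carrier G" "\<And>t. t \<in> {0..T} \<Longrightarrow> p (\<gamma> t) = M t"
    and M: "\<And>t. t \<in> {0<..<T} \<Longrightarrow> (M has_vector_derivative M t ** horizontal (\<psi> t)) (at t)"
  shows "\<bar>f (\<gamma> T) - f (\<gamma> 0)\<bar> \<le> T"
proof -
  have sm: "smooth_function G p f" using f by (simp add: admissible_def)
  have der: "\<exists>d. ((\<lambda>t. f (\<gamma> t)) has_real_derivative d) (at t) \<and> \<bar>d\<bar> \<le> 1" if t: "t \<in> {0<..<T}" for t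
  proof -
    have g: "\<gamma> t \<in> carrier G" using \<gamma>(2) t by auto
    then obtain U F where U: "openin (top_of_set (carrier G)) U" "\<gamma> t \<in> U" "\<forall>x\<in>U. f x = F (p x)"
      "\<forall>x\<in>U. F differentiable at (p x)" by (rule smooth_function_local[OF sm])
    note U = U(1,2) U(3)[rule_format] U(4)[rule_format]
    define D where "D = frechet_derivative F (at (M t))"
    have pM: "p (\<gamma> t) = M t" using \<gamma>(3) t by auto
    have F: "F differentiable at (M t)" using U(4)[OF U(2)] pM by simp
    have "linear D" unfolding D_def using F frechet_derivative_works has_derivative_linear by blast
    define a where "a = D (M t ** X_mat)"
    define b where "b = D (M t ** Y_mat)"
    have "(left_invariant_field G p X_mat f (\<gamma> t))\<^sup>2 + (left_invariant_field G p Y_mat f (\<gamma> t))\<^sup>2 \<le> 1"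
      using f g unfolding admissible_def by blast
    then have ab: "a\<^sup>2 + b\<^sup>2 \<le> 1"
      using left_invariant_field_X[of U _ f F, OF U(1-3)] left_invariant_field_Y[of U _ f F, OF U(1-3)] F
      by (simp add: a_def b_def D_def pM)
    have "((\<lambda>t. F (M t)) has_real_derivative D (M t ** horizontal (\<psi> t))) (at t)"
      unfolding D_def by (rule has_real_derivative_along_curve[OF F M[OF t]])
    moreover have "D (M t ** horizontal (\<psi> t)) = cos (\<psi> t) * a + sin (\<psi> t) * b"
      by (simp add: mult_horizontal linear_add[OF \<open>linear D\<close>] linear_scale[OF \<open>linear D\<close>] a_def b_def)
    ultimately have d: "((\<lambda>t. F (M t)) has_real_derivative cos (\<psi> t) * a + sin (\<psi> t) * b) (at t)" by simp
    have \<gamma>': "continuous_on {0<..<T} \<gamma>" "\<gamma> \<in> {0<..<T} \<rightarrow> carrier G"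
      by (rule continuous_on_subset[OF \<gamma>(1)], force) (use \<gamma>(2) in auto)
    have "openin (top_of_set {0<..<T}) ({0<..<T} \<inter> \<gamma> -` U)" by (rule continuous_openin_preimage[OF \<gamma>' U(1)])
    then have op: "open ({0<..<T} \<inter> \<gamma> -` U)" using openin_open_trans open_greaterThanLessThan by blast
    have "((\<lambda>t. f (\<gamma> t)) has_real_derivative cos (\<psi> t) * a + sin (\<psi> t) * b) (at t)"
      by (rule has_field_derivative_transform_within_open[OF d op]) (use t U \<gamma>(3) in auto)
    moreover have "(cos (\<psi> t) * a + sin (\<psi> t) * b)\<^sup>2 \<le> 1\<^sup>2"
    proof -
      \<comment> \<open>Lagrange's identity, giving Cauchy-Schwarz for the unit vector (cos \<psi>,
        sin \<psi>) and (a, b).\<close>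
      have "(cos (\<psi> t) * a + sin (\<psi> t) * b)\<^sup>2 + (cos (\<psi> t) * b - sin (\<psi> t) * a)\<^sup>2 = a\<^sup>2 + b\<^sup>2"
        using sin_cos_squared_add[of "\<psi> t"] by algebra
      then show ?thesis using ab zero_le_power2[of "cos (\<psi> t) * b - sin (\<psi> t) * a"] unfolding one_power2 by linarith
    qed
    then have "\<bar>cos (\<psi> t) * a + sin (\<psi> t) * b\<bar> \<le> 1" unfolding one_power2 by (rule abs_le_square_iff[of _ 1, THEN iffD2, unfolded abs_one one_power2])
    ultimately show ?thesis by blast
  qed
  have "(\<lambda>t. f (\<gamma> t)) differentiable at x" if "0 < x" "x < T" for x
    using der[of x] that real_differentiable_def by auto
  from MVT[OF T continuous_on_smooth_function[OF sm \<gamma>(1,2)] this]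
  obtain l z where z: "0 < z" "z < T" "((\<lambda>t. f (\<gamma> t)) has_real_derivative l) (at z)" "f (\<gamma> T) - f (\<gamma> 0) = (T - 0) * l"
    by blast
  obtain d where "((\<lambda>t. f (\<gamma> t)) has_real_derivative d) (at z)" "\<bar>d\<bar> \<le> 1" using der[of z] z by auto
  with z(3) have "\<bar>l\<bar> \<le> 1" using DERIV_unique by blast
  then show ?thesis using T z(4) by (simp add: abs_mult mult_left_le)
qed

end

section \<open>An explicit family of horizontal curves\<close>

lemma mk_mat_has_vector_derivative:
  assumes "(u has_vector_derivative u') (at t)" "(v has_vector_derivative v') (at t)"
  shows "((\<lambda>t. mk_mat (u t) (v t)) has_vector_derivative mk_mat u' v') (at t)"
proof -
  have "linear (\<lambda>x. mk_mat (fst x) (snd x))"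
    by (rule linearI; rule mat_eqI) (simp_all add: cu_add cv_add cu_scaleR cv_scaleR)
  then have "bounded_linear (\<lambda>x. mk_mat (fst x) (snd x))" by (simp add: linear_conv_bounded_linear)
  from bounded_linear.has_vector_derivative[OF this has_vector_derivative_Pair[OF assms]]
  show ?thesis by simp
qed

text \<open>The geodesics \<open>exp (t (A + l Z)) exp (- t l Z)\<close> with \<open>A = horizontal \<phi>\<^sub>0\<close>.\<close>

definition geo_P :: "real \<Rightarrow> real \<Rightarrow> real" where "geo_P l t = cser 0 ((1 - l\<^sup>2) * t\<^sup>2)"
definition geo_Q :: "real \<Rightarrow> real \<Rightarrow> real" where "geo_Q l t = 2 * t * cser 1 ((1 - l\<^sup>2) * t\<^sup>2)"

definition geodesic :: "real \<Rightarrow> real \<Rightarrow> real \<Rightarrow> real^2^2" where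
  "geodesic l \<phi>\<^sub>0 t = mk_mat (Complex (geo_P l t) (l * geo_Q l t) * cis (- l * t)) (of_real (geo_Q l t) * cis (\<phi>\<^sub>0 - l * t))"

text \<open>Since (A + l Z)^2 = (1 - l^2) I, one has exp (t (A + l Z)) = P I + Q (A + l Z) with P =
  \<open>geo_P l t\<close> and Q = \<open>geo_Q l t\<close>; hence P' = (1 - l^2) Q and Q' =
  P.\<close>

lemma geo_P_deriv: "(geo_P l has_real_derivative (1 - l\<^sup>2) * geo_Q l t) (at t)"
proof -
  have "((\<lambda>t. (1 - l\<^sup>2) * t\<^sup>2) has_real_derivative (1 - l\<^sup>2) * (2 * t)) (at t)"
    by (auto intro!: derivative_eq_intros)
  from DERIV_chain2[OF cser_deriv[of 0] this] show ?thesis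
    unfolding geo_P_def[abs_def] geo_Q_def One_nat_def by (rule DERIV_cong) simp
qed

lemma geo_Q_deriv: "(geo_Q l has_real_derivative geo_P l t) (at t)"
proof -
  let ?x = "(1 - l\<^sup>2) * t\<^sup>2"
  have "((\<lambda>t. (1 - l\<^sup>2) * t\<^sup>2) has_real_derivative (1 - l\<^sup>2) * (2 * t)) (at t)"
    by (auto intro!: derivative_eq_intros)
  from DERIV_chain2[OF cser_deriv[of 1] this]
  have "((\<lambda>t. cser 1 ((1 - l\<^sup>2) * t\<^sup>2)) has_real_derivative cser 2 ?x * ((1 - l\<^sup>2) * (2 * t))) (at t)"
    by (simp add: numeral_2_eq_2 One_nat_def)
  from DERIV_mult[OF DERIV_cmult_Id[of 2] this]
  have "(geo_Q l has_real_derivative 2 * cser 1 ?x + cser 2 ?x * ((1 - l\<^sup>2) * (2 * t)) * (2 * t)) (at t)"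
    unfolding geo_Q_def[abs_def] .
  also have "2 * cser 1 ?x + cser 2 ?x * ((1 - l\<^sup>2) * (2 * t)) * (2 * t) = geo_P l t"
    using cser_ode[of ?x] by (simp add: geo_P_def power2_eq_square algebra_simps)
  finally show ?thesis .
qed

text \<open>The right factor exp (- t l Z) cancels the vertical component l Z of the velocity and
  conjugates A, which turns its direction by - 2 l t.\<close>

lemma geodesic_horizontal:
  "(geodesic l \<phi>\<^sub>0 has_vector_derivative geodesic l \<phi>\<^sub>0 t ** horizontal (\<phi>\<^sub>0 - 2 * l * t)) (at t)"
proof -
  have u: "((\<lambda>t. Complex (geo_P l t) (l * geo_Q l t) * cis (- l * t)) has_vector_derivative
      of_real (geo_Q l t) * cis (- l * t)) (at t)"
    unfolding has_vector_derivative_complex_iff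
    by (auto intro!: derivative_eq_intros geo_P_deriv geo_Q_deriv simp: algebra_simps power2_eq_square)
  have v: "((\<lambda>t. of_real (geo_Q l t) * cis (\<phi>\<^sub>0 - l * t)) has_vector_derivative
      cnj (Complex (geo_P l t) (l * geo_Q l t)) * cis (\<phi>\<^sub>0 - l * t)) (at t)"
    unfolding has_vector_derivative_complex_iff
    by (auto intro!: derivative_eq_intros geo_P_deriv geo_Q_deriv simp: algebra_simps)
  have "geodesic l \<phi>\<^sub>0 t ** horizontal (\<phi>\<^sub>0 - 2 * l * t)
    = mk_mat (of_real (geo_Q l t) * cis (- l * t)) (cnj (Complex (geo_P l t) (l * geo_Q l t)) * cis (\<phi>\<^sub>0 - l * t))"
    by (rule mat_eqI) (simp_all add: geodesic_def cu_mult cv_mult cis_cnj cis_mult mult.assoc)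
  then show ?thesis
    unfolding geodesic_def[abs_def] using mk_mat_has_vector_derivative[OF u v] by simp
qed

lemma geo_pythagoras: "(geo_P l t)\<^sup>2 + (l * geo_Q l t)\<^sup>2 = 1 + (geo_Q l t)\<^sup>2"
proof -
  have "(geo_P l t)\<^sup>2 = 1 + 4 * ((1 - l\<^sup>2) * t\<^sup>2) * (cser 1 ((1 - l\<^sup>2) * t\<^sup>2))\<^sup>2"
    using cser_pythagoras[of "(1 - l\<^sup>2) * t\<^sup>2"] by (simp add: geo_P_def)
  also have "4 * ((1 - l\<^sup>2) * t\<^sup>2) * (cser 1 ((1 - l\<^sup>2) * t\<^sup>2))\<^sup>2 = (1 - l\<^sup>2) * (geo_Q l t)\<^sup>2"
    by (simp add: geo_Q_def power_mult_distrib)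
  finally show ?thesis by (simp add: power_mult_distrib algebra_simps)
qed

context covering_group
begin

text \<open>That the curve reaches the right matrix at time T = Phi is the computation of
  \<open>geo_P\<close> and \<open>geo_Q\<close> at T. That its lift ends at the right point of G is
  read off from an explicit lift \<open>K (\<zeta> t)\<close> with a continuous angle.\<close>

lemma dist_upper_bound:
  assumes f: "admissible f" and r: "r > 0"
  shows "\<bar>f (K (of_real (sinh r) * cis \<phi>, z)) - f \<one>\<bar> \<le> Phi (cosh r) z"
proof -
  define c where "c = cosh r"
  define w where "w = sinh r"
  have c: "c > 1" using r cosh_real_strict_mono[of 0 r] by (simp add: c_def)
  have w: "w > 0" "w\<^sup>2 = c\<^sup>2 - 1" using r by (simp_all add: w_def c_def cosh_square_eq)
  define \<theta> where "\<theta> = Theta c z"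
  define q where "q = arcosh_quot (c * cos \<theta>)"
  define T where "T = w * q"
  define l where "l = c * sin \<theta> / w"
  have dom: "\<bar>\<theta>\<bar> < pi" "c * cos \<theta> > -1" "\<theta> - c * sin \<theta> * q = z"
    using Theta[OF c, of z] by (auto simp: \<theta>_def q_def theta_dom_def theta_fun_def)
  have q: "q > 0" unfolding q_def by (rule arcosh_quot_pos[OF dom(2)])
  have T: "T > 0" "T = Phi c z"
    using w q by (simp_all add: T_def Phi_def q_def \<theta>_def w_def c_def cosh_square_eq)
  have lT: "l * T = \<theta> - z" using w dom(3) by (simp add: l_def T_def)
  \<comment> \<open>The argument of \<open>cser\<close> in \<open>geo_P\<close> and
    \<open>geo_Q\<close> at time T; as a value of \<open>csinv\<close> it exceeds - pi^2, and
    \<open>cser 0\<close> sends it to c cos \<theta>.\<close>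
  have xT: "(1 - l\<^sup>2) * T\<^sup>2 = csinv (c * cos \<theta>)"
  proof -
    have "(l * w)\<^sup>2 = (c * sin \<theta>)\<^sup>2" using w(1) by (simp add: l_def)
    then have "(1 - l\<^sup>2) * T\<^sup>2 = (w\<^sup>2 - (c * sin \<theta>)\<^sup>2) * q\<^sup>2" unfolding T_def by algebra
    also have "\<dots> = ((c * cos \<theta>)\<^sup>2 - 1) * q\<^sup>2" using w(2) sin_cos_squared_add[of \<theta>] by algebra
    finally show ?thesis unfolding q_def arcosh_quot_square[OF dom(2)] .
  qed
  have PT: "geo_P l T = c * cos \<theta>" by (simp add: geo_P_def xT csinv[OF dom(2)])
  have QT: "geo_Q l T = w"
    using q unfolding geo_Q_def xT by (simp add: T_def q_def arcosh_quot_eq[OF dom(2)])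
  \<comment> \<open>Up to time T the curve has not returned to the axis: for l^2 > 1 the argument
    decreases in t, so the bound at T suffices.\<close>
  have Q0: "geo_Q l t \<ge> 0" if "t \<in> {0..T}" for t
  proof -
    have "(1 - l\<^sup>2) * t\<^sup>2 > - pi\<^sup>2"
    proof (cases "l\<^sup>2 \<le> 1")
      case True
      then have "(1 - l\<^sup>2) * t\<^sup>2 \<ge> 0" by simp
      moreover have "0 < pi\<^sup>2" by simp
      ultimately show ?thesis by linarith
    next
      case False
      have "t\<^sup>2 \<le> T\<^sup>2" using that by (intro power_mono) auto
      then have "(1 - l\<^sup>2) * T\<^sup>2 \<le> (1 - l\<^sup>2) * t\<^sup>2" using False by (intro mult_left_mono_neg) auto
      then show ?thesis using xT csinv(2)[OF dom(2)] by linarith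
    qed
    then have "cser 1 ((1 - l\<^sup>2) * t\<^sup>2) > 0" by (rule cser_1_pos)
    then show ?thesis using that by (simp add: geo_Q_def)
  qed
  define n where "n t = sqrt (1 + (geo_Q l t)\<^sup>2)" for t
  have n: "n t > 0" "(n t)\<^sup>2 = 1 + (geo_Q l t)\<^sup>2" for t by (simp_all add: n_def add_pos_nonneg)
  have Pn: "\<bar>geo_P l t\<bar> \<le> n t" for t
    unfolding n_def using geo_pythagoras[of l t] zero_le_power2[of "l * geo_Q l t"]
    by (intro real_le_rsqrt) (unfold power2_abs, linarith)
  \<comment> \<open>As Q \<ge> 0, the number P + i l Q stays in one closed half-plane, where sgn l
    times an arccos is a continuous choice of its argument.\<close>
  define \<eta> where "\<eta> t = sgn l * arccos (geo_P l t / n t)" for t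
  have ang: "-1 \<le> geo_P l t / n t" "geo_P l t / n t \<le> 1" for t
    using Pn[of t] n(1)[of t] by (auto simp: abs_le_iff divide_simps)
  have polar: "of_real (n t) * cis (\<eta> t) = Complex (geo_P l t) (l * geo_Q l t)" if t: "t \<in> {0..T}" for t
  proof -
    let ?b = "arccos (geo_P l t / n t)"
    have s: "n t * sin ?b = \<bar>l\<bar> * geo_Q l t"
    proof -
      have "1 - (geo_P l t / n t)\<^sup>2 = (l * geo_Q l t / n t)\<^sup>2"
      proof -
        have "(geo_P l t)\<^sup>2 / (n t)\<^sup>2 + (l * geo_Q l t)\<^sup>2 / (n t)\<^sup>2 = 1"
          unfolding add_divide_distrib[symmetric] geo_pythagoras n(2)[symmetric] using n(1)[of t] by simp
        then show ?thesis by (simp add: power_divide)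
      qed
      then have "sin ?b = \<bar>l * geo_Q l t / n t\<bar>" using sin_arccos[OF ang[of t]] by simp
      then show ?thesis using n(1)[of t] Q0[OF t] by (simp add: abs_mult abs_divide)
    qed
    have cs: "n t * cos ?b = geo_P l t" using cos_arccos[OF ang[of t]] n(1)[of t] by simp
    show ?thesis
    proof (cases "l = 0")
      \<comment> \<open>For l = 0 the sign factor gives the angle 0, which is correct because P =
        cosh t > 0.\<close>
      case True
      then have "(n t)\<^sup>2 = (geo_P l t)\<^sup>2" "geo_P l t > 0"
        using geo_pythagoras[of l t] n[of t] cser_pos_nonneg[of "t\<^sup>2" 0] by (simp_all add: geo_P_def)
      then have "n t = geo_P l t" using n(1)[of t] by (simp add: power2_eq_iff_nonneg)
      then show ?thesis using True by (simp add: \<eta>_def complex_eq_iff)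
    next
      case False
      then have "cos (\<eta> t) = cos ?b" "sin (\<eta> t) = sgn l * sin ?b" by (auto simp: \<eta>_def sgn_if)
      then show ?thesis using cs s by (simp add: complex_eq_iff mult.left_commute[of "n t"]) (simp add: sgn_if)
    qed
  qed
  have cont: "continuous_on {0..T} (geo_P l)" "continuous_on {0..T} (geo_Q l)"
    using geo_P_deriv geo_Q_deriv by (blast intro: DERIV_isCont continuous_at_imp_continuous_on)+
  \<comment> \<open>The argument of \<open>cu\<close> along the geodesic is \<eta> - l t; dividing
    this phase out of \<open>cv\<close> leaves \<phi>_0 - \<eta>. The initial direction \<phi>_0 =
    \<phi> + \<theta> is chosen because \<eta> T = \<theta>.\<close>
  define \<zeta> where "\<zeta> t = (of_real (geo_Q l t) * cis (\<phi> + \<theta> - \<eta> t), \<eta> t - l * t)" for t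
  have "continuous_on {0..T} (\<lambda>t. arccos (geo_P l t / n t))"
    by (rule continuous_on_compose2[OF continuous_on_arccos'])
       (use ang n(1) in \<open>auto simp: n_def less_le intro!: continuous_intros cont\<close>)
  then have "continuous_on {0..T} \<eta>" unfolding \<eta>_def by (rule continuous_on_mult_left)
  then have c\<gamma>: "continuous_on {0..T} (\<lambda>t. K (\<zeta> t))" unfolding \<zeta>_def by (intro continuous_on_K continuous_intros cont)
  have p\<gamma>: "p (K (\<zeta> t)) = geodesic l (\<phi> + \<theta>) t" if t: "t \<in> {0..T}" for t
  proof (rule mat_eqI)
    have "cu (p (K (\<zeta> t))) = of_real (n t) * cis (\<eta> t) * cis (- l * t)"
      by (simp add: K \<zeta>_def cu_kap norm_mult n_def cis_mult)
    then show "cu (p (K (\<zeta> t))) = cu (geodesic l (\<phi> + \<theta>) t)" by (simp add: polar[OF t] geodesic_def)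
    show "cv (p (K (\<zeta> t))) = cv (geodesic l (\<phi> + \<theta>) t)"
      by (simp add: K \<zeta>_def cv_kap geodesic_def cis_mult add_diff_eq)
  qed
  have "\<bar>f (K (\<zeta> T)) - f (K (\<zeta> 0))\<bar> \<le> T"
    by (rule horizontal_curve_bound[OF f T(1) c\<gamma> _ p\<gamma> geodesic_horizontal]) (simp_all add: K)
  moreover have "\<zeta> 0 = (0, 0)"
  proof -
    have "geo_P l 0 = 1" using cser_0_square[of 0] by (simp add: geo_P_def)
    then show ?thesis by (simp add: \<zeta>_def \<eta>_def n_def geo_Q_def)
  qed
  moreover have "\<eta> T = \<theta>"
  proof -
    have "n T = c" using c w by (simp add: n_def QT)
    then have "\<eta> T = sgn l * arccos (cos \<theta>)" using c by (simp add: \<eta>_def PT)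
    moreover have "arccos (cos \<theta>) = \<bar>\<theta>\<bar>" using dom(1) arccos_cos[of "\<bar>\<theta>\<bar>"] by simp
    \<comment> \<open>On (-pi, pi) the signs of sin \<theta> and \<theta> agree, so the branch
      chosen by sgn l gives \<theta> rather than its negative.\<close>
    moreover have "sgn l = sgn \<theta>"
    proof -
      have "sgn (sin \<theta>) = sgn \<theta>"
      proof (cases \<theta> "0::real" rule: linorder_cases)
        case less then show ?thesis using dom(1) sin_gt_zero[of "- \<theta>"] by (simp add: sgn_if)
      next
        case greater then show ?thesis using dom(1) sin_gt_zero[of \<theta>] by (simp add: sgn_if)
      qed simp
      then show ?thesis using c w(1) by (simp add: l_def sgn_mult sgn_divide)
    qed
    ultimately show ?thesis by (simp add: sgn_mult_abs)
  qed
  then have "\<zeta> T = (of_real (sinh r) * cis \<phi>, z)" using lT by (simp add: \<zeta>_def QT w_def)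
  ultimately show ?thesis using T(2) K(4) by (simp add: c_def)
qed

end

section \<open>The angle coordinate on the universal covering group\<close>

lemma polar_arctan: "Re z > 0 \<Longrightarrow> of_real (cmod z) * cis (arctan (Im z / Re z)) = z"
proof -
  assume "Re z > 0"
  moreover from this have "z \<noteq> 0" by auto
  ultimately have "Arg z = arctan (Im z / Re z)" by (simp add: Arg_eq_Im_Ln Im_Ln_eq)
  then show ?thesis using rcis_cmod_Arg[of z] by (simp add: rcis_def)
qed

text \<open>A continuous right inverse of \<open>kap\<close> on the matrices of SL(2,R) with Re (cu
  M) > 0, a neighbourhood of the identity.\<close>

definition axis_chart :: "real^2^2 \<Rightarrow> complex \<times> real" where
  "axis_chart M = (cv M * cis (- local_angle 0 M), local_angle 0 M)"

lemma mem_angle_dom_0: "M \<in> angle_dom 0 \<longleftrightarrow> Re (cu M) > 0"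
  by (simp add: angle_dom_def)

lemma cmod_cu: "det M = 1 \<Longrightarrow> cmod (cu M) = sqrt (1 + (cmod (cv M))\<^sup>2)"
  by (rule real_sqrt_unique[symmetric]) (simp_all add: det_cu_cv)

lemma kap_axis_chart:
  assumes "det M = 1" "M \<in> angle_dom 0" shows "kap (axis_chart M) = M"
proof (rule mat_eqI)
  have pos: "Re (cu M) > 0" using assms(2) by (simp add: mem_angle_dom_0)
  have "cu (kap (axis_chart M)) = of_real (cmod (cu M)) * cis (arctan (Im (cu M) / Re (cu M)))"
    unfolding cmod_cu[OF assms(1)] by (simp add: axis_chart_def cu_kap norm_mult local_angle_def)
  then show "cu (kap (axis_chart M)) = cu M" using polar_arctan[OF pos] by simp
  show "cv (kap (axis_chart M)) = cv M"
    by (simp add: axis_chart_def cv_kap cis_mult mult.assoc)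
qed

lemma continuous_on_axis_chart: "continuous_on (angle_dom 0) axis_chart"
proof -
  have "continuous_on (angle_dom 0) (local_angle 0)"
    using local_angle_has_derivative has_derivative_continuous
    by (intro continuous_at_imp_continuous_on) blast
  then show ?thesis unfolding axis_chart_def[abs_def]
    by (intro continuous_intros continuous_on_id)
qed

lemma axis_chart_one: "axis_chart (mat 1) = (0, 0)"
  by (simp add: axis_chart_def local_angle_def)

text \<open>The definition of simple connectivity makes any two loops freely homotopic, in
  particular the constant ones at x and y; the track of the base point joins x to y.\<close>

lemma simply_connected_imp_path:
  fixes S :: "'a::topological_space set"
  assumes "simply_connected S" "x \<in> S" "y \<in> S"
  obtains c where "path c" "path_image c \<subseteq> S" "pathstart c = x" "pathfinish c = y"
proof -
  have "homotopic_loops S (\<lambda>_. x) (\<lambda>_. y)"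
    using assms(2,3)
    by (intro assms(1)[unfolded simply_connected_def, rule_format])
       (auto simp: path_def path_image_def pathstart_def pathfinish_def)
  then obtain h :: "real \<times> real \<Rightarrow> 'a" where h: "continuous_on ({0..1} \<times> {0..1}) h" "h \<in> ({0..1} \<times> {0..1}) \<rightarrow> S"
    "\<And>t. h (0, t) = x" "\<And>t. h (1, t) = y"
    unfolding homotopic_loops_def homotopic_with_def by auto
  have "continuous_on {0..1} (\<lambda>t. h (t, 0))"
    by (rule continuous_on_compose2[OF h(1)]) (auto intro!: continuous_intros)
  then show ?thesis
    using h by (intro that[of "\<lambda>t. h (t, 0)"]) (auto simp: path_def path_image_def pathstart_def pathfinish_def)
qed

text \<open>Going along c and back along d gives a loop that contracts in S, so its image under
  \<psi> contracts in the punctured plane. By monodromy of exp its logarithm returns to the initial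
  value.\<close>

lemma log_lift_unique:
  fixes S :: "'a::topological_space set" and \<psi> :: "'a \<Rightarrow> complex"
  assumes S: "simply_connected S" and \<psi>: "continuous_on S \<psi>" "\<And>x. x \<in> S \<Longrightarrow> \<psi> x \<noteq> 0" "\<psi> a = 1"
    and c: "path c" "path_image c \<subseteq> S" "pathstart c = a" "pathfinish c = b"
    and d: "path d" "path_image d \<subseteq> S" "pathstart d = a" "pathfinish d = b"
    and h: "path h" "h 0 = 0" "\<And>t. t \<in> {0..1} \<Longrightarrow> exp (h t) = \<psi> (c t)"
    and k: "path k" "k 0 = 0" "\<And>t. t \<in> {0..1} \<Longrightarrow> exp (k t) = \<psi> (d t)"
  shows "h 1 = k 1"
proof -
  define L where "L = c +++ reversepath d"
  \<comment> \<open>The shift makes the reversed k start where h ends; l then ends at h 1 - k 1,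
    which monodromy forces to be 0.\<close>
  define l where "l = h +++ (\<lambda>t. k (1 - t) + (h 1 - k 1))"
  have aS: "a \<in> S" using c(2,3) pathstart_in_path_image by blast
  have L: "path L" "path_image L \<subseteq> S" "pathstart L = a" "pathfinish L = a"
    unfolding L_def using c d by (simp_all add: subset_path_image_join)
  have "homotopic_loops S L (\<lambda>_. a)"
  proof (rule S[unfolded simply_connected_def, rule_format], intro conjI)
    show "path (\<lambda>_::real. a)" "path_image (\<lambda>_::real. a) \<subseteq> S" using aS by (auto simp: path_def path_image_def)
    show "pathfinish L = pathstart L" using L by simp
  qed (use L in \<open>simp_all add: pathstart_def pathfinish_def\<close>)
  then have "homotopic_loops (- {0}) (\<psi> \<circ> L) (\<psi> \<circ> (\<lambda>_. a))"
    by (rule homotopic_loops_continuous_image[OF _ \<psi>(1)]) (use \<psi>(2) in auto)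
  then have "homotopic_loops (- {0}) (\<psi> \<circ> L) (linepath 1 1)"
    using \<psi>(3) by (simp add: o_def linepath_def)
  then have hom: "homotopic_paths (- {0}) (\<psi> \<circ> L) (linepath (pathstart (\<psi> \<circ> L)) (pathstart (\<psi> \<circ> L)))"
    by (rule homotopic_loops_imp_homotopic_paths_null)
  have p1: "pathstart (\<psi> \<circ> L) = 1" using L(3) \<psi>(3) by (simp add: pathstart_compose)
  have eq: "exp (h 1) = exp (k 1)" using h(3)[of 1] k(3)[of 1] c(4) d(4) by (simp add: pathfinish_def)
  have pl: "path l"
  proof -
    have "path (\<lambda>t. k (1 - t) + (h 1 - k 1))"
      unfolding path_def
    proof (intro continuous_on_add continuous_on_const)
      show "continuous_on {0..1} (\<lambda>t. k (1 - t))"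
        by (rule continuous_on_compose2[OF k(1)[unfolded path_def]])
           (simp_all add: continuous_on_diff continuous_on_id continuous_on_const image_subset_iff)
    qed
    then show ?thesis unfolding l_def using h(1) by (intro path_join_imp) (auto simp: pathstart_def pathfinish_def)
  qed
  have "pathfinish l = pathfinish (linepath (0::complex) 0)"
  proof (rule covering_space_monodromy[OF covering_space_exp_punctured_plane _ _ _ _ hom])
    show "path (\<psi> \<circ> L)" using hom homotopic_paths_imp_path by blast
    show "path_image (\<psi> \<circ> L) \<subseteq> - {0}" using hom homotopic_paths_imp_subset by blast
    show "exp (l t) = (\<psi> \<circ> L) t" if "t \<in> {0..1}" for t
    proof (cases "t \<le> 1/2")
      case True
      then show ?thesis using that h(3)[of "2 * t"] by (simp add: l_def L_def joinpaths_def)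
    next
      case False
      then have "exp (k (1 - (2 * t - 1))) = \<psi> (d (1 - (2 * t - 1)))" using that by (intro k(3)) auto
      then show ?thesis using False eq by (simp add: l_def L_def joinpaths_def reversepath_def exp_add exp_diff)
    qed
    show "exp (linepath 0 0 t) = linepath (pathstart (\<psi> \<circ> L)) (pathstart (\<psi> \<circ> L)) t" for t
      unfolding p1 by (simp add: linepath_def)
    show "pathstart l = pathstart (linepath (0::complex) 0)" using h(2) by (simp add: l_def pathstart_def joinpaths_def)
  qed (use pl p1 in auto)
  then show ?thesis using k(2) by (simp add: l_def pathfinish_def joinpaths_def linepath_def)
qed

context covering_group
begin

text \<open>Left translation moves the question to the identity: a nearby x is
  \<open>g \<otimes> K y\<close> with y small, and
  \<open>t \<mapsto> g \<otimes> K (t *\<^sub>R y)\<close> is the path.\<close>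

lemma path_neighbourhood:
  assumes g: "g \<in> carrier G" and W: "open W" "p g \<in> W"
  shows "\<exists>U. openin (top_of_set (carrier G)) U \<and> g \<in> U \<and> (\<forall>x\<in>U. \<exists>c. path c \<and> path_image c \<subseteq> carrier G \<inter> p -` W \<and>
     pathstart c = g \<and> pathfinish c = x)"
proof -
  obtain B u \<sigma> where B: "openin (top_of_set (carrier SL2)) B" "mat 1 \<in> B"
    "openin (top_of_set (carrier G)) u" "\<one> \<in> u" "homeomorphism u B p \<sigma>" by (rule local_section)
  have inj: "inj_on p u" using B(5) by (intro inj_on_inverseI[of _ \<sigma>]) (simp add: homeomorphism_def)
  have "openin (top_of_set UNIV) (UNIV \<inter> K -` u)"
    by (rule continuous_openin_preimage[OF K(1) _ B(3)]) (simp add: K)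
  then have o1: "open (K -` u)" by simp
  have "open ((\<lambda>x. p g ** kap x) -` W)"
    by (intro open_vimage W continuous_on_mat_mult continuous_on_const continuous_on_kap continuous_on_id)
  with o1 have "open (K -` u \<inter> (\<lambda>x. p g ** kap x) -` W)" by (rule open_Int)
  moreover have "(0, 0) \<in> K -` u \<inter> (\<lambda>x. p g ** kap x) -` W" using B W by (simp add: K kap_0)
  ultimately obtain \<delta> where \<delta>: "\<delta> > 0" "ball (0, 0) \<delta> \<subseteq> K -` u \<inter> (\<lambda>x. p g ** kap x) -` W"
    using open_contains_ball by blast
  define N where "N = angle_dom 0 \<inter> axis_chart -` ball (0, 0) \<delta>"
  have oN: "open N" unfolding N_def
    by (rule continuous_open_preimage[OF continuous_on_axis_chart open_angle_dom open_ball])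
  define u' where "u' = u \<inter> (carrier G \<inter> p -` N)"
  have ou': "openin (top_of_set (carrier G)) u'" unfolding u'_def
    by (intro openin_Int B(3) continuous_openin_preimage_gen[OF continuous_p oN])
  interpret G: group G by (rule group_G)
  have left: "continuous_on (carrier G) (\<lambda>x. inv g \<otimes> x)" "(\<lambda>x. inv g \<otimes> x) \<in> carrier G \<rightarrow> carrier G"
    using g by (auto intro!: continuous_on_mult continuous_on_const continuous_on_id)
  define U where "U = carrier G \<inter> (\<lambda>x. inv g \<otimes> x) -` u'"
  have "openin (top_of_set (carrier G)) U" unfolding U_def by (rule continuous_openin_preimage[OF left ou'])
  moreover have "g \<in> U"
    using g B(4) \<delta>(1) by (simp add: U_def u'_def N_def p_one axis_chart_one mem_angle_dom_0)
  moreover have "\<exists>c. path c \<and> path_image c \<subseteq> carrier G \<inter> p -` W \<and> pathstart c = g \<and> pathfinish c = x" if x: "x \<in> U" for x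
  proof -
    define k where "k = inv g \<otimes> x"
    have k: "k \<in> u" "k \<in> carrier G" "p k \<in> angle_dom 0" "axis_chart (p k) \<in> ball (0, 0) \<delta>"
      using x by (auto simp: U_def u'_def N_def k_def)
    define y where "y = axis_chart (p k)"
    have "p (K y) = p k" using kap_axis_chart[OF det_p[OF k(2)] k(3)] by (simp add: K y_def)
    moreover have "K y \<in> u" using \<delta>(2) k(4) by (auto simp: y_def)
    \<comment> \<open>Both points lie in the sheet u and have the same projection.\<close>
    ultimately have "K y = k" using inj k(1) by (auto dest: inj_onD)
    then have x_eq: "g \<otimes> K y = x" using g x by (simp add: k_def U_def G.m_assoc[symmetric])
    define c where "c t = g \<otimes> K (t *\<^sub>R y)" for t :: real
    have "path c" unfolding path_def c_def[abs_def]
      using g by (intro continuous_on_mult continuous_on_const continuous_on_K continuous_intros) (auto simp: K)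
    moreover have "c t \<in> carrier G \<inter> p -` W" if "t \<in> {0..1}" for t
    proof -
      have "norm (t *\<^sub>R y) \<le> 1 * norm y" using that unfolding norm_scaleR by (intro mult_right_mono) auto
      also have "\<dots> < \<delta>" using k(4) by (simp add: y_def dist_norm zero_prod_def[symmetric])
      finally have "t *\<^sub>R y \<in> ball (0, 0) \<delta>" by (simp add: dist_norm zero_prod_def[symmetric])
      then show ?thesis using \<delta>(2) g by (auto simp: c_def p_mult K)
    qed
    moreover have "c 0 = g" "c 1 = x" using g x_eq by (simp_all add: c_def K zero_prod_def)
    ultimately show ?thesis
      by (intro exI[of _ c]) (auto simp: path_image_def pathstart_def pathfinish_def)
  qed
  ultimately show ?thesis by blast
qed

text \<open>The coordinate z without a global inverse of \<open>K\<close>: it is the imaginary part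
  of a logarithm of \<open>cu (p g)\<close> continued along a path from the identity, independent of
  the path by \<open>log_lift_unique\<close>. The local formula is what yields smoothness.\<close>

lemma exists_angle:
  assumes sc: "simply_connected (carrier G)"
  shows "\<exists>\<zeta>. (\<forall>w z. \<zeta> (K (w, z)) = z) \<and> (\<forall>g\<in>carrier G. \<exists>U. openin (top_of_set (carrier G)) U \<and> g \<in> U \<and>
      (\<forall>x\<in>U. p x \<in> angle_dom (\<zeta> g) \<and> \<zeta> x = local_angle (\<zeta> g) (p x)))"
proof -
  define \<psi> where "\<psi> g = cu (p g)" for g
  have \<psi>c: "continuous_on (carrier G) \<psi>" unfolding \<psi>_def by (intro continuous_on_cu continuous_p)
  have \<psi>0: "\<psi> g \<noteq> 0" if "g \<in> carrier G" for g
  proof -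
    have "cmod (\<psi> g) > 0" unfolding \<psi>_def cmod_cu[OF det_p[OF that]] by (simp add: add_pos_nonneg)
    then show ?thesis by auto
  qed
  have \<psi>1: "\<psi> \<one> = 1" by (simp add: \<psi>_def p_one)
  define R where "R g c h \<longleftrightarrow> path c \<and> path_image c \<subseteq> carrier G \<and> pathstart c = \<one> \<and> pathfinish c = g \<and>
    path h \<and> h 0 = 0 \<and> (\<forall>t\<in>{0..1}. exp (h t) = \<psi> (c t))" for g c and h :: "real \<Rightarrow> complex"
  have ex: "\<exists>c h. R g c h" if g: "g \<in> carrier G" for g
  proof -
    obtain c where c: "path c" "path_image c \<subseteq> carrier G" "pathstart c = \<one>" "pathfinish c = g"
      by (rule simply_connected_imp_path[OF sc one_closed g])
    have 1: "path (\<psi> \<circ> c)" by (rule path_continuous_image[OF c(1) continuous_on_subset[OF \<psi>c c(2)]])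
    have 2: "path_image (\<psi> \<circ> c) \<subseteq> - {0}" using c(2) \<psi>0 by (auto simp: path_image_compose)
    have 3: "pathstart (\<psi> \<circ> c) = exp 0" using c(3) \<psi>1 by (simp add: pathstart_compose)
    show ?thesis
    proof (rule covering_space_lift_path_strong[OF covering_space_exp_punctured_plane UNIV_I 1 2 3])
      fix h assume h: "path h" "pathstart h = 0" "\<And>t. t \<in> {0..1} \<Longrightarrow> exp (h t) = (\<psi> \<circ> c) t"
      have "R g c h" unfolding R_def using c h(1,2) h(3) by (simp add: pathstart_def)
      then show "\<exists>c h. R g c h" by blast
    qed
  qed
  have uniq: "h 1 = k 1" if "R g c h" "R g d k" for g c h d k
    by (rule log_lift_unique[OF sc \<psi>c \<psi>0 \<psi>1, of c g d h k]) (use that in \<open>simp_all add: R_def\<close>)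
  define \<zeta> where "\<zeta> g = Im ((SOME h. \<exists>c. R g c h) 1)" for g
  have \<zeta>: "\<zeta> g = Im (h 1)" if "R g c h" for g c h
  proof -
    have "\<exists>c. R g c (SOME h. \<exists>c. R g c h)" by (rule someI[of "\<lambda>h. \<exists>c. R g c h" h]) (use that in blast)
    then obtain d where "R g d (SOME h. \<exists>c. R g c h)" ..
    from uniq[OF this that] show ?thesis by (simp add: \<zeta>_def)
  qed
  have "\<zeta> (K (w, z)) = z" for w z
  proof -
    \<comment> \<open>Along the ray from (0, 0) to (w, z) the logarithm is explicit, with imaginary
      part t z.\<close>
    define h where "h t = of_real (ln (sqrt (1 + (cmod (t *\<^sub>R w))\<^sup>2))) + \<i> * of_real (t * z)" for t
    have pos: "sqrt (1 + (cmod (t *\<^sub>R w))\<^sup>2) > 0" for t by (simp add: add_pos_nonneg)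
    have "path h" unfolding path_def h_def[abs_def] using pos
      by (intro continuous_intros ballI) (rule less_imp_neq[OF pos, symmetric])
    moreover have "exp (h t) = \<psi> (K (t *\<^sub>R w, t * z))" for t
    proof -
      have "exp (h t) = of_real (exp (ln (sqrt (1 + (cmod (t *\<^sub>R w))\<^sup>2)))) * cis (t * z)"
        by (simp add: h_def exp_add cis_conv_exp exp_of_real)
      also have "exp (ln (sqrt (1 + (cmod (t *\<^sub>R w))\<^sup>2))) = sqrt (1 + (cmod (t *\<^sub>R w))\<^sup>2)" using pos by (rule exp_ln)
      finally show ?thesis by (simp only: \<psi>_def K cu_kap)
    qed
    moreover have "h 0 = 0" by (simp add: h_def)
    moreover have "path (\<lambda>t. K (t *\<^sub>R w, t * z))" unfolding path_def by (intro continuous_on_K continuous_intros)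
    ultimately have "R (K (w, z)) (\<lambda>t. K (t *\<^sub>R w, t * z)) h"
      by (simp add: R_def path_image_def pathstart_def pathfinish_def K image_subset_iff)
    from \<zeta>[OF this] show ?thesis by (simp add: h_def)
  qed
  moreover have "\<exists>U. openin (top_of_set (carrier G)) U \<and> g \<in> U \<and>
      (\<forall>x\<in>U. p x \<in> angle_dom (\<zeta> g) \<and> \<zeta> x = local_angle (\<zeta> g) (p x))" if g: "g \<in> carrier G" for g
  proof -
    obtain c h where R: "R g c h" using ex[OF g] by blast
    define z where "z = \<zeta> g"
    have z: "Im (h 1) = z" using \<zeta>[OF R] by (simp add: z_def)
    have e1: "exp (h 1) = \<psi> g" using R by (auto simp: R_def pathfinish_def)
    have polar: "\<psi> g = of_real (cmod (\<psi> g)) * cis z"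
      using e1 z exp_eq_polar[of "h 1"] by (metis norm_exp_eq_Re of_real_exp)
    have n: "cmod (\<psi> g) > 0" using \<psi>0[OF g] by simp
    \<comment> \<open>\<open>cu\<close> relative to its value at g: v g = 1, and Re v > 0 exactly
      over \<open>angle_dom z\<close>.\<close>
    define v where "v x = \<psi> x * cis (- z) / of_real (cmod (\<psi> g))" for x
    have vx: "\<psi> x = v x * \<psi> g" for x
    proof -
      have "v x * (of_real (cmod (\<psi> g)) * cis z) = \<psi> x * (cis (- z) * cis z)" using n by (simp add: v_def)
      then show ?thesis using polar by (simp add: cis_mult)
    qed
    have vpos: "Re (v x) > 0 \<longleftrightarrow> p x \<in> angle_dom z" for x
      using n by (simp add: v_def angle_dom_def \<psi>_def zero_less_divide_iff Re_divide_of_real del: times_complex.sel)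
    have vg: "v g = 1" using vx[of g] \<psi>0[OF g] by simp
    have "p g \<in> angle_dom z" using vg vpos[of g] by simp
    from path_neighbourhood[OF g open_angle_dom this]
    obtain U where U: "openin (top_of_set (carrier G)) U" "g \<in> U"
      "\<forall>x\<in>U. \<exists>c. path c \<and> path_image c \<subseteq> carrier G \<inter> p -` angle_dom z \<and> pathstart c = g \<and> pathfinish c = x" by blast
    have "p x \<in> angle_dom z \<and> \<zeta> x = local_angle z (p x)" if x: "x \<in> U" for x
    proof -
      obtain e where e: "path e" "path_image e \<subseteq> carrier G \<inter> p -` angle_dom z" "pathstart e = g" "pathfinish e = x"
        using U(3) x by blast
      have et: "e t \<in> carrier G" "p (e t) \<in> angle_dom z" if "t \<in> {0..1}" for t
        using subsetD[OF e(2), of "e t"] that by (auto simp: path_image_def)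
      have px: "p x \<in> angle_dom z" using et(2)[of 1] e(4) by (simp add: pathfinish_def)
      \<comment> \<open>The logarithm at g is continued along e by the principal branch, which is
        continuous because v stays in the right half-plane there.\<close>
      define k where "k t = h 1 + Ln (v (e t))" for t
      have "path k"
      proof -
        have "continuous_on {0..1} (\<lambda>t. \<psi> (e t))"
          using e(1) et(1) by (intro continuous_on_compose2[OF \<psi>c]) (auto simp: path_def)
        moreover have "v (e t) \<notin> \<real>\<^sub>\<le>\<^sub>0" if "t \<in> {0..1}" for t
          using et(2)[OF that] vpos[of "e t"] by (auto simp: complex_nonpos_Reals_iff)
        ultimately show ?thesis unfolding path_def k_def
          using n by (intro continuous_on_add continuous_on_const continuous_on_Ln') (auto simp: v_def intro!: continuous_intros)
      qed
      moreover have k0: "k 0 = h 1" using e(3) vg by (simp add: k_def pathstart_def)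
      moreover have "exp (k t) = \<psi> (e t)" if "t \<in> {0..1}" for t
      proof -
        have "v (e t) \<noteq> 0" using vpos[of "e t"] et(2)[OF that] by auto
        then show ?thesis using e1 vx[of "e t"] by (simp add: k_def exp_add mult.commute)
      qed
      ultimately have k: "path k" "k 0 = h 1" "\<And>t. t \<in> {0..1} \<Longrightarrow> exp (k t) = \<psi> (e t)" by blast+
      have "R x (c +++ e) (h +++ k)"
        unfolding R_def
      proof (intro conjI ballI)
        have R': "path c" "path_image c \<subseteq> carrier G" "pathstart c = \<one>" "pathfinish c = g" "path h" "h 0 = 0"
          "\<And>t. t \<in> {0..1} \<Longrightarrow> exp (h t) = \<psi> (c t)" using R by (auto simp: R_def)
        show "path (c +++ e)" using R' e by (intro path_join_imp) auto
        show "path_image (c +++ e) \<subseteq> carrier G" using R' e by (intro subset_path_image_join) auto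
        show "pathstart (c +++ e) = \<one>" "pathfinish (c +++ e) = x" using R' e by auto
        show "path (h +++ k)" using R' k by (intro path_join_imp) (auto simp: pathstart_def pathfinish_def)
        show "(h +++ k) 0 = 0" using R' by (simp add: joinpaths_def)
        show "exp ((h +++ k) t) = \<psi> ((c +++ e) t)" if "t \<in> {0..1}" for t
          using R'(7)[of "2 * t"] k(3)[of "2 * t - 1"] that by (simp add: joinpaths_def)
      qed
      from \<zeta>[OF this] have "\<zeta> x = Im (k 1)" by (simp add: joinpaths_def)
      also have "\<dots> = z + Im (Ln (v x))" using e(4) z by (simp add: k_def pathfinish_def)
      also have "Im (Ln (v x)) = arctan (Im (v x) / Re (v x))"
        using px vpos[of x] by (subst Im_Ln_eq) auto
      also have "Im (v x) / Re (v x) = Im (\<psi> x * cis (- z)) / Re (\<psi> x * cis (- z))"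
        using n by (simp add: v_def Re_divide_of_real Im_divide_of_real del: times_complex.sel)
      finally show ?thesis using px by (simp add: local_angle_def \<psi>_def)
    qed
    then show ?thesis using U(1,2) unfolding z_def by blast
  qed
  ultimately show ?thesis by blast
qed

end

section \<open>The lower bound and the theorem\<close>

definition cyl_dist :: "real \<Rightarrow> real \<Rightarrow> real" where
  "cyl_dist r z = (if r > 0 then Phi (cosh r) z else sqrt (2 * pi * \<bar>z\<bar> + z\<^sup>2))"

lemma Phi_tendsto:
  assumes "c > 1" "(f \<longlongrightarrow> c) F" "(g \<longlongrightarrow> z) F"
  shows "((\<lambda>x. Phi (f x) (g x)) \<longlongrightarrow> Phi c z) F"
proof -
  have "isCont (\<lambda>(c, z). Phi c z) (c, z)"
    using Phi_has_derivative[OF assms(1)] has_derivative_continuous by blast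
  from isCont_tendsto_compose[OF this tendsto_Pair[OF assms(2,3)]] show ?thesis by simp
qed

lemma sqrt_tendsto_right:
  assumes "a \<ge> 1"
  shows "((\<lambda>\<epsilon>. sqrt (a\<^sup>2 + \<epsilon>\<^sup>2)) \<longlongrightarrow> a) (at_right 0)" "eventually (\<lambda>\<epsilon>. sqrt (a\<^sup>2 + \<epsilon>\<^sup>2) > a) (at_right 0)"
proof -
  have "((\<lambda>\<epsilon>. sqrt (a\<^sup>2 + \<epsilon>\<^sup>2)) \<longlongrightarrow> sqrt (a\<^sup>2 + 0\<^sup>2)) (at_right 0)" by (intro tendsto_intros)
  then show "((\<lambda>\<epsilon>. sqrt (a\<^sup>2 + \<epsilon>\<^sup>2)) \<longlongrightarrow> a) (at_right 0)" using assms by simp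
  have "sqrt (a\<^sup>2 + \<epsilon>\<^sup>2) > a" if "\<epsilon> > 0" for \<epsilon> using that by (intro real_less_rsqrt) simp
  then show "eventually (\<lambda>\<epsilon>. sqrt (a\<^sup>2 + \<epsilon>\<^sup>2) > a) (at_right 0)"
    using eventually_at_right_less[of "0::real"] by (auto elim: eventually_mono)
qed

lemma cyl_dist_approx:
  assumes "r \<ge> 0"
  shows "((\<lambda>\<epsilon>. Phi (sqrt ((cosh r)\<^sup>2 + \<epsilon>\<^sup>2)) z) \<longlongrightarrow> cyl_dist r z) (at_right 0)"
proof (cases "r > 0")
  case True
  then have "cosh r > 1" using cosh_real_strict_mono[of 0 r] by simp
  then show ?thesis
    using sqrt_tendsto_right(1)[of "cosh r"] True by (auto intro!: Phi_tendsto simp: cyl_dist_def cosh_real_ge_1)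
next
  case False
  with assms have "r = 0" by simp
  moreover have "filterlim (\<lambda>\<epsilon>. sqrt (1\<^sup>2 + \<epsilon>\<^sup>2)) (at_right 1) (at_right 0)"
    using sqrt_tendsto_right[of 1] by (intro tendsto_imp_filterlim_at_right) auto
  from filterlim_compose[OF Phi_tendsto_axis this] have
    "((\<lambda>\<epsilon>. Phi (sqrt (1\<^sup>2 + \<epsilon>\<^sup>2)) z) \<longlongrightarrow> sqrt (2 * pi * \<bar>z\<bar> + z\<^sup>2)) (at_right 0)" .
  ultimately show ?thesis by (simp add: cyl_dist_def)
qed

lemma cyl_dist_nonneg: "cyl_dist r z \<ge> 0"
proof (cases "r > 0")
  case True
  then have "cosh r > 1" using cosh_real_strict_mono[of 0 r] by simp
  then show ?thesis using True Phi_pos[of "cosh r" z] by (simp add: cyl_dist_def)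
qed (simp add: cyl_dist_def)

context covering_group
begin

text \<open>Axis points are limits of points with r > 0, f is continuous, and \<open>Phi\<close> has
  the stated limit.\<close>

lemma dist_upper_bound_axis:
  assumes f: "admissible f"
  shows "\<bar>f (K (0, z)) - f \<one>\<bar> \<le> sqrt (2 * pi * \<bar>z\<bar> + z\<^sup>2)"
proof -
  define h where "h r = \<bar>f (K (of_real (sinh r) * cis 0, z)) - f \<one>\<bar>" for r
  have "continuous_on UNIV (\<lambda>r. f (K (of_real (sinh r) * cis 0, z)))"
    using f by (intro continuous_on_smooth_function continuous_on_K continuous_intros) (auto simp: admissible_def K)
  then have "isCont h 0" unfolding h_def[abs_def]
    by (intro continuous_intros) (simp add: continuous_on_eq_continuous_at)
  then have "(h \<longlongrightarrow> h 0) (at_right 0)" by (simp add: isCont_def filterlim_at_split)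
  moreover have "filterlim cosh (at_right 1) (at_right (0::real))"
  proof (rule tendsto_imp_filterlim_at_right)
    have "isCont cosh (0::real)" by (intro continuous_intros)
    then show "(cosh \<longlongrightarrow> 1) (at_right (0::real))" by (simp add: isCont_def filterlim_at_split)
    have "cosh r > 1" if "r > 0" for r :: real using that cosh_real_strict_mono[of 0 r] by simp
    then show "eventually (\<lambda>r::real. cosh r > 1) (at_right 0)"
      using eventually_at_right_less[of "0::real"] by (auto elim: eventually_mono)
  qed
  from filterlim_compose[OF Phi_tendsto_axis this]
  have "((\<lambda>r. Phi (cosh r) z) \<longlongrightarrow> sqrt (2 * pi * \<bar>z\<bar> + z\<^sup>2)) (at_right 0)" .
  moreover have "eventually (\<lambda>r. h r \<le> Phi (cosh r) z) (at_right 0)"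
    using eventually_at_right_less[of "0::real"]
    by (rule eventually_mono) (simp only: h_def dist_upper_bound[OF f])
  ultimately have "h 0 \<le> sqrt (2 * pi * \<bar>z\<bar> + z\<^sup>2)"
    by (intro tendsto_le[of "at_right 0"]) auto
  then show ?thesis by (simp add: h_def)
qed

lemma cc_dist_cyl_eq_SUP:
  "cc_dist_cyl G p r \<phi> z = (SUP f\<in>Collect admissible. ereal \<bar>f \<one> - f (K (of_real (sinh r) * cis \<phi>, z))\<bar>)"
  unfolding cc_dist_cyl_def cc_dist_def cyl_point_eq admissible_def ..

lemma cc_dist_cyl_le:
  assumes "r \<ge> 0" shows "cc_dist_cyl G p r \<phi> z \<le> ereal (cyl_dist r z)"
  unfolding cc_dist_cyl_eq_SUP
proof (rule SUP_least)
  fix f assume "f \<in> Collect admissible"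
  then have f: "admissible f" by simp
  show "ereal \<bar>f \<one> - f (K (of_real (sinh r) * cis \<phi>, z))\<bar> \<le> ereal (cyl_dist r z)"
    using assms dist_upper_bound[OF f, of r \<phi> z] dist_upper_bound_axis[OF f, of z]
    by (cases "r = 0") (auto simp: cyl_dist_def abs_minus_commute)
qed

text \<open>Smoothness and the gradient bound are local, so f only has to be a
  \<open>shifted_dist\<close> near each point, with an angle y that may vary from point to
  point.\<close>

lemma admissible_shifted_dist:
  assumes \<epsilon>: "\<epsilon> > 0"
    and loc: "\<And>g. g \<in> carrier G \<Longrightarrow> \<exists>U W y. openin (top_of_set (carrier G)) U \<and> g \<in> U \<and> open W \<and> p ` U \<subseteq> W \<and>
      smooth_on W y \<and> (\<forall>M\<in>W. \<exists>\<mu>. \<bar>\<mu>\<bar> \<le> 1 \<and> (y has_derivative (\<lambda>V. \<mu> * Im (cu V * cnj (cu M)) / (cmod (cu M))\<^sup>2)) (at M)) \<and>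
      (\<forall>x\<in>U. f x = shifted_dist \<epsilon> y (p x))"
  shows "admissible f"
  unfolding admissible_def
proof (intro conjI ballI)
  show "smooth_function G p f"
    unfolding smooth_function_def
  proof
    fix g assume "g \<in> carrier G"
    from loc[OF this] obtain U W y where *: "openin (top_of_set (carrier G)) U" "g \<in> U" "open W" "p ` U \<subseteq> W"
      "smooth_on W y" "\<forall>x\<in>U. f x = shifted_dist \<epsilon> y (p x)" by (elim exE conjE) (rule that)
    have "\<forall>k. Ck_on k W (shifted_dist \<epsilon> y)"
      using smooth_on_shifted_dist[OF *(3) \<epsilon> *(5)] unfolding smooth_on_def .
    with * show "\<exists>U W F. openin (top_of_set (carrier G)) U \<and> g \<in> U \<and> open W \<and> p ` U \<subseteq> W \<and> (\<forall>k. Ck_on k W F) \<and> (\<forall>x\<in>U. f x = F (p x))"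
      by (intro exI[of _ U] exI[of _ W] exI[of _ "shifted_dist \<epsilon> y"] conjI)
  qed
  fix g assume g: "g \<in> carrier G"
  from loc[OF this] obtain U W y where *: "openin (top_of_set (carrier G)) U" "g \<in> U" "open W" "p ` U \<subseteq> W"
      "smooth_on W y" "\<forall>x\<in>U. f x = shifted_dist \<epsilon> y (p x)"
      and "\<forall>M\<in>W. \<exists>\<mu>. \<bar>\<mu>\<bar> \<le> 1 \<and> (y has_derivative (\<lambda>V. \<mu> * Im (cu V * cnj (cu M)) / (cmod (cu M))\<^sup>2)) (at M)"
    by (elim exE conjE) (rule that)
  moreover have pg: "p g \<in> W" using *(2,4) by blast
  ultimately obtain \<mu> where \<mu>: "\<bar>\<mu>\<bar> \<le> 1"
    "(y has_derivative (\<lambda>V. \<mu> * Im (cu V * cnj (cu (p g))) / (cmod (cu (p g)))\<^sup>2)) (at (p g))" by blast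
  have F: "shifted_dist \<epsilon> y differentiable at (p g)"
    by (rule smooth_on_differentiable[OF smooth_on_shifted_dist[OF *(3) \<epsilon> *(5)] pg])
  show "(left_invariant_field G p X_mat f g)\<^sup>2 + (left_invariant_field G p Y_mat f g)\<^sup>2 \<le> 1"
    using shifted_dist_gradient[OF \<epsilon> det_p[OF g] \<mu>]
    by (simp add: left_invariant_field_X[of U g f "shifted_dist \<epsilon> y", OF *(1,2) bspec[OF *(6)] F]
        left_invariant_field_Y[of U g f "shifted_dist \<epsilon> y", OF *(1,2) bspec[OF *(6)] F])
qed

lemma cc_dist_cyl_eqI:
  assumes r: "r \<ge> 0"
    and ge: "\<And>\<epsilon>. \<epsilon> > 0 \<Longrightarrow> ereal \<bar>Phi (sqrt (1 + \<epsilon>\<^sup>2)) 0 - Phi (sqrt ((cosh r)\<^sup>2 + \<epsilon>\<^sup>2)) z\<bar> \<le> cc_dist_cyl G p r \<phi> z"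
  shows "cc_dist_cyl G p r \<phi> z = ereal (cyl_dist r z)"
proof (rule antisym[OF cc_dist_cyl_le[OF r]])
  \<comment> \<open>The test function is positive at the identity; its value there tends to
    \<open>cyl_dist 0 0 = 0\<close>.\<close>
  have "((\<lambda>\<epsilon>. ereal \<bar>Phi (sqrt (1 + \<epsilon>\<^sup>2)) 0 - Phi (sqrt ((cosh r)\<^sup>2 + \<epsilon>\<^sup>2)) z\<bar>) \<longlongrightarrow> ereal \<bar>cyl_dist 0 0 - cyl_dist r z\<bar>) (at_right 0)"
    using cyl_dist_approx[of 0 0] by (intro tendsto_intros cyl_dist_approx r) simp
  moreover have "\<bar>cyl_dist 0 0 - cyl_dist r z\<bar> = cyl_dist r z" using cyl_dist_nonneg[of r z] by (simp add: cyl_dist_def)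
  ultimately have "((\<lambda>\<epsilon>. ereal \<bar>Phi (sqrt (1 + \<epsilon>\<^sup>2)) 0 - Phi (sqrt ((cosh r)\<^sup>2 + \<epsilon>\<^sup>2)) z\<bar>) \<longlongrightarrow> ereal (cyl_dist r z)) (at_right 0)" by simp
  then show "ereal (cyl_dist r z) \<le> cc_dist_cyl G p r \<phi> z"
    by (rule tendsto_upperbound) (auto intro!: eventually_mono[OF eventually_at_right_less] ge)
qed

lemma shifted_cosh_K: "shifted_cosh \<epsilon> (p (K (of_real (sinh r) * cis \<phi>, z))) = sqrt ((cosh r)\<^sup>2 + \<epsilon>\<^sup>2)"
  by (simp add: shifted_cosh_def K cv_kap norm_mult cosh_square_eq)

lemma shifted_cosh_one: "shifted_cosh \<epsilon> (p \<one>) = sqrt (1 + \<epsilon>\<^sup>2)"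
  by (simp add: shifted_cosh_def p_one)

lemma cc_dist_cyl_simply_connected:
  assumes sc: "simply_connected (carrier G)" and r: "r \<ge> 0"
  shows "cc_dist_cyl G p r \<phi> z = ereal (cyl_dist r z)"
proof (rule cc_dist_cyl_eqI[OF r])
  fix \<epsilon> :: real assume \<epsilon>: "\<epsilon> > 0"
  obtain \<zeta> where \<zeta>: "\<And>w z. \<zeta> (K (w, z)) = z"
    and loc: "\<And>g. g \<in> carrier G \<Longrightarrow> \<exists>U. openin (top_of_set (carrier G)) U \<and> g \<in> U \<and>
      (\<forall>x\<in>U. p x \<in> angle_dom (\<zeta> g) \<and> \<zeta> x = local_angle (\<zeta> g) (p x))"
    using exists_angle[OF sc] by blast
  define f where "f g = Phi (shifted_cosh \<epsilon> (p g)) (\<zeta> g)" for g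
  have "admissible f"
  proof (rule admissible_shifted_dist[OF \<epsilon>])
    fix g assume "g \<in> carrier G"
    from loc[OF this] obtain U where U: "openin (top_of_set (carrier G)) U" "g \<in> U"
      "\<And>x. x \<in> U \<Longrightarrow> p x \<in> angle_dom (\<zeta> g)" "\<And>x. x \<in> U \<Longrightarrow> \<zeta> x = local_angle (\<zeta> g) (p x)" by blast
    show "\<exists>U W y. openin (top_of_set (carrier G)) U \<and> g \<in> U \<and> open W \<and> p ` U \<subseteq> W \<and>
      smooth_on W y \<and> (\<forall>M\<in>W. \<exists>\<mu>. \<bar>\<mu>\<bar> \<le> 1 \<and> (y has_derivative (\<lambda>V. \<mu> * Im (cu V * cnj (cu M)) / (cmod (cu M))\<^sup>2)) (at M)) \<and>
      (\<forall>x\<in>U. f x = shifted_dist \<epsilon> y (p x))"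
    proof (intro exI[of _ U] exI[of _ "angle_dom (\<zeta> g)"] exI[of _ "local_angle (\<zeta> g)"] conjI ballI)
      show "p ` U \<subseteq> angle_dom (\<zeta> g)" using U(3) by blast
      show "\<exists>\<mu>. \<bar>\<mu>\<bar> \<le> 1 \<and> (local_angle (\<zeta> g) has_derivative (\<lambda>V. \<mu> * Im (cu V * cnj (cu M)) / (cmod (cu M))\<^sup>2)) (at M)"
        if "M \<in> angle_dom (\<zeta> g)" for M
        by (rule exI[of _ 1]) (use local_angle_has_derivative[OF that] in simp)
      show "f x = shifted_dist \<epsilon> (local_angle (\<zeta> g)) (p x)" if "x \<in> U" for x
        using U(4)[OF that] by (simp add: f_def shifted_dist_def)
    qed (rule U open_angle_dom local_angle_smooth)+
  qed
  then have "ereal \<bar>f \<one> - f (K (of_real (sinh r) * cis \<phi>, z))\<bar> \<le> cc_dist_cyl G p r \<phi> z"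
    unfolding cc_dist_cyl_eq_SUP by (intro SUP_upper) simp
  moreover have "\<zeta> \<one> = 0" using \<zeta>[of 0 0] by (simp add: K)
  ultimately show "ereal \<bar>Phi (sqrt (1 + \<epsilon>\<^sup>2)) 0 - Phi (sqrt ((cosh r)\<^sup>2 + \<epsilon>\<^sup>2)) z\<bar> \<le> cc_dist_cyl G p r \<phi> z"
    by (simp add: f_def shifted_cosh_K shifted_cosh_one \<zeta>)
qed

end

section \<open>The distance on SL(2,R)\<close>

interpretation SL2: covering_group SL2 id
proof (rule covering_group.intro)
  show "group SL2" by (rule group_SL2)
  show "continuous_on (carrier SL2 \<times> carrier SL2) (\<lambda>(x, y). x \<otimes>\<^bsub>SL2\<^esub> y)"
    by (simp add: case_prod_unfold) (intro continuous_intros)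
  show "id \<in> hom SL2 SL2" by (auto simp: hom_def group.is_monoid[OF group_SL2] monoid.m_closed)
  show "covering_space (carrier SL2) id (carrier SL2)"
    by (rule homeomorphism_imp_covering_space[of _ _ _ id]) (auto simp: homeomorphism_def continuous_on_id)
qed

lemma SL2_admissible:
  assumes "\<epsilon> > 0" "0 \<le> k" "k < 1"
  shows "SL2.admissible (shifted_dist \<epsilon> (rounded_angle k))"
proof (rule SL2.admissible_shifted_dist[OF assms(1)])
  fix g assume g: "g \<in> carrier SL2"
  have nz: "cu M \<noteq> 0" if "det M = 1" for M
  proof -
    have "cmod (cu M) > 0" unfolding cmod_cu[OF that] by (simp add: add_pos_nonneg)
    then show ?thesis by auto
  qed
  show "\<exists>U W y. openin (top_of_set (carrier SL2)) U \<and> g \<in> U \<and> open W \<and> id ` U \<subseteq> W \<and>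
      smooth_on W y \<and> (\<forall>M\<in>W. \<exists>\<mu>. \<bar>\<mu>\<bar> \<le> 1 \<and> (y has_derivative (\<lambda>V. \<mu> * Im (cu V * cnj (cu M)) / (cmod (cu M))\<^sup>2)) (at M)) \<and>
      (\<forall>x\<in>U. shifted_dist \<epsilon> (rounded_angle k) x = shifted_dist \<epsilon> y (id x))"
  proof (rule exI[of _ "carrier SL2"], rule exI[of _ "{M. cu M \<noteq> 0}"], rule exI[of _ "rounded_angle k"], intro conjI ballI)
    show "\<exists>\<mu>. \<bar>\<mu>\<bar> \<le> 1 \<and> (rounded_angle k has_derivative (\<lambda>V. \<mu> * Im (cu V * cnj (cu M)) / (cmod (cu M))\<^sup>2)) (at M)"
      if "M \<in> {M. cu M \<noteq> 0}" for M
      using rounded_angle_has_derivative[OF assms(2,3), of M] that by blast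
  qed (use g nz open_cu_nonzero rounded_angle_smooth[OF assms(2,3)] in auto)
qed

text \<open>First k \<rightarrow> 1 with epsilon fixed, then epsilon \<rightarrow> 0 inside
  \<open>cc_dist_cyl_eqI\<close>. The range of z enters through arccos (cos z) = |z|, and evenness
  of \<open>Phi\<close> removes the absolute value.\<close>

lemma SL2_cc_dist_cyl:
  assumes r: "r > 0" and z: "z \<in> {-pi..pi}"
  shows "cc_dist_cyl SL2 id r \<phi> z = ereal (cyl_dist r z)"
proof (rule SL2.cc_dist_cyl_eqI)
  show "0 \<le> r" using r by simp
  fix \<epsilon> :: real assume \<epsilon>: "\<epsilon> > 0"
  let ?M = "SL2.K (of_real (sinh r) * cis \<phi>, z)"
  let ?a = "sqrt (1 + \<epsilon>\<^sup>2)" and ?b = "sqrt ((cosh r)\<^sup>2 + \<epsilon>\<^sup>2)"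
  have a: "?a > 1" using \<epsilon> by simp
  have b: "?b > 1"
  proof (intro real_less_rsqrt)
    have "1 \<le> (cosh r)\<^sup>2" using cosh_real_ge_1[of r] by (rule one_le_power)
    moreover have "0 < \<epsilon>\<^sup>2" using \<epsilon> by simp
    ultimately show "1\<^sup>2 < (cosh r)\<^sup>2 + \<epsilon>\<^sup>2" unfolding one_power2 by linarith
  qed
  have K: "?M = kap (of_real (sinh r) * cis \<phi>, z)" using SL2.K(3) by simp
  have Re: "Re (cu ?M) / cmod (cu ?M) = cos z"
  proof -
    have "sqrt (1 + (cmod (of_real (sinh r) * cis \<phi>))\<^sup>2) > 0" by (simp add: add_pos_nonneg)
    then show ?thesis unfolding K cu_kap by (simp add: norm_mult)
  qed
  have ge: "ereal \<bar>Phi ?a (arccos k) - Phi ?b (arccos (k * cos z))\<bar> \<le> cc_dist_cyl SL2 id r \<phi> z" if k: "0 \<le> k" "k < 1" for k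
  proof -
    have "ereal \<bar>shifted_dist \<epsilon> (rounded_angle k) \<one>\<^bsub>SL2\<^esub> - shifted_dist \<epsilon> (rounded_angle k) ?M\<bar> \<le> cc_dist_cyl SL2 id r \<phi> z"
      unfolding SL2.cc_dist_cyl_eq_SUP using SL2_admissible[OF \<epsilon> k] by (intro SUP_upper) simp
    moreover have "shifted_dist \<epsilon> (rounded_angle k) \<one>\<^bsub>SL2\<^esub> = Phi ?a (arccos k)"
      using SL2.shifted_cosh_one[of \<epsilon>] by (simp add: shifted_dist_def rounded_angle_def)
    moreover have "shifted_dist \<epsilon> (rounded_angle k) ?M = Phi ?b (arccos (k * cos z))"
      using SL2.shifted_cosh_K[of \<epsilon> r \<phi> z] by (simp add: shifted_dist_def rounded_angle_def Re)
    ultimately show ?thesis by simp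
  qed
  have ev: "eventually (\<lambda>k::real. 0 \<le> k \<and> k < 1) (at_left 1)"
    by (rule eventually_mono[OF eventually_at_left_real[of 0 1]]) auto
  have arccos: "((\<lambda>k. arccos (k * cos x)) \<longlongrightarrow> arccos (1 * cos x)) (at_left 1)" for x
  proof (rule continuous_on_tendsto_compose[OF continuous_on_arccos'])
    show "((\<lambda>k. k * cos x) \<longlongrightarrow> 1 * cos x) (at_left 1)" by (intro tendsto_intros)
    have "k * cos x \<in> {-1..1}" if "0 \<le> k \<and> k < 1" for k
    proof -
      have "\<bar>k * cos x\<bar> \<le> 1" using that mult_mono[of k 1 "\<bar>cos x\<bar>" 1] by (simp add: abs_mult)
      then show ?thesis unfolding atLeastAtMost_iff abs_le_iff by linarith
    qed
    then show "eventually (\<lambda>k. k * cos x \<in> {-1..1}) (at_left 1)" by (rule eventually_mono[OF ev])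
  qed simp
  have "((\<lambda>k. Phi ?a (arccos k)) \<longlongrightarrow> Phi ?a 0) (at_left 1)"
    using arccos[of 0] by (intro Phi_tendsto a tendsto_const) simp
  moreover have "((\<lambda>k. Phi ?b (arccos (k * cos z))) \<longlongrightarrow> Phi ?b \<bar>z\<bar>) (at_left 1)"
  proof -
    have "arccos (1 * cos z) = \<bar>z\<bar>" using z arccos_cos[of "\<bar>z\<bar>"] by (auto simp: abs_le_iff)
    then show ?thesis using arccos[of z] by (intro Phi_tendsto b tendsto_const) simp
  qed
  ultimately have "((\<lambda>k. ereal \<bar>Phi ?a (arccos k) - Phi ?b (arccos (k * cos z))\<bar>) \<longlongrightarrow> ereal \<bar>Phi ?a 0 - Phi ?b \<bar>z\<bar>\<bar>) (at_left 1)"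
    by (intro tendsto_intros)
  then have "ereal \<bar>Phi ?a 0 - Phi ?b \<bar>z\<bar>\<bar> \<le> cc_dist_cyl SL2 id r \<phi> z"
    by (rule tendsto_upperbound) (auto intro: eventually_mono[OF ev] ge)
  moreover have "Phi ?b \<bar>z\<bar> = Phi ?b z" using Phi_minus[OF b, of z] by (simp add: abs_if)
  ultimately show "ereal \<bar>Phi ?a 0 - Phi ?b z\<bar> \<le> cc_dist_cyl SL2 id r \<phi> z" by simp
qed

text \<open>From z \<noteq> 0 follows \<theta> \<noteq> 0, hence sin \<theta> \<noteq> 0 on (-pi,
  pi), and the equation for \<theta> can be solved for the quotient occurring in
  \<open>Phi\<close>.\<close>

lemma Phi_square_theta:
  assumes r: "r > 0" and z: "z \<noteq> 0" and \<theta>: "theta_solution r z \<theta>"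
  shows "(Phi (cosh r) z)\<^sup>2 = (\<theta> - z)\<^sup>2 * (tanh r)\<^sup>2 / (sin \<theta>)\<^sup>2"
proof -
  have c: "cosh r > 1" using r cosh_real_strict_mono[of 0 r] by simp
  have dom: "theta_dom (cosh r) \<theta>" "theta_fun (cosh r) \<theta> = z" using \<theta> theta_solution_iff[OF r] by auto
  then have eq: "Theta (cosh r) z = \<theta>" by (rule Theta_eqI[OF c])
  have "\<theta> \<noteq> 0" using dom(2) z by (auto simp: theta_fun_def)
  then have s: "sin \<theta> \<noteq> 0"
    using dom(1) sin_gt_zero[of \<theta>] sin_gt_zero[of "- \<theta>"] by (cases "\<theta> > 0") (auto simp: theta_dom_def)
  define q where "q = arcosh_quot (cosh r * cos \<theta>)"
  have "\<theta> - z = cosh r * sin \<theta> * q" using dom(2) by (simp add: theta_fun_def q_def)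
  moreover have "Phi (cosh r) z = sinh r * q" using r by (simp add: Phi_def eq q_def cosh_square_eq)
  ultimately show ?thesis using s by (simp add: tanh_def power_mult_distrib power_divide)
qed

theorem mainTheorem9:
  fixes G :: "('g::topological_space) monoid" and p :: "'g \<Rightarrow> real^2^2"
  assumes "universal_covering_group G p"
  shows
    "(\<forall>z. \<forall>\<phi>\<in>{0..2*pi}. (cc_dist_cyl G p 0 \<phi> z)\<^sup>2 = ereal (2 * pi * \<bar>z\<bar> + z\<^sup>2)) \<and>
     (\<forall>r>0. \<forall>\<phi>\<in>{0..2*pi}. (cc_dist_cyl G p r \<phi> 0)\<^sup>2 = ereal (r\<^sup>2)) \<and>
     (\<forall>r>0. \<forall>z. z \<noteq> 0 \<longrightarrow>
        (\<exists>!\<theta>. theta_solution r z \<theta>) \<and>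
        (\<forall>\<theta>. theta_solution r z \<theta> \<longrightarrow>
           (\<forall>\<phi>\<in>{0..2*pi}. (cc_dist_cyl G p r \<phi> z)\<^sup>2 =
              ereal ((\<theta> - z)\<^sup>2 * (tanh r)\<^sup>2 / (sin \<theta>)\<^sup>2)))) \<and>
     (\<forall>r>0. \<forall>z\<in>{-pi..pi}. \<forall>\<phi>\<in>{0..2*pi}. \<forall>\<psi>\<in>{0..2*pi}.
        cc_dist_cyl SL2 id r \<phi> z = cc_dist_cyl G p r \<psi> z)"
proof -
  interpret covering_group G p
    by (rule covering_group.intro) (use assms in \<open>auto simp: universal_covering_group_def\<close>)
  have sc: "simply_connected (carrier G)" using assms by (simp add: universal_covering_group_def)
  note dist = cc_dist_cyl_simply_connected[OF sc]
  have "(cc_dist_cyl G p 0 \<phi> z)\<^sup>2 = ereal (2 * pi * \<bar>z\<bar> + z\<^sup>2)" for \<phi> z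
    by (simp add: dist cyl_dist_def)
  moreover have "(cc_dist_cyl G p r \<phi> 0)\<^sup>2 = ereal (r\<^sup>2)" if "r > 0" for r \<phi>
    using that by (simp add: dist cyl_dist_def Phi_0)
  moreover have "\<exists>!\<theta>. theta_solution r z \<theta>" if "r > 0" for r z
  proof -
    have "cosh r > 1" using that cosh_real_strict_mono[of 0 r] by simp
    then show ?thesis using theta_fun_ex1[of "cosh r" z] by (simp add: theta_solution_iff[OF that])
  qed
  moreover have "(cc_dist_cyl G p r \<phi> z)\<^sup>2 = ereal ((\<theta> - z)\<^sup>2 * (tanh r)\<^sup>2 / (sin \<theta>)\<^sup>2)"
    if "r > 0" "z \<noteq> 0" "theta_solution r z \<theta>" for r z \<theta> \<phi>
    using that(1) by (simp add: dist cyl_dist_def Phi_square_theta[OF that])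
  moreover have "cc_dist_cyl SL2 id r \<phi> z = cc_dist_cyl G p r \<psi> z" if "r > 0" "z \<in> {-pi..pi}" for r z \<phi> \<psi>
    using that by (simp add: dist SL2_cc_dist_cyl)
  ultimately show ?thesis by blast
qed

end
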